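(* Let $G$ be a graph with maximum degree $\Delta(G) \le 4$ and let $\lambda \ge 2$ be an integer. Then: (a) if $M$ is a matching in $G$ (viewed as a spanning subgraph), then $BBC_\lambda(G, M) \le 2\lambda + 1$; (b) if $H$ is a $1$-degenerate spanning subgraph of $G$, then $BBC_\lambda(G, H) \le 2\lambda + 2$. The respective colorings (a $\lambda$-backbone $(2\lambda+1)$-coloring in (a), a $\lambda$-backbone $(2\lambda+2)$-coloring in (b)) can be found in $\mathcal{O}(n)$ time, where $n = |V(G)|$.
   Context: A graph is $d$-degenerate if every induced subgraph of it contains a vertex of degree at most $d$. For an integer $\lambda \ge 2$, a graph $G$ and a spanning subgraph $H$ of $G$ (the backbone; $E(H) \subseteq E(G)$), a $\lambda$-backbone coloring of $G$ with backbone $H$ is a function $c\colon V(G) \to \mathbb{N}_+$ with $c(u) \ne c(v)$ for every $\{u,v\} \in E(G)$ and $|c(u) - c(v)| \ge \lambda$ for every $\{u,v\} \in E(H)$; it is a $\lambda$-backbone $k$-coloring if all colors lie in $\{1,\ldots,k\}$. $BBC_\lambda(G,H)$ is the smallest $k$ for which a $\lambda$-backbone $k$-coloring exists. *)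

theory Defs
  imports Complex_Main "HOL-Library.Landau_Symbols" "HOL-Library.Disjoint_Sets"
begin

record 'a ugraph =
  verts :: "'a set"
  edges :: "'a set set"

definition simple_graph :: "'a ugraph \<Rightarrow> bool" where
  "simple_graph G \<longleftrightarrow> finite (verts G) \<and> (\<forall>e\<in>edges G. e \<subseteq> verts G \<and> card e = 2)"

definition degree :: "'a ugraph \<Rightarrow> 'a \<Rightarrow> nat" where
  "degree G v = card {e \<in> edges G. v \<in> e}"

text \<open>The inserted \<open>0\<close> only matters for the graph without vertices.\<close>

definition max_degree :: "'a ugraph \<Rightarrow> nat" where
  "max_degree G = Max (insert 0 (degree G ` verts G))"

definition induced_subgraph :: "'a ugraph \<Rightarrow> 'a set \<Rightarrow> 'a ugraph" where
  "induced_subgraph G S = \<lparr>verts = S, edges = {e \<in> edges G. e \<subseteq> S}\<rparr>"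

definition degenerate :: "nat \<Rightarrow> 'a ugraph \<Rightarrow> bool" where
  "degenerate d G \<longleftrightarrow>
     (\<forall>S. S \<subseteq> verts G \<and> S \<noteq> {} \<longrightarrow> (\<exists>v\<in>S. degree (induced_subgraph G S) v \<le> d))"

definition spanning_subgraph :: "'a ugraph \<Rightarrow> 'a ugraph \<Rightarrow> bool" where
  "spanning_subgraph H G \<longleftrightarrow> verts H = verts G \<and> edges H \<subseteq> edges G"

definition matching :: "'a ugraph \<Rightarrow> 'a set set \<Rightarrow> bool" where
  "matching G M \<longleftrightarrow> M \<subseteq> edges G \<and> pairwise disjnt M"

definition spanned_by :: "'a ugraph \<Rightarrow> 'a set set \<Rightarrow> 'a ugraph" where
  "spanned_by G M = \<lparr>verts = verts G, edges = M\<rparr>"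

definition backbone_coloring :: "nat \<Rightarrow> 'a ugraph \<Rightarrow> 'a ugraph \<Rightarrow> ('a \<Rightarrow> nat) \<Rightarrow> bool" where
  "backbone_coloring lam G H c \<longleftrightarrow>
     (\<forall>v\<in>verts G. 1 \<le> c v) \<and>
     (\<forall>u v. {u, v} \<in> edges G \<longrightarrow> c u \<noteq> c v) \<and>
     (\<forall>u v. {u, v} \<in> edges H \<longrightarrow> int lam \<le> \<bar>int (c u) - int (c v)\<bar>)"

definition backbone_k_coloring ::
    "nat \<Rightarrow> nat \<Rightarrow> 'a ugraph \<Rightarrow> 'a ugraph \<Rightarrow> ('a \<Rightarrow> nat) \<Rightarrow> bool" where
  "backbone_k_coloring lam k G H c \<longleftrightarrow>
     backbone_coloring lam G H c \<and> (\<forall>v\<in>verts G. c v \<in> {1..k})"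

definition BBC :: "nat \<Rightarrow> 'a ugraph \<Rightarrow> 'a ugraph \<Rightarrow> nat" where
  "BBC lam G H = (LEAST k. \<exists>c. backbone_k_coloring lam k G H c)"

text \<open>
  Running time is measured on a uniform-cost random access machine, presented as a structured
  while language. The memory consists of arrays of natural numbers; a program names its arrays
  by literals, so it uses only finitely many of them, while indices are computed. The only
  arithmetic operations are addition and truncated subtraction, and every node of an evaluated
  expression and every executed command other than sequencing costs one time unit. In
  conditionals and loops a test succeeds iff its value is nonzero.
\<close>

type_synonym store = "nat \<Rightarrow> nat \<Rightarrow> nat"

datatype aexp = Const nat | Cell nat aexp | Add aexp aexp | Sub aexp aexp

fun aval :: "aexp \<Rightarrow> store \<Rightarrow> nat" where
  "aval (Const k) s = k"
| "aval (Cell a i) s = s a (aval i s)"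
| "aval (Add x y) s = aval x s + aval y s"
| "aval (Sub x y) s = aval x s - aval y s"

fun acost :: "aexp \<Rightarrow> nat" where
  "acost (Const k) = 1"
| "acost (Cell a i) = 1 + acost i"
| "acost (Add x y) = 1 + acost x + acost y"
| "acost (Sub x y) = 1 + acost x + acost y"

datatype com =
    Skip
  | Assign nat aexp aexp
  | Seq com com
  | Cond aexp com com
  | Loop aexp com

text \<open>\<open>exec p s t s'\<close>: started in \<open>s\<close>, the program \<open>p\<close> halts in \<open>s'\<close> after \<open>t\<close> time units.\<close>

inductive exec :: "com \<Rightarrow> store \<Rightarrow> nat \<Rightarrow> store \<Rightarrow> bool" where
  exec_Skip: "exec Skip s 1 s"
| exec_Assign:
    "exec (Assign a i x) s (1 + acost i + acost x) (s(a := (s a)(aval i s := aval x s)))"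
| exec_Seq:
    "exec p s t s' \<Longrightarrow> exec q s' t' s'' \<Longrightarrow> exec (Seq p q) s (t + t') s''"
| exec_CondTrue:
    "aval b s \<noteq> 0 \<Longrightarrow> exec p s t s' \<Longrightarrow> exec (Cond b p q) s (1 + acost b + t) s'"
| exec_CondFalse:
    "aval b s = 0 \<Longrightarrow> exec q s t s' \<Longrightarrow> exec (Cond b p q) s (1 + acost b + t) s'"
| exec_LoopFalse:
    "aval b s = 0 \<Longrightarrow> exec (Loop b p) s (1 + acost b) s"
| exec_LoopTrue:
    "aval b s \<noteq> 0 \<Longrightarrow> exec p s t s' \<Longrightarrow> exec (Loop b p) s' t' s'' \<Longrightarrow>
     exec (Loop b p) s (1 + acost b + t + t') s''"

inductive_cases exec_SkipE: "exec Skip s t s'"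
inductive_cases exec_AssignE: "exec (Assign a i x) s t s'"
inductive_cases exec_SeqE: "exec (Seq p q) s t s'"
inductive_cases exec_CondE: "exec (Cond b p q) s t s'"
inductive_cases exec_LoopE: "exec (Loop b p) s t s'"

lemma exec_deterministic:
  "exec p s t s' \<Longrightarrow> exec p s u r \<Longrightarrow> t = u \<and> s' = r"
proof (induction arbitrary: u r rule: exec.induct)
  case (exec_Skip s)
  then show ?case by (auto elim: exec_SkipE)
next
  case (exec_Assign a i x s)
  then show ?case by (auto elim: exec_AssignE)
next
  case (exec_Seq p s t s' q t' s'')
  from exec_Seq.prems obtain t1 r1 t2
    where "exec p s t1 r1" "exec q r1 t2 r" "u = t1 + t2" by (rule exec_SeqE)
  with exec_Seq.IH show ?case by metis
next
  case (exec_CondTrue b s p t s' q)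
  from exec_CondTrue.prems exec_CondTrue.hyps(1) obtain t1
    where "exec p s t1 r" "u = 1 + acost b + t1" by (auto elim: exec_CondE)
  with exec_CondTrue.IH show ?case by metis
next
  case (exec_CondFalse b s q t s' p)
  from exec_CondFalse.prems exec_CondFalse.hyps(1) obtain t1
    where "exec q s t1 r" "u = 1 + acost b + t1" by (auto elim: exec_CondE)
  with exec_CondFalse.IH show ?case by metis
next
  case (exec_LoopFalse b s p)
  then show ?case by (auto elim: exec_LoopE)
next
  case (exec_LoopTrue b s p t s' t' s'')
  from exec_LoopTrue.prems obtain t1 r1 t2
    where "exec p s t1 r1" "exec (Loop b p) r1 t2 r" "u = 1 + acost b + t1 + t2"
    by (rule exec_LoopE) (use exec_LoopTrue.hyps(1) in auto)
  with exec_LoopTrue.IH show ?case by metis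
qed

definition adjacency_lists :: "nat ugraph \<Rightarrow> nat list list \<Rightarrow> bool" where
  "adjacency_lists G adj \<longleftrightarrow>
     verts G = {..<length adj} \<and>
     (\<forall>v<length adj. distinct (adj ! v) \<and> set (adj ! v) = {u. {v, u} \<in> edges G})"

definition array_of :: "nat list \<Rightarrow> nat \<Rightarrow> nat" where
  "array_of xs i = (if i < length xs then xs ! i else 0)"

text \<open>
  Adjacency lists are stored consecutively in one array; the list of vertex \<open>v\<close> occupies the
  positions from \<open>offsets adj ! v\<close> (inclusive) to \<open>offsets adj ! (v + 1)\<close> (exclusive).
\<close>

definition offsets :: "nat list list \<Rightarrow> nat list" where
  "offsets adj = map (\<lambda>v. length (concat (take v adj))) [0..<length adj + 1]"

definition input_store :: "nat \<Rightarrow> nat list list \<Rightarrow> nat list list \<Rightarrow> store" where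
  "input_store lam adjG adjH =
     (\<lambda>_ _. 0)
       (0 := array_of [length adjG, lam],
        1 := array_of (offsets adjG),
        2 := array_of (concat adjG),
        3 := array_of (offsets adjH),
        4 := array_of (concat adjH))"

text \<open>
  On every presentation of \<open>G\<close> and \<open>H\<close> by adjacency lists, \<open>p\<close> halts within \<open>T n\<close> time units,
  where \<open>n\<close> is the number of vertices, leaving in array \<open>5\<close> (indexed by the vertices) a
  backbone coloring with at most \<open>k\<close> colors.
\<close>

definition finds_coloring_in_time ::
    "com \<Rightarrow> (nat \<Rightarrow> nat) \<Rightarrow> nat \<Rightarrow> nat \<Rightarrow> nat ugraph \<Rightarrow> nat ugraph \<Rightarrow> bool" where
  "finds_coloring_in_time p T lam k G H \<longleftrightarrow>
     (\<forall>adjG adjH. adjacency_lists G adjG \<and> adjacency_lists H adjH \<longrightarrow>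
        (\<exists>t s. exec p (input_store lam adjG adjH) t s \<and> t \<le> T (card (verts G)) \<and>
               backbone_k_coloring lam k G H (s 5)))"

end

theory Submission imports Defs begin

text \<open>
  The color map sending 1, 2, 3, 4, 5, 6 to 1, 2, $\lambda+1$, $\lambda+2$, $2\lambda+1$, $2\lambda+2$
  turns distance at least 2 into distance at least $\lambda$, so it suffices to treat $\lambda = 2$, with
  five colors for a matching and six for a forest.

  Colors are assigned in two passes. First the vertices are eliminated one after the other: if \<open>a\<close> is
  the least color left in the list of \<open>v\<close>, then \<open>v\<close> deletes \<open>a\<close> from the lists of its remaining
  ordinary neighbors and \<open>a + 1\<close> from the list of its remaining backbone neighbor \<open>p\<close>, of which there
  is at most one. In the second pass the vertices are colored in reverse order from their lists.
  Then \<open>v\<close> may take \<open>a\<close>, unless \<open>p\<close> has color \<open>a - 1\<close> or \<open>a\<close> and so excludes at most the colors \<open>a\<close> and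
  \<open>a + 1\<close> from the list of \<open>v\<close>; hence a list with three colors more than \<open>v\<close> has remaining ordinary
  neighbors is long enough. With six colors and degree at most four, each vertex deletes only one
  color per neighbor, and eliminating leaves of the forest keeps all lists long enough.

  With five colors the lists are shorter by one, and \<open>v\<close> deletes \<open>a\<close> from the list of \<open>p\<close> too, unless
  \<open>a + 1\<close> is missing in its own list. This is affordable if the second endpoint of every matching edge
  has degree at most three or still has a remaining neighbor when it is eliminated, as it is the case
  for the reverse of a graph search started at all unmatched vertices and all vertices of degree at most
  three. A component without such vertices is 4-regular and perfectly matched. In it there are a
  matching edge \<open>xy\<close> and a neighbor \<open>u\<close> of \<open>x\<close> whose removal leaves the component connected. Color
  \<open>x\<close> and \<open>y\<close> with 2 and 4 and eliminate \<open>u\<close> first: as its list contains 1 but not 2, the partner of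
  \<open>u\<close> loses only the color 2 and can serve as the start of the search.
\<close>

section \<open>Straight-line programs and loops\<close>

text \<open>The count is tight: five colors minus one for each of four neighbors leaves one. Only a
  vertex that loses two colors to its partner can end up with an empty list, and every device for
  five colors saves just that one color: a missing neighbor, a neighbor still to be eliminated, or a
  partner whose two deletions coincide. The last is what the precoloring buys: \<open>u\<close> has
  the values 1 and 2 = 1 + 1, so its partner loses nothing besides 2. Precolored neighbors cost one
  color each, like eliminated ones. The removable vertices are found in linear time by a
  breadth-first search that treats each matching edge as one node and numbers these edges. Edges
  numbered beyond the last one that discovered anything ("late" edges) are leaves of the search tree
  and can be taken away. If two late edges are joined, \<open>x\<close> and \<open>u\<close> are
  chosen on them. Otherwise \<open>u\<close> is the last discoverer and \<open>x\<close> the vertex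
  it discovered last; then each late vertex has four neighbors, at most three of them on its own
  edge and that of \<open>u\<close>, and a fourth one links it to the earlier edges.\<close>

fun straight :: "com \<Rightarrow> bool" where
  "straight (Seq p q) \<longleftrightarrow> straight p \<and> straight q"
| "straight (Cond b p q) \<longleftrightarrow> straight p \<and> straight q"
| "straight (Loop b p) \<longleftrightarrow> False"
| "straight _ \<longleftrightarrow> True"

fun ev :: "com \<Rightarrow> store \<Rightarrow> store" where
  "ev Skip s = s"
| "ev (Assign a i x) s = s(a := (s a)(aval i s := aval x s))"
| "ev (Seq p q) s = ev q (ev p s)"
| "ev (Cond b p q) s = (if aval b s \<noteq> 0 then ev p s else ev q s)"
| "ev (Loop b p) s = s"

text \<open>A conditional is charged with both branches, so the bound is a constant that does not
  depend on the store.\<close>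

fun cost :: "com \<Rightarrow> nat" where
  "cost Skip = 1"
| "cost (Assign a i x) = 1 + acost i + acost x"
| "cost (Seq p q) = cost p + cost q"
| "cost (Cond b p q) = 1 + acost b + (cost p + cost q)"
| "cost (Loop b p) = 0"

fun writes :: "com \<Rightarrow> nat set" where
  "writes Skip = {}"
| "writes (Assign a i x) = {a}"
| "writes (Seq p q) = writes p \<union> writes q"
| "writes (Cond b p q) = writes p \<union> writes q"
| "writes (Loop b p) = {}"

lemma ev_frame: "k \<notin> writes p \<Longrightarrow> ev p s k = s k"
  by (induction p arbitrary: s) auto

lemma exec_straight: "straight p \<Longrightarrow> \<exists>t\<le>cost p. exec p s t (ev p s)"
proof (induction p arbitrary: s)
  case Skip
  show ?case unfolding ev.simps cost.simps using exec_Skip by blast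
next
  case (Assign a i x)
  show ?case unfolding ev.simps cost.simps using exec_Assign by blast
next
  case (Seq p q)
  then obtain t t' where "t \<le> cost p" "exec p s t (ev p s)"
    "t' \<le> cost q" "exec q (ev p s) t' (ev q (ev p s))" by (metis straight.simps(1))
  then show ?case unfolding ev.simps cost.simps by (meson add_mono exec_Seq)
next
  case (Cond b p q)
  obtain t t' where *: "t \<le> cost p" "exec p s t (ev p s)" "t' \<le> cost q" "exec q s t' (ev q s)"
    using Cond by (metis straight.simps(2))
  then have b: "1 + acost b + t \<le> cost (Cond b p q)" "1 + acost b + t' \<le> cost (Cond b p q)" by auto
  show ?case
  proof (cases "aval b s = 0")
    case True
    then have "exec (Cond b p q) s (1 + acost b + t') (ev (Cond b p q) s)"
      using exec_CondFalse[OF True *(4), of p] by (simp only: ev.simps if_False not_True_eq_False refl simp_thms)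
    with b show ?thesis by (intro exI conjI)
  next
    case False
    then have "exec (Cond b p q) s (1 + acost b + t) (ev (Cond b p q) s)"
      using exec_CondTrue[OF False *(2), of q] by (simp only: ev.simps if_True not_False_eq_True)
    with b show ?thesis by (intro exI conjI)
  qed
qed simp

definition runs :: "com \<Rightarrow> store \<Rightarrow> nat \<Rightarrow> (store \<Rightarrow> bool) \<Rightarrow> bool" where
  "runs p s T Q \<longleftrightarrow> (\<exists>t s'. exec p s t s' \<and> t \<le> T \<and> Q s')"

lemma runs_straight: "straight p \<Longrightarrow> Q (ev p s) \<Longrightarrow> cost p \<le> T \<Longrightarrow> runs p s T Q"
  unfolding runs_def using exec_straight[of p s] by (metis le_trans)

lemma runs_Seq:
  assumes "runs p s T Q" "\<And>s'. Q s' \<Longrightarrow> runs q s' T' R"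
  shows "runs (Seq p q) s (T + T') R"
proof -
  from assms(1) obtain t s' where 1: "exec p s t s'" "t \<le> T" "Q s'" unfolding runs_def by auto
  from assms(2)[OF 1(3)] obtain t' s'' where 2: "exec q s' t' s''" "t' \<le> T'" "R s''"
    unfolding runs_def by auto
  show ?thesis unfolding runs_def
    using exec_Seq[OF 1(1) 2(1)] add_mono[OF 1(2) 2(2)] 2(3) by (intro exI conjI)
qed

lemma runs_Seq_straight:
  assumes "straight p" "ev p s = s'" "runs q s' T R" "cost p \<le> C"
  shows "runs (Seq p q) s (C + T) R"
  using assms by (intro runs_Seq[where Q = "\<lambda>t. t = s'"]) (simp_all add: runs_straight)

text \<open>The measure drops in every iteration, and the summand 1 pays for the final failing test.
  Since the body is straight-line, one constant prices all iterations.\<close>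

lemma runs_Loop:
  fixes \<mu> :: "store \<Rightarrow> nat"
  assumes "straight p" "I s"
    and step: "\<And>s. I s \<Longrightarrow> aval b s \<noteq> 0 \<Longrightarrow> I (ev p s) \<and> \<mu> (ev p s) < \<mu> s"
  shows "runs (Loop b p) s ((1 + acost b + cost p) * (\<mu> s + 1)) (\<lambda>s'. I s' \<and> aval b s' = 0)"
  using \<open>I s\<close>
proof (induction "\<mu> s" arbitrary: s rule: less_induct)
  case less
  show ?case
  proof (cases "aval b s = 0")
    case True
    then have "exec (Loop b p) s (1 + acost b) s" by (rule exec_LoopFalse)
    moreover have "1 + acost b \<le> (1 + acost b + cost p) * (\<mu> s + 1)" by simp
    ultimately show ?thesis using less.prems True unfolding runs_def by (intro exI conjI)
  next
    case False
    note st = step[OF less.prems False]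
    obtain t where t: "t \<le> cost p" "exec p s t (ev p s)" using exec_straight[OF \<open>straight p\<close>] by blast
    obtain t' s' where t': "exec (Loop b p) (ev p s) t' s'"
      "t' \<le> (1 + acost b + cost p) * (\<mu> (ev p s) + 1)" "I s'" "aval b s' = 0"
      using less.hyps[of "ev p s"] st by (auto simp: runs_def)
    have "exec (Loop b p) s (1 + acost b + t + t') s'"
      using exec_LoopTrue[OF False t(2) t'(1)] .
    moreover have "1 + acost b + t + t' \<le> (1 + acost b + cost p) * (\<mu> s + 1)"
    proof -
      have "1 + acost b + t + t' \<le> (1 + acost b + cost p) * (\<mu> (ev p s) + 1 + 1)"
        using t(1) t'(2) by (simp add: algebra_simps)
      also have "\<dots> \<le> (1 + acost b + cost p) * (\<mu> s + 1)"
        using st by (intro mult_left_mono) auto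
      finally show ?thesis .
    qed
    ultimately show ?thesis using t'(3,4) unfolding runs_def by (intro exI conjI)
  qed
qed

lemma runs_weaken: "runs p s T Q \<Longrightarrow> T \<le> T' \<Longrightarrow> (\<And>s. Q s \<Longrightarrow> R s) \<Longrightarrow> runs p s T' R"
  unfolding runs_def by (elim exE conjE, intro exI conjI) (assumption, auto)

abbreviation var :: "nat \<Rightarrow> aexp" where "var x \<equiv> Cell x (Const 0)"
abbreviation set_var :: "nat \<Rightarrow> aexp \<Rightarrow> com" where "set_var x e \<equiv> Assign x (Const 0) e"
abbreviation incr :: "nat \<Rightarrow> com" where "incr x \<equiv> set_var x (Add (var x) (Const 1))"

definition neq :: "aexp \<Rightarrow> aexp \<Rightarrow> aexp" where "neq x y = Add (Sub x y) (Sub y x)"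

lemma aval_neq [simp]: "aval (neq x y) s = 0 \<longleftrightarrow> aval x s = aval y s"
  by (auto simp: neq_def)

text \<open>
  For a vertex of degree at most four, \<open>for_adj\<close> runs \<open>p\<close> with variable \<open>w\<close> ranging over the list
  of vertex \<open>var 20\<close> in the adjacency structure held by the arrays \<open>off\<close> and \<open>dat\<close>. The
  iteration is unrolled, so that loop bodies containing it take constant time.
\<close>

definition adj_item :: "nat \<Rightarrow> nat \<Rightarrow> nat \<Rightarrow> com \<Rightarrow> nat \<Rightarrow> com" where
  "adj_item off dat w p i =
     Cond (Sub (Sub (Cell off (Add (var 20) (Const 1))) (Cell off (var 20))) (Const i))
       (Seq (set_var w (Cell dat (Add (Cell off (var 20)) (Const i)))) p) Skip"

definition for_adj :: "nat \<Rightarrow> nat \<Rightarrow> nat \<Rightarrow> com \<Rightarrow> com" where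
  "for_adj off dat w p = Seq (adj_item off dat w p 0) (Seq (adj_item off dat w p 1)
     (Seq (adj_item off dat w p 2) (adj_item off dat w p 3)))"

lemma straight_for_adj [simp]: "straight (for_adj off dat w p) \<longleftrightarrow> straight p"
  by (auto simp: for_adj_def adj_item_def)

lemma writes_for_adj [simp]: "writes (for_adj off dat w p) = insert w (writes p)"
  by (auto simp: for_adj_def adj_item_def)

lemma length_offsets [simp]: "length (offsets adj) = Suc (length adj)"
  by (simp add: offsets_def)

lemma offsets_nth: "v \<le> length adj \<Longrightarrow> array_of (offsets adj) v = length (concat (take v adj))"
  by (simp add: array_of_def offsets_def nth_append del: upt_Suc)

lemma offsets_diff:
  "v < length adj \<Longrightarrow> array_of (offsets adj) (Suc v) = array_of (offsets adj) v + length (adj ! v)"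
  by (simp add: offsets_nth take_Suc_conv_app_nth)

lemma array_of_concat:
  assumes "v < length adj" "i < length (adj ! v)"
  shows "array_of (concat adj) (array_of (offsets adj) v + i) = adj ! v ! i"
proof -
  have "adj = take v adj @ adj ! v # drop (Suc v) adj" using assms by (simp add: id_take_nth_drop)
  then have "concat adj = concat (take v adj) @ adj ! v @ concat (drop (Suc v) adj)"
    by (metis concat.simps(2) concat_append)
  then have "concat adj ! (length (concat (take v adj)) + i) = adj ! v ! i"
    "length (concat (take v adj)) + i < length (concat adj)"
    using assms(2) by (simp_all only: nth_append_length_plus nth_append_left length_append)
  then show ?thesis using assms(1) by (simp only: array_of_def[of "concat adj"] offsets_nth[OF less_imp_le[OF assms(1)]] if_True)
qed

text \<open>The invariant is indexed by the set of neighbors handled so far, not by a position in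
  the list. The frame condition given to \<open>step\<close> makes everything available that the
  iteration does not write, such as the input arrays and the current vertex.\<close>

lemma for_adj_rule:
  assumes off: "s off = array_of (offsets adj)" and dat: "s dat = array_of (concat adj)"
    and v: "s 20 0 = v" "v < length adj" "length (adj ! v) \<le> 4" "distinct (adj ! v)"
    and fr: "{off, dat, 20} \<inter> writes p = {}" "w \<notin> {off, dat, 20}"
    and init: "I {} s"
    and step: "\<And>D x t. x \<in> set (adj ! v) \<Longrightarrow> x \<notin> D \<Longrightarrow> D \<subseteq> set (adj ! v) \<Longrightarrow> I D t \<Longrightarrow>
      (\<forall>k. k \<notin> insert w (writes p) \<longrightarrow> t k = s k) \<Longrightarrow>
      I (insert x D) (ev p (t(w := (t w)(0 := x))))"
  shows "I (set (adj ! v)) (ev (for_adj off dat w p) s)"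
proof -
  let ?xs = "adj ! v"
  define J where "J i t \<longleftrightarrow> I (set (take i ?xs)) t \<and> (\<forall>k. k \<notin> insert w (writes p) \<longrightarrow> t k = s k)" for i t
  have item: "J (Suc i) (ev (adj_item off dat w p i) t)" if "J i t" for i t
  proof -
    have eqs: "t off = s off" "t dat = s dat" "t 20 = s 20" using that fr by (auto simp: J_def)
    have deg: "s off (Suc v) - s off v = length ?xs" using v by (simp add: off offsets_diff)
    show ?thesis
    proof (cases "i < length ?xs")
      case True
      have x: "s dat (s off v + i) = ?xs ! i" using v True by (simp add: off dat array_of_concat)
      have "ev (adj_item off dat w p i) t = ev p (t(w := (t w)(0 := ?xs ! i)))"
        using True deg x v eqs by (simp add: adj_item_def)
      moreover have "I (insert (?xs ! i) (set (take i ?xs))) (ev p (t(w := (t w)(0 := ?xs ! i))))"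
        using that True v(4) unfolding J_def
        by (intro step) (auto simp: in_set_conv_nth nth_eq_iff_index_eq dest: in_set_takeD)
      moreover have "ev p (t(w := (t w)(0 := ?xs ! i))) k = s k" if "k \<notin> insert w (writes p)" for k
        using that \<open>J i t\<close> by (auto simp: J_def ev_frame)
      ultimately show ?thesis using True by (simp add: J_def take_Suc_conv_app_nth)
    next
      case False
      then have "ev (adj_item off dat w p i) t = t" using deg v eqs by (simp add: adj_item_def)
      then show ?thesis using that False by (simp add: J_def)
    qed
  qed
  have "J 0 s" by (simp add: J_def init)
  then have "J 4 (ev (for_adj off dat w p) s)"
    unfolding for_adj_def using item[of 0] item[of 1] item[of 2] item[of 3]
    by (simp add: numeral_eq_Suc)
  then show ?thesis using v by (simp add: J_def)
qed

section \<open>List coloring in two passes\<close>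

text \<open>
  Memory layout: array 5 is the output, 6 holds the colors from \<open>{1..6}\<close> (\<open>0\<close>: none yet), 7 and 8
  the values \<open>a\<close> and \<open>b\<close> of the elimination pass (\<open>a w = 0\<close>: \<open>w\<close> not eliminated), 9 the order, which
  is eliminated from the last position to the first, 10 the forbidden colors of the current vertex,
  11 the table of \<open>stretch\<close>, and 12 the visited vertices. Arrays 13 to 18 hold the data of
  \<open>pair_inv\<close>. Arrays from 20 on are variables, used at index 0 only: 20 is the current
  vertex, 21 a neighbor of it, and 26 the length of the order.

  An eliminated backbone neighbor \<open>w\<close> forbids \<open>a w + 1\<close> and \<open>b w\<close>, where \<open>b w\<close> is \<open>a w\<close> or
  \<open>a w + 1\<close>.
\<close>

definition forb :: "(nat \<Rightarrow> nat) \<Rightarrow> (nat \<Rightarrow> nat) \<Rightarrow> (nat \<Rightarrow> nat) \<Rightarrow> bool \<Rightarrow> nat \<Rightarrow> nat \<Rightarrow> bool" where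
  "forb col a b h w c \<longleftrightarrow>
     (if col w \<noteq> 0 then c = col w \<or> h \<and> (c = col w + 1 \<or> c + 1 = col w)
      else a w \<noteq> 0 \<and> (if h then c = a w + 1 \<or> c = b w else c = a w))"

definition clear :: com where
  "clear = Seq (Assign 10 (Const 1) (Const 0)) (Seq (Assign 10 (Const 2) (Const 0))
     (Seq (Assign 10 (Const 3) (Const 0)) (Seq (Assign 10 (Const 4) (Const 0))
     (Seq (Assign 10 (Const 5) (Const 0)) (Assign 10 (Const 6) (Const 0))))))"

definition test_backbone :: com where
  "test_backbone = Seq (set_var 22 (Const 0))
     (for_adj 3 4 23 (Cond (neq (var 23) (var 21)) Skip (set_var 22 (Const 1))))"

text \<open>A neighbor with a color acts through its color even if it has been eliminated. Hence the
  same code serves both passes: in the second one, vertices already colored act by their colors and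
  the others by what they deleted in the first pass. Below color 1 the decrement hits index 0, which
  stands for no color.\<close>

definition mark :: com where
  "mark = Seq test_backbone
    (Cond (Cell 6 (var 21))
       (Seq (Assign 10 (Cell 6 (var 21)) (Const 1))
         (Cond (var 22)
           (Seq (Assign 10 (Add (Cell 6 (var 21)) (Const 1)) (Const 1))
                (Assign 10 (Sub (Cell 6 (var 21)) (Const 1)) (Const 1))) Skip))
       (Cond (Cell 7 (var 21))
         (Cond (var 22)
           (Seq (Assign 10 (Add (Cell 7 (var 21)) (Const 1)) (Const 1))
                (Assign 10 (Cell 8 (var 21)) (Const 1)))
           (Assign 10 (Cell 7 (var 21)) (Const 1))) Skip))"

text \<open>The last color is taken without a test, so the result stays in the palette even for an
  empty list.\<close>

fun pick :: "nat \<Rightarrow> nat \<Rightarrow> com" where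
  "pick c 0 = set_var 25 (Const c)"
| "pick c (Suc k) = Cond (Cell 10 (Const c)) (pick (Suc c) k) (set_var 25 (Const c))"

definition choose_color :: "nat \<Rightarrow> com" where
  "choose_color K = Seq clear (Seq (for_adj 1 2 21 mark) (pick 1 (K - 1)))"

lemma straight_pick [simp]: "straight (pick c k)" by (induction k arbitrary: c) auto
lemma writes_pick [simp]: "writes (pick c k) = {25}" by (induction k arbitrary: c) auto

lemma pick_least:
  "c \<le> ev (pick c k) s 25 0 \<and> ev (pick c k) s 25 0 \<le> c + k \<and>
   (\<forall>d. c \<le> d \<and> d < ev (pick c k) s 25 0 \<longrightarrow> s 10 d \<noteq> 0) \<and>
   (ev (pick c k) s 25 0 < c + k \<longrightarrow> s 10 (ev (pick c k) s 25 0) = 0)"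
proof (induction k arbitrary: c)
  case (Suc k)
  from Suc[of "Suc c"] show ?case
    by (auto simp: Suc_le_eq) (metis le_neq_implies_less)+
qed auto

lemma straight_test [simp]: "straight test_backbone"
  and writes_test [simp]: "writes test_backbone = {22, 23}"
  by (auto simp: test_backbone_def)

lemma straight_mark [simp]: "straight mark"
  and writes_mark [simp]: "writes mark = {10, 22, 23}"
  by (auto simp: mark_def)

lemma straight_choose_color [simp]: "straight (choose_color K)"
  and writes_choose_color [simp]: "writes (choose_color K) = {10, 21, 22, 23, 25}"
  by (auto simp: choose_color_def clear_def)

definition fwd_body :: "nat \<Rightarrow> bool \<Rightarrow> com" where
  "fwd_body K wide = Seq (set_var 24 (Sub (var 24) (Const 1))) (Seq (set_var 20 (Cell 9 (var 24)))
     (Seq (choose_color K) (Seq (Assign 7 (var 20) (var 25))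
     (Cond (if wide then Const 1 else Cell 10 (Add (var 25) (Const 1)))
        (Assign 8 (var 20) (Add (var 25) (Const 1))) (Assign 8 (var 20) (var 25))))))"

definition forward :: "nat \<Rightarrow> bool \<Rightarrow> com" where
  "forward K wide = Seq (set_var 24 (var 26)) (Loop (var 24) (fwd_body K wide))"

definition bwd_body :: "nat \<Rightarrow> com" where
  "bwd_body K = Seq (set_var 20 (Cell 9 (var 24))) (Seq (choose_color K)
     (Seq (Assign 6 (var 20) (var 25)) (incr 24)))"

definition backward :: "nat \<Rightarrow> com" where
  "backward K = Seq (set_var 24 (Const 0)) (Loop (Sub (var 26) (var 24)) (bwd_body K))"

definition table :: com where
  "table = Seq (Assign 11 (Const 1) (Const 1)) (Seq (Assign 11 (Const 2) (Const 2))
     (Seq (Assign 11 (Const 3) (Add (Cell 0 (Const 1)) (Const 1)))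
     (Seq (Assign 11 (Const 4) (Add (Cell 0 (Const 1)) (Const 2)))
     (Seq (Assign 11 (Const 5) (Add (Add (Cell 0 (Const 1)) (Cell 0 (Const 1))) (Const 1)))
     (Assign 11 (Const 6) (Add (Add (Cell 0 (Const 1)) (Cell 0 (Const 1))) (Const 2)))))))"

definition write_body :: com where
  "write_body = Seq (Assign 5 (var 24) (Cell 11 (Cell 6 (var 24)))) (incr 24)"

definition write_out :: com where
  "write_out = Seq (Seq table (set_var 24 (Const 0))) (Loop (Sub (Cell 0 (Const 0)) (var 24)) write_body)"

definition engine :: "nat \<Rightarrow> bool \<Rightarrow> com" where
  "engine K wide = Seq (forward K wide) (Seq (backward K) write_out)"

definition engine_cost :: "nat \<Rightarrow> bool \<Rightarrow> nat" where
  "engine_cost K wide = 26 + cost (fwd_body K wide) + cost (bwd_body K) + cost table + cost write_body"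

lemma writes_fwd_body: "writes (fwd_body K wide) = {7, 8, 10, 20, 21, 22, 23, 24, 25}"
  and straight_fwd_body: "straight (fwd_body K wide)"
  by (auto simp: fwd_body_def)

lemma writes_bwd_body: "writes (bwd_body K) = {6, 10, 20, 21, 22, 23, 24, 25}"
  and straight_bwd_body: "straight (bwd_body K)"
  by (auto simp: bwd_body_def)

section \<open>Lists of available colors and the elimination pass\<close>

locale instance_lists =
  fixes adj hadj :: "nat list list" and lam :: nat
  assumes len: "length hadj = length adj"
    and nb: "\<lbrakk>v < length adj; w \<in> set (adj ! v)\<rbrakk> \<Longrightarrow> w < length adj \<and> w \<noteq> v \<and> v \<in> set (adj ! w)"
    and deg: "v < length adj \<Longrightarrow> length (adj ! v) \<le> 4"
    and dist: "v < length adj \<Longrightarrow> distinct (adj ! v)"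
    and hsub: "v < length adj \<Longrightarrow> set (hadj ! v) \<subseteq> set (adj ! v)"
    and hsym: "\<lbrakk>v < length adj; w \<in> set (hadj ! v)\<rbrakk> \<Longrightarrow> v \<in> set (hadj ! w)"
    and hdist: "v < length adj \<Longrightarrow> distinct (hadj ! v)"
begin

abbreviation n :: nat where "n \<equiv> length adj"
abbreviation N :: "nat \<Rightarrow> nat set" where "N v \<equiv> set (adj ! v)"
abbreviation B :: "nat \<Rightarrow> nat set" where "B v \<equiv> set (hadj ! v)"

lemma card_N: "v < n \<Longrightarrow> card (N v) \<le> 4"
  using deg dist by (metis distinct_card)

lemma hdeg: "v < n \<Longrightarrow> length (hadj ! v) \<le> 4"
  using hdist hsub card_N by (metis List.finite_set card_mono distinct_card le_trans)

definition inp :: "store \<Rightarrow> bool" where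
  "inp s \<longleftrightarrow> (\<forall>k<5. s k = input_store lam adj hadj k)"

lemma inp_cells:
  assumes "inp s"
  shows "s 0 0 = n" "s 0 1 = lam" "s 0 (Suc 0) = lam" "s 1 = array_of (offsets adj)" "s 2 = array_of (concat adj)"
    "s 3 = array_of (offsets hadj)" "s 4 = array_of (concat hadj)"
  using assms by (auto simp: inp_def input_store_def array_of_def)

lemma inp_cong: "inp s \<Longrightarrow> (\<And>k. k < 5 \<Longrightarrow> s' k = s k) \<Longrightarrow> inp s'"
  by (simp add: inp_def)

lemma inp_upd [simp]: "5 \<le> k \<Longrightarrow> inp (s(k := f)) \<longleftrightarrow> inp s"
  by (auto simp: inp_def)

lemma test_backbone:
  assumes "inp s" "s 20 0 = v" "v < n" "s 21 0 = w"
  shows "ev test_backbone s 22 0 \<noteq> 0 \<longleftrightarrow> w \<in> B v"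
proof -
  let ?p = "Cond (neq (var 23) (var 21)) Skip (set_var 22 (Const 1))"
  let ?s = "s(22 := (s 22)(0 := 0))"
  define I where "I D t \<longleftrightarrow> (t 22 0 \<noteq> (0::nat) \<longleftrightarrow> w \<in> D)" for D :: "nat set" and t :: store
  have "I (B v) (ev (for_adj 3 4 23 ?p) ?s)"
  proof (rule for_adj_rule)
    show "?s 3 = array_of (offsets hadj)" "?s 4 = array_of (concat hadj)"
      using inp_cells[OF assms(1)] by simp_all
    show "length (hadj ! v) \<le> 4" "distinct (hadj ! v)" using hdeg hdist assms by auto
    fix D x t
    assume "I D t" "\<forall>k. k \<notin> insert 23 (writes ?p) \<longrightarrow> t k = ?s k"
    then show "I (insert x D) (ev ?p (t(23 := (t 23)(0 := x))))"
      using assms by (auto simp: I_def)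
  qed (use assms len in \<open>auto simp: I_def\<close>)
  then show ?thesis by (simp add: I_def test_backbone_def)
qed

lemma mark:
  assumes "inp s" "s 20 0 = v" "v < n" "s 21 0 = w"
  shows "ev mark s 10 c \<noteq> 0 \<longleftrightarrow> s 10 c \<noteq> 0 \<or> forb (s 6) (s 7) (s 8) (w \<in> B v) w c"
proof -
  let ?t = "ev test_backbone s"
  have fr: "?t 6 = s 6" "?t 7 = s 7" "?t 8 = s 8" "?t 10 = s 10" "?t 21 = s 21" by (simp_all add: ev_frame)
  have h: "?t 22 0 = 0 \<longleftrightarrow> w \<notin> B v" using test_backbone[OF assms] by auto
  have col: "c = s 6 w - Suc 0 \<longleftrightarrow> Suc c = s 6 w" if "s 6 w \<noteq> 0" using that by auto
  note simps = mark_def forb_def fr assms(4) h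
  show ?thesis
  proof (cases "s 6 w = 0")
    case True
    then show ?thesis by (cases "s 7 w = 0"; cases "w \<in> B v"; simp add: simps)
  next
    case False
    then show ?thesis using col[OF False] by (cases "w \<in> B v"; simp add: simps)
  qed
qed

text \<open>The program stores no lists. Deleting a color from the list of a neighbor amounts to
  setting \<open>a\<close> and \<open>b\<close> of the deleting vertex, and a list is recomputed
  from the neighbors whenever it is needed.\<close>

definition avail :: "nat \<Rightarrow> (nat \<Rightarrow> nat) \<Rightarrow> (nat \<Rightarrow> nat) \<Rightarrow> (nat \<Rightarrow> nat) \<Rightarrow> nat \<Rightarrow> nat set" where
  "avail K col a b v = {c \<in> {1..K}. \<forall>w\<in>N v. \<not> forb col a b (w \<in> B v) w c}"

lemma finite_avail [simp]: "finite (avail K col a b v)" by (simp add: avail_def)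

lemma choose_color:
  assumes "inp s" "s 20 0 = v" "v < n" "1 \<le> K" "K \<le> 6"
  defines "s' \<equiv> ev (choose_color K) s"
  defines "A \<equiv> avail K (s 6) (s 7) (s 8) v"
  shows "c \<in> {1..6} \<Longrightarrow> s' 10 c \<noteq> 0 \<longleftrightarrow> c \<notin> avail 6 (s 6) (s 7) (s 8) v"
    and "s' 25 0 \<in> {1..K}" and "A \<noteq> {} \<Longrightarrow> s' 25 0 \<in> A" and "c \<in> A \<Longrightarrow> s' 25 0 \<le> c"
proof -
  let ?s = "ev clear s"
  let ?t = "ev (for_adj 1 2 21 mark) ?s"
  have fr: "k \<noteq> 10 \<Longrightarrow> ?s k = s k" for k by (simp add: clear_def)
  define I where "I D t \<longleftrightarrow> (\<forall>c\<in>{1..6}. t 10 c \<noteq> 0 \<longleftrightarrow> (\<exists>w\<in>D. forb (s 6) (s 7) (s 8) (w \<in> B v) w c))"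
    for D and t :: store
  have "I (N v) ?t"
  proof (rule for_adj_rule)
    show "?s 1 = array_of (offsets adj)" "?s 2 = array_of (concat adj)"
      using inp_cells[OF assms(1)] by (simp_all add: fr)
    show "length (adj ! v) \<le> 4" "distinct (adj ! v)" using deg dist assms by auto
    fix D x t
    assume I: "I D t" and t: "\<forall>k. k \<notin> insert 21 (writes mark) \<longrightarrow> t k = ?s k"
    let ?t = "t(21 := (t 21)(0 := x))"
    have "inp ?t" using assms(1) by (rule inp_cong) (use t in \<open>auto simp: fr\<close>)
    moreover have "?t 20 0 = v" "?t 21 0 = x" using t assms by (auto simp: fr)
    ultimately have "ev mark ?t 10 c \<noteq> 0 \<longleftrightarrow> ?t 10 c \<noteq> 0 \<or> forb (?t 6) (?t 7) (?t 8) (x \<in> B v) x c" for c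
      using assms by (intro mark)
    moreover have "?t 6 = s 6" "?t 7 = s 7" "?t 8 = s 8" "?t 10 = t 10" using t by (auto simp: fr)
    ultimately show "I (insert x D) (ev mark ?t)" using I unfolding I_def by auto
  next
    have "c = 1 \<or> c = 2 \<or> c = 3 \<or> c = 4 \<or> c = 5 \<or> c = 6" if "c \<in> {1..6}" for c :: nat
      using that by auto
    then show "I {} ?s" by (auto simp: I_def clear_def)
  qed (use assms in \<open>auto simp: fr\<close>)
  then have F: "?t 10 c \<noteq> 0 \<longleftrightarrow> c \<notin> avail 6 (s 6) (s 7) (s 8) v" if "c \<in> {1..6}" for c
    using that by (auto simp: I_def avail_def)
  have s': "s' = ev (pick 1 (K - 1)) ?t" by (simp add: s'_def choose_color_def)
  have "s' 10 = ?t 10" by (simp add: s' ev_frame)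
  with F show "c \<in> {1..6} \<Longrightarrow> s' 10 c \<noteq> 0 \<longleftrightarrow> c \<notin> avail 6 (s 6) (s 7) (s 8) v" by simp
  note p = pick_least[of 1 "K - 1" ?t, folded s']
  show r: "s' 25 0 \<in> {1..K}" using p assms by auto
  have A: "A = {c \<in> {1..K}. ?t 10 c = 0}"
  proof -
    have "A = {c \<in> {1..K}. c \<in> avail 6 (s 6) (s 7) (s 8) v}" using assms(5) by (auto simp: A_def avail_def)
    moreover have "?t 10 c = 0 \<longleftrightarrow> c \<in> avail 6 (s 6) (s 7) (s 8) v" if "c \<in> {1..K}" for c
      using F[of c] that assms(5) by auto
    ultimately show ?thesis by blast
  qed
  have le: "s' 25 0 \<le> c" if "c \<in> A" for c
  proof (rule ccontr)
    assume "\<not> s' 25 0 \<le> c"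
    moreover have "1 \<le> c" "?t 10 c = 0" using that unfolding A by auto
    ultimately show False using p by (meson not_le)
  qed
  then show "c \<in> A \<Longrightarrow> s' 25 0 \<le> c" .
  show "A \<noteq> {} \<Longrightarrow> s' 25 0 \<in> A"
  proof -
    assume "A \<noteq> {}"
    then obtain c where "c \<in> A" by auto
    then have c: "s' 25 0 \<le> c" "c \<in> {1..K}" "?t 10 c = 0" using le[of c] unfolding A by blast+
    have "?t 10 (s' 25 0) = 0"
    proof (cases "s' 25 0 < K")
      case True
      then show ?thesis using p assms(4) by auto
    next
      case False
      then have "s' 25 0 = c" using c by auto
      then show ?thesis using c by simp
    qed
    then show ?thesis using r unfolding A by blast
  qed
qed

text \<open>Zero encodes "not eliminated". Cutting the final array down to the later positions
  therefore restores the state at an earlier moment of the elimination, and the specification can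
  speak about final arrays only.\<close>

definition restr :: "(nat \<Rightarrow> nat) \<Rightarrow> nat set \<Rightarrow> nat \<Rightarrow> nat" where
  "restr a S w = (if w \<in> S then a w else 0)"

lemma avail_cong:
  assumes "\<And>w. w \<in> N v \<Longrightarrow> col w = col' w" "\<And>w. w \<in> N v \<Longrightarrow> a w = a' w"
    "\<And>w. w \<in> N v \<Longrightarrow> a w \<noteq> 0 \<Longrightarrow> b w = b' w"
  shows "avail K col a b v = avail K col' a' b' v"
  unfolding avail_def forb_def using assms by (intro Collect_cong conj_cong ball_cong refl) auto

definition elim_list ::
    "nat \<Rightarrow> (nat \<Rightarrow> nat) \<Rightarrow> nat \<Rightarrow> (nat \<Rightarrow> nat) \<Rightarrow> (nat \<Rightarrow> nat) \<Rightarrow> (nat \<Rightarrow> nat) \<Rightarrow> nat \<Rightarrow> nat set" where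
  "elim_list K ord m col a b i = avail K col (restr a (ord ` {i<..<m})) b (ord i)"

text \<open>Membership of \<open>a\<close> is conditional because of the default value for empty
  lists. The last clause uses the list over six colors even for \<open>K = 5\<close>: what the
  program tests is the mark of color \<open>a + 1\<close>, which may be 6.\<close>

definition elim_spec ::
    "nat \<Rightarrow> bool \<Rightarrow> (nat \<Rightarrow> nat) \<Rightarrow> nat \<Rightarrow> (nat \<Rightarrow> nat) \<Rightarrow> (nat \<Rightarrow> nat) \<Rightarrow> (nat \<Rightarrow> nat) \<Rightarrow> nat \<Rightarrow> bool" where
  "elim_spec K wide ord m col a b i \<longleftrightarrow>
     a (ord i) \<in> {1..K} \<and>
     (elim_list K ord m col a b i \<noteq> {} \<longrightarrow> a (ord i) \<in> elim_list K ord m col a b i) \<and>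
     (\<forall>c\<in>elim_list K ord m col a b i. a (ord i) \<le> c) \<and>
     b (ord i) = (if wide \<or> a (ord i) + 1 \<notin> elim_list 6 ord m col a b i then a (ord i) + 1 else a (ord i))"

text \<open>The marks are kept for the colors 1 to 6. The test of the color after \<open>c\<close>
  makes sense only for \<open>c\<close> up to 5, which is the origin of
  \<open>wide \<or> K \<le> 5\<close>.\<close>

lemma fwd_body:
  assumes "inp s" "s 24 0 = Suc j" "s 9 j = v" "v < n" "1 \<le> K" "K \<le> 6" "wide \<or> K \<le> 5"
  defines "c \<equiv> ev (choose_color K) (s(24 := (s 24)(0 := j), 20 := (s 20)(0 := v))) 25 0"
  defines "av \<equiv> \<lambda>K. avail K (s 6) (s 7) (s 8) v"
  shows "ev (fwd_body K wide) s 24 0 = j"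
    and "ev (fwd_body K wide) s 7 = (s 7)(v := c)"
    and "ev (fwd_body K wide) s 8 = (s 8)(v := (if wide \<or> c + 1 \<notin> av 6 then c + 1 else c))"
    and "c \<in> {1..K}" "av K \<noteq> {} \<Longrightarrow> c \<in> av K" "d \<in> av K \<Longrightarrow> c \<le> d"
proof -
  let ?s = "s(24 := (s 24)(0 := j), 20 := (s 20)(0 := v))"
  define t where "t = ev (choose_color K) ?s"
  have "inp ?s" "?s 20 0 = v" using assms(1) by simp_all
  note ch = choose_color[OF this assms(4,5,6), folded t_def]
  have c: "c = t 25 0" by (simp add: c_def t_def)
  have fr: "t 24 = ?s 24" "t 20 = ?s 20" "t 7 = s 7" "t 8 = s 8"
    by (simp_all add: t_def ev_frame fun_upd_def)
  show r: "c \<in> {1..K}" using ch(2) by (simp add: c)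
  show "av K \<noteq> {} \<Longrightarrow> c \<in> av K" "d \<in> av K \<Longrightarrow> c \<le> d" using ch(3,4) by (simp_all add: c av_def)
  let ?u = "if wide then Const 1 else Cell 10 (Add (var 25) (Const 1))"
  have ev: "ev (fwd_body K wide) s = ev (Cond ?u (Assign 8 (var 20) (Add (var 25) (Const 1)))
      (Assign 8 (var 20) (var 25))) (t(7 := (t 7)(v := c)))"
    using assms(2,3) by (simp add: fwd_body_def t_def[symmetric] fr c)
  have test: "aval ?u (t(7 := (t 7)(v := c))) \<noteq> 0 \<longleftrightarrow> wide \<or> c + 1 \<notin> av 6"
    using ch(1)[of "c + 1"] r assms(7) by (auto simp: av_def c)
  show "ev (fwd_body K wide) s 24 0 = j" "ev (fwd_body K wide) s 7 = (s 7)(v := c)"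
    unfolding ev by (simp_all add: fr ev_frame fun_upd_def del: ev.simps)
  show "ev (fwd_body K wide) s 8 = (s 8)(v := (if wide \<or> c + 1 \<notin> av 6 then c + 1 else c))"
    unfolding ev ev.simps(4) test by (auto simp: fr c fun_eq_iff)
qed

lemma bwd_body:
  assumes "inp s" "s 24 0 = j" "s 9 j = v" "v < n" "1 \<le> K" "K \<le> 6" "avail K (s 6) (s 7) (s 8) v \<noteq> {}"
  obtains c where "ev (bwd_body K) s 24 0 = Suc j" "ev (bwd_body K) s 6 = (s 6)(v := c)"
    "c \<in> avail K (s 6) (s 7) (s 8) v"
proof -
  let ?s = "s(20 := (s 20)(0 := v))"
  define t where "t = ev (choose_color K) ?s"
  have "inp ?s" "?s 20 0 = v" using assms(1) by simp_all
  note ch = choose_color[OF this assms(4,5,6), folded t_def]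
  have fr: "t 24 = ?s 24" "t 20 = ?s 20" "t 6 = s 6" by (simp_all add: t_def ev_frame fun_upd_def)
  have ev: "ev (bwd_body K) s = t(6 := (t 6)(v := t 25 0), 24 := (t 24)(0 := Suc j))"
    using assms(2,3) by (simp add: bwd_body_def t_def[symmetric] fr)
  show ?thesis using ch(3) assms(7) by (intro that[of "t 25 0"]) (simp_all add: ev fr)
qed

definition same_except :: "nat set \<Rightarrow> store \<Rightarrow> store \<Rightarrow> bool" where
  "same_except X s t \<longleftrightarrow> (\<forall>k. k \<notin> X \<longrightarrow> t k = s k)"

lemma same_exceptD: "same_except X s t \<Longrightarrow> k \<notin> X \<Longrightarrow> t k = s k"
  by (simp add: same_except_def)

lemma same_except_ev: "same_except X s t \<Longrightarrow> writes p \<subseteq> X \<Longrightarrow> same_except X s (ev p t)"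
  unfolding same_except_def by (metis ev_frame subsetD)

lemma same_except_inp: "same_except X s t \<Longrightarrow> X \<inter> {..<5} = {} \<Longrightarrow> inp s \<Longrightarrow> inp t"
  by (rule inp_cong[of s]) (auto simp: same_except_def)

abbreviation fwd_vars :: "nat set" where "fwd_vars \<equiv> {7, 8, 10, 20, 21, 22, 23, 24, 25}"
abbreviation bwd_vars :: "nat set" where "bwd_vars \<equiv> {6, 10, 20, 21, 22, 23, 24, 25}"

lemma forward:
  assumes "inp s" "s 9 = ord" "s 6 = col" "s 7 = (\<lambda>_. 0)" "s 26 0 = m" "inj_on ord {..<m}"
    "\<And>i. i < m \<Longrightarrow> ord i < n" "1 \<le> K" "K \<le> 6" "wide \<or> K \<le> 5"
  shows "runs (forward K wide) s (5 + (3 + cost (fwd_body K wide)) * (m + 1))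
    (\<lambda>t. same_except fwd_vars s t \<and> (\<forall>i<m. elim_spec K wide ord m col (t 7) (t 8) i))"
proof -
  define I where "I t \<longleftrightarrow> same_except fwd_vars s t \<and> t 24 0 \<le> m \<and>
      (\<forall>w. w \<notin> ord ` {t 24 0..<m} \<longrightarrow> t 7 w = 0) \<and>
      (\<forall>i\<in>{t 24 0..<m}. elim_spec K wide ord m col (t 7) (t 8) i)" for t
  have step: "I (ev (fwd_body K wide) t) \<and> ev (fwd_body K wide) t 24 0 < t 24 0" if I: "I t" and nz: "t 24 0 \<noteq> 0" for t
  proof -
    obtain j where j: "t 24 0 = Suc j" using nz by (cases "t 24 0") auto
    have sa: "same_except fwd_vars s t" using I by (simp add: I_def)
    have jm: "j < m" using I j by (simp add: I_def)
    define v where "v = ord j"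
    have inp: "inp t" using same_except_inp[OF sa] assms(1) by auto
    have eqs: "t 9 = ord" "t 6 = col" using same_exceptD[OF sa] assms by auto
    have vn: "v < n" using assms(7) jm by (simp add: v_def)
    have t9: "t 9 j = v" by (simp add: eqs v_def)
    define c where "c = ev (choose_color K) (t(24 := (t 24)(0 := j), 20 := (t 20)(0 := v))) 25 0"
    note fb = fwd_body[OF inp j t9 vn assms(8,9,10), folded c_def, unfolded eqs]
    let ?t = "ev (fwd_body K wide) t"
    have vnot: "v \<notin> ord ` {i<..<m}" if "j \<le> i" for i
      using that inj_onD[OF assms(6), of j] jm by (auto simp: v_def)
    \<comment> \<open>The list at a position sees only later positions, so the entries just written
      for position \<open>j\<close> are invisible from \<open>j\<close> on.\<close>
    have old: "elim_list K' ord m col (?t 7) (?t 8) i = elim_list K' ord m col (t 7) (t 8) i" if "j \<le> i" for K' i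
      unfolding elim_list_def using vnot[OF that] by (intro avail_cong) (auto simp: fb restr_def)
    \<comment> \<open>Positions up to \<open>j\<close> still carry 0, so at this moment the
      restriction changes nothing and the list computed by the program is the specified one.\<close>
    have "restr (t 7) (ord ` {j<..<m}) = t 7"
    proof
      fix w show "restr (t 7) (ord ` {j<..<m}) w = t 7 w"
        using I j by (auto simp: I_def restr_def atLeastSucLessThan_greaterThanLessThan)
    qed
    then have new: "elim_list K' ord m col (t 7) (t 8) j = avail K' col (t 7) (t 8) v" for K'
      by (simp add: elim_list_def v_def)
    have spec_j: "elim_spec K wide ord m col (?t 7) (?t 8) j"
    proof -
      have "?t 7 v = c" "?t 8 v = (if wide \<or> c + 1 \<notin> avail 6 col (t 7) (t 8) v then c + 1 else c)"
        by (simp_all only: fb(2,3) fun_upd_same)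
      note vals = this
      show ?thesis
        unfolding elim_spec_def old[OF order_refl] new v_def[symmetric] vals using fb(4-6) by blast
    qed
    have spec: "elim_spec K wide ord m col (?t 7) (?t 8) i" if "i \<in> {Suc j..<m}" for i
    proof -
      have "ord i \<noteq> v" using imageI[of i "{j<..<m}" ord] vnot[OF order_refl] that by (metis Suc_le_lessD atLeastLessThan_iff greaterThanLessThan_iff)
      moreover have "elim_spec K wide ord m col (t 7) (t 8) i" using I j that by (simp add: I_def)
      moreover from calculation have vals: "?t 7 (ord i) = t 7 (ord i)" "?t 8 (ord i) = t 8 (ord i)"
        by (simp_all only: fb(2,3) fun_upd_other not_False_eq_True)
      moreover have ji: "j \<le> i" using that by simp
      ultimately show ?thesis unfolding elim_spec_def old[OF ji] vals by blast
    qed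
    have "{j..<m} = insert j {Suc j..<m}" using jm by auto
    with spec spec_j have "\<forall>i\<in>{j..<m}. elim_spec K wide ord m col (?t 7) (?t 8) i" by (metis insertE)
    moreover have "same_except fwd_vars s ?t"
      by (rule same_except_ev[OF sa]) (simp add: writes_fwd_body)
    moreover have "?t 7 w = 0" if "w \<notin> ord ` {j..<m}" for w
    proof -
      have "w \<noteq> v" "w \<notin> ord ` {Suc j..<m}" using that jm by (auto simp: v_def)
      then show ?thesis using I j by (simp add: fb I_def)
    qed
    ultimately show ?thesis using jm by (simp add: I_def fb(1) j)
  qed
  let ?s = "s(24 := (s 24)(0 := m))"
  have "I ?s" using assms by (auto simp: I_def same_except_def)
  then have "runs (Loop (var 24) (fwd_body K wide)) ?s
      ((1 + acost (var 24) + cost (fwd_body K wide)) * (?s 24 0 + 1)) (\<lambda>t. I t \<and> aval (var 24) t = 0)"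
    by (intro runs_Loop[where \<mu> = "\<lambda>t. t 24 0"] straight_fwd_body) (use step in auto)
  then have "runs (Loop (var 24) (fwd_body K wide)) ?s ((3 + cost (fwd_body K wide)) * (m + 1)) (\<lambda>t. I t \<and> t 24 0 = 0)"
    by (rule runs_weaken) (auto simp: algebra_simps)
  then have "runs (forward K wide) s (5 + (3 + cost (fwd_body K wide)) * (m + 1)) (\<lambda>t. I t \<and> t 24 0 = 0)"
    unfolding forward_def
    by (rule runs_Seq_straight[rotated 2]) (simp_all add: assms(5))
  then show ?thesis by (rule runs_weaken) (auto simp: I_def)
qed

end

section \<open>Coloring in the reverse order of elimination\<close>

definition compat :: "bool \<Rightarrow> nat \<Rightarrow> nat \<Rightarrow> bool" where
  "compat h c d \<longleftrightarrow> \<not> (c = d \<or> h \<and> (c = d + 1 \<or> c + 1 = d))"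

lemma compat_sym: "compat h c d \<longleftrightarrow> compat h d c"
  by (auto simp: compat_def)

context instance_lists begin

lemma B_sym: "v < n \<Longrightarrow> w < n \<Longrightarrow> w \<in> B v \<longleftrightarrow> v \<in> B w"
  using hsym by blast

text \<open>What a vertex needs in order to be colored in the second pass. If \<open>a\<close> is
  blocked by the backbone neighbor \<open>p\<close>, then each ordinary neighbor at a position
  before \<open>i\<close> excludes at most one color, and \<open>p\<close> excludes one color of the
  list or two; one color more must be present, whence 2 and 3. The two alternatives rule out the
  double loss: if \<open>b = a\<close>, then \<open>p\<close> cannot have color \<open>a\<close>,
  and if \<open>a + 1\<close> is missing from the list, it cannot be lost.\<close>

definition elim_ok ::
    "nat \<Rightarrow> (nat \<Rightarrow> nat) \<Rightarrow> nat \<Rightarrow> (nat \<Rightarrow> nat) \<Rightarrow> (nat \<Rightarrow> nat) \<Rightarrow> (nat \<Rightarrow> nat) \<Rightarrow> nat \<Rightarrow> bool" where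
  "elim_ok K ord m col a b i \<longleftrightarrow>
     a (ord i) \<in> elim_list K ord m col a b i \<and>
     (\<forall>c\<in>elim_list K ord m col a b i. a (ord i) \<le> c) \<and>
     (\<forall>p\<in>B (ord i) \<inter> ord ` {..<i}. B (ord i) \<inter> ord ` {..<i} = {p} \<and>
        card (N (ord i) \<inter> ord ` {..<i} - {p}) + 2 \<le> card (elim_list K ord m col a b i) \<and>
        (b (ord i) = a (ord i) \<or> a (ord i) + 1 \<notin> elim_list K ord m col a b i \<or>
         card (N (ord i) \<inter> ord ` {..<i} - {p}) + 3 \<le> card (elim_list K ord m col a b i)))"

definition order_ok :: "nat \<Rightarrow> (nat \<Rightarrow> nat) \<Rightarrow> nat \<Rightarrow> (nat \<Rightarrow> nat) \<Rightarrow> bool" where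
  "order_ok K ord m col \<longleftrightarrow>
     inj_on ord {..<m} \<and> (\<forall>i<m. ord i < n) \<and>
     (\<forall>v<n. col v \<le> K \<and> (col v = 0 \<longleftrightarrow> v \<in> ord ` {..<m}) \<and>
        (\<forall>w\<in>N v. col v \<noteq> 0 \<and> col w \<noteq> 0 \<longrightarrow> compat (w \<in> B v) (col v) (col w)))"

lemma order_okD:
  assumes "order_ok K ord m col"
  shows "inj_on ord {..<m}" "i < m \<Longrightarrow> ord i < n" "i < m \<Longrightarrow> col (ord i) = 0"
    "v < n \<Longrightarrow> col v = 0 \<Longrightarrow> v \<in> ord ` {..<m}" "v < n \<Longrightarrow> col v \<le> K"
    "v < n \<Longrightarrow> w \<in> N v \<Longrightarrow> col v \<noteq> 0 \<Longrightarrow> col w \<noteq> 0 \<Longrightarrow> compat (w \<in> B v) (col v) (col w)"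
  using assms unfolding order_ok_def by blast+

text \<open>When \<open>ord j\<close> is colored, vertices at later positions still act through
  \<open>a\<close> and \<open>b\<close>, exactly as when \<open>ord j\<close> was eliminated, while
  those at earlier positions act through their colors. So its old list is left, minus the conflicts
  with colored neighbors. No ordinary neighbor uses the minimum \<open>a\<close> of this list; if
  the backbone neighbor blocks it, the list is long enough by \<open>elim_ok\<close>.\<close>

lemma backward_avail:
  assumes oo: "order_ok K ord m col0" and eo: "\<And>i. i < m \<Longrightarrow> elim_ok K ord m col0 a b i"
    and j: "j < m"
    and c1: "\<And>w. w \<notin> ord ` {..<j} \<Longrightarrow> col w = col0 w"
    and c2: "\<And>i. i < j \<Longrightarrow> col (ord i) \<in> elim_list K ord m col0 a b i"
  shows "avail K col a b (ord j) = {c \<in> elim_list K ord m col0 a b j.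
      \<forall>w\<in>N (ord j) \<inter> ord ` {..<j}. compat (w \<in> B (ord j)) c (col w)}" (is ?eq)
    and "avail K col a b (ord j) \<noteq> {}"
proof -
  define v where "v = ord j"
  define E where "E = ord ` {j<..<m}"
  define P where "P = ord ` {..<j}"
  define L where "L = elim_list K ord m col0 a b j"
  note od = order_okD[OF oo]
  have vn: "v < n" and v0: "col0 v = 0" using od(2,3)[OF j] by (simp_all add: v_def)
  have disj: "w \<notin> E" if "w \<in> P" for w
    using that inj_onD[OF od(1)] j unfolding E_def P_def by force
  have L: "L = avail K col0 (restr a E) b v" by (simp add: L_def elim_list_def E_def v_def)
  have L_sub: "elim_list K ord m col0 a b i \<subseteq> {1..K}" for i by (auto simp: elim_list_def avail_def)
  have same: "forb col a b h w c \<longleftrightarrow> (if w \<in> P then \<not> compat h c (col w) else forb col0 (restr a E) b h w c)"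
    and free: "w \<in> P \<Longrightarrow> \<not> forb col0 (restr a E) b h w c"
    if w: "w \<in> N v" for w h c
  proof -
    have wn: "w < n" "w \<noteq> v" using nb[OF vn w] by auto
    have in_P: "col w \<noteq> 0" "col0 w = 0" if "w \<in> P"
    proof -
      from that obtain i where i: "i < j" "w = ord i" by (auto simp: P_def)
      show "col w \<noteq> 0" using c2[OF i(1)] L_sub[of i] i(2) by auto
      show "col0 w = 0" using i j od(3) by simp
    qed
    show "w \<in> P \<Longrightarrow> \<not> forb col0 (restr a E) b h w c"
      using in_P disj by (auto simp: forb_def restr_def)
    show "forb col a b h w c \<longleftrightarrow> (if w \<in> P then \<not> compat h c (col w) else forb col0 (restr a E) b h w c)"
    proof (cases "w \<in> P")
      case True
      then show ?thesis using in_P by (simp add: forb_def compat_def)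
    next
      case False
      then have col: "col w = col0 w" using c1 by (simp add: P_def)
      show ?thesis
      proof (cases "col0 w = 0")
        case True
        then obtain i where "i < m" "w = ord i" using od(4)[OF wn(1)] by auto
        then have "w \<in> E" using False wn(2) unfolding E_def P_def v_def by (cases i j rule: linorder_cases) auto
        then show ?thesis using False col by (simp add: forb_def restr_def)
      qed (use False col in \<open>simp add: forb_def\<close>)
    qed
  qed
  have av: "avail K col a b v = {c \<in> L. \<forall>w\<in>N v \<inter> P. compat (w \<in> B v) c (col w)}"
    unfolding L avail_def using same free by auto
  then show ?eq by (simp add: v_def L_def P_def)
  note e = eo[OF j, unfolded elim_ok_def, folded v_def L_def P_def]
  have aL: "a v \<in> L" and amin: "\<And>c. c \<in> L \<Longrightarrow> a v \<le> c" using e by auto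
  have finL: "finite L" by (simp add: L)
  \<comment> \<open>The color of \<open>w\<close> comes from the list of \<open>w\<close> at its own
    elimination. At that time \<open>v\<close>, being at a later position, had already made its
    deletions.\<close>
  have kill: "if w \<in> B v then col w \<noteq> a v + 1 \<and> col w \<noteq> b v else col w \<noteq> a v" if w: "w \<in> N v" "w \<in> P" for w
  proof -
    obtain i where i: "i < j" "w = ord i" using w(2) by (auto simp: P_def)
    have wn: "w < n" "v \<in> N w" using nb[OF vn w(1)] by auto
    have "v \<in> ord ` {i<..<m}" using i(1) j by (auto simp: v_def)
    then have "restr a (ord ` {i<..<m}) v = a v" by (simp add: restr_def)
    moreover have "a v \<noteq> 0" using aL L_sub[of j] by (auto simp: L_def)
    moreover have "\<not> forb col0 (restr a (ord ` {i<..<m})) b (v \<in> B w) v (col w)"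
      using c2[OF i(1)] wn(2) i(2) by (auto simp: elim_list_def avail_def)
    ultimately show ?thesis using v0 B_sym[OF vn wn(1)] by (auto simp: forb_def)
  qed
  have "{c \<in> L. \<forall>w\<in>N v \<inter> P. compat (w \<in> B v) c (col w)} \<noteq> {}"
  proof (cases "B v \<inter> P = {}")
    case True
    then have "compat (w \<in> B v) (a v) (col w)" if "w \<in> N v \<inter> P" for w
      using kill[of w] that by (auto simp: compat_def split: if_splits)
    then show ?thesis using aL by blast
  next
    case False
    then obtain p where p: "p \<in> B v \<inter> P" by auto
    define X where "X = N v \<inter> P - {p}"
    have e': "B v \<inter> P = {p}" "card X + 2 \<le> card L" "b v = a v \<or> a v + 1 \<notin> L \<or> card X + 3 \<le> card L"
      using e p unfolding X_def by blast+
    have pN: "p \<in> N v" using p hsub[OF vn] by auto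
    have q: "col p \<noteq> a v + 1" "col p \<noteq> b v" using kill[OF pN] p by auto
    have X: "compat (w \<in> B v) c (col w) \<longleftrightarrow> c \<noteq> col w" if "w \<in> X" for w c
      using that e'(1) by (auto simp: X_def compat_def)
    have NP: "N v \<inter> P = insert p X" using p pN by (auto simp: X_def)
    show ?thesis
    proof (cases "compat True (a v) (col p)")
      case True
      have "a v \<noteq> col w" if "w \<in> X" for w using kill[of w] that e'(1) by (auto simp: X_def split: if_splits)
      then have "\<forall>w\<in>N v \<inter> P. compat (w \<in> B v) (a v) (col w)"
        unfolding NP using True p X by auto
      then show ?thesis using aL by blast
    next
      case False
      define Y where "Y = {c \<in> L. \<not> compat True c (col p)}"
      have "card Y + card X < card L"
      proof (cases "col p = a v \<and> a v + 1 \<in> L")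
        case True
        then have "card X + 3 \<le> card L" using e'(3) q(2) by auto
        \<comment> \<open>A color in conflict with \<open>p\<close> differs from \<open>a\<close> by
          at most one here, and \<open>a\<close> is the least color of the list.\<close>
        moreover have "Y \<subseteq> {a v, a v + 1}" using amin True by (fastforce simp: Y_def compat_def)
        then have "card Y \<le> 2" using card_mono[of "{a v, a v + 1}" Y] by auto
        ultimately show ?thesis by simp
      next
        case n: False
        \<comment> \<open>Now \<open>p\<close> has color \<open>a - 1\<close>, or it has color
          \<open>a\<close> while \<open>a + 1\<close> is missing from the list; in both cases only
          \<open>a\<close> is lost.\<close>
        have "Y \<subseteq> {a v}" using amin n False q(1) by (fastforce simp: Y_def compat_def)
        then have "card Y \<le> 1" using card_mono[of "{a v}" Y] by auto
        then show ?thesis using e'(2) by simp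
      qed
      moreover have "card (Y \<union> col ` X) \<le> card Y + card X"
        using card_Un_le[of Y "col ` X"] card_image_le[of X col] by (simp add: X_def)
      ultimately have "card (Y \<union> col ` X) < card L" by simp
      then obtain c where "c \<in> L" "c \<notin> Y \<union> col ` X"
        using card_mono[of "Y \<union> col ` X" L] finL by (auto simp: Y_def X_def not_less[symmetric])
      then have "\<forall>w\<in>N v \<inter> P. compat (w \<in> B v) c (col w)" unfolding NP using p X by (auto simp: Y_def)
      then show ?thesis using \<open>c \<in> L\<close> by blast
    qed
  qed
  then show "avail K col a b (ord j) \<noteq> {}" using av by (simp add: v_def)
qed

lemma backward:
  assumes "inp s" "s 9 = ord" "s 6 = col0" "s 7 = a" "s 8 = b" "s 26 0 = m"
    and oo: "order_ok K ord m col0" and eo: "\<And>i. i < m \<Longrightarrow> elim_ok K ord m col0 a b i"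
    and K: "1 \<le> K" "K \<le> 6"
  shows "runs (backward K) s (3 + (6 + cost (bwd_body K)) * (m + 1))
    (\<lambda>t. same_except bwd_vars s t \<and>
      (\<forall>v<n. t 6 v \<in> {1..K} \<and> (\<forall>w\<in>N v. compat (w \<in> B v) (t 6 v) (t 6 w))))"
proof -
  note od = order_okD[OF oo]
  define I where "I t \<longleftrightarrow> same_except bwd_vars s t \<and> t 24 0 \<le> m \<and>
      (\<forall>w. w \<notin> ord ` {..<t 24 0} \<longrightarrow> t 6 w = col0 w) \<and>
      (\<forall>i<t 24 0. t 6 (ord i) \<in> elim_list K ord m col0 a b i) \<and>
      (\<forall>v<n. \<forall>w\<in>N v. t 6 v \<noteq> 0 \<and> t 6 w \<noteq> 0 \<longrightarrow> compat (w \<in> B v) (t 6 v) (t 6 w))" for t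
  have L_sub: "elim_list K ord m col0 a b i \<subseteq> {1..K}" for i by (auto simp: elim_list_def avail_def)
  have step: "I (ev (bwd_body K) t) \<and> m - ev (bwd_body K) t 24 0 < m - t 24 0" if I: "I t" and nz: "t 24 0 < m" for t
  proof -
    define j where "j = t 24 0"
    define v where "v = ord j"
    have sa: "same_except bwd_vars s t" using I by (simp add: I_def)
    have jm: "j < m" using nz by (simp add: j_def)
    have inp: "inp t" using same_except_inp[OF sa] assms(1) by auto
    have eqs: "t 9 = ord" "t 7 = a" "t 8 = b" using same_exceptD[OF sa] assms by auto
    have vn: "v < n" using od(2) jm by (simp add: v_def)
    have c1: "\<And>w. w \<notin> ord ` {..<j} \<Longrightarrow> t 6 w = col0 w"
      and c2: "\<And>i. i < j \<Longrightarrow> t 6 (ord i) \<in> elim_list K ord m col0 a b i"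
      using I by (auto simp: I_def j_def)
    note av = backward_avail[OF oo eo jm c1 c2, folded v_def]
    have "avail K (t 6) (t 7) (t 8) v \<noteq> {}" using av(2) by (simp add: eqs)
    then obtain c where c: "ev (bwd_body K) t 24 0 = Suc j" "ev (bwd_body K) t 6 = (t 6)(v := c)"
      "c \<in> avail K (t 6) (t 7) (t 8) v"
      using bwd_body[OF inp j_def[symmetric] _ vn K, unfolded eqs] by (metis eqs v_def)
    have cL: "c \<in> elim_list K ord m col0 a b j" using c(3) av(1) by (auto simp: eqs)
    have cav: "\<not> forb (t 6) a b (w \<in> B v) w c" if "w \<in> N v" for w
      using c(3) that by (auto simp: avail_def eqs)
    have cc: "compat (w \<in> B v) c (t 6 w)" if "w \<in> N v" "t 6 w \<noteq> 0" for w
      using cav[OF that(1)] that(2) by (simp add: forb_def compat_def)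
    let ?t = "ev (bwd_body K) t"
    have "same_except bwd_vars s ?t" by (rule same_except_ev[OF sa]) (simp add: writes_bwd_body)
    moreover have "?t 6 w = col0 w" if "w \<notin> ord ` {..<Suc j}" for w
      using that c1[of w] by (auto simp: c(2) v_def lessThan_Suc)
    moreover have "?t 6 (ord i) \<in> elim_list K ord m col0 a b i" if "i < Suc j" for i
    proof (cases "i = j")
      case True
      then show ?thesis using cL by (simp add: c(2) v_def)
    next
      case False
      then have "i < j" using that by simp
      moreover have "ord i \<noteq> v" using inj_onD[OF od(1), of i j] False \<open>i < j\<close> jm by (auto simp: v_def)
      ultimately show ?thesis using c2 by (simp add: c(2))
    qed
    moreover have "compat (w \<in> B u) (?t 6 u) (?t 6 w)" if "u < n" "w \<in> N u" "?t 6 u \<noteq> 0" "?t 6 w \<noteq> 0" for u w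
    proof -
      have uw: "u \<noteq> w" "w < n" "u \<in> N w" using nb[OF that(1,2)] by auto
      consider "u = v" | "w = v" | "u \<noteq> v" "w \<noteq> v" by auto
      then show ?thesis
      proof cases
        case 1
        then show ?thesis using cc[of w] that uw by (auto simp: c(2))
      next
        case 2
        then show ?thesis using cc[of u] that uw B_sym[of u v] vn by (auto simp: c(2) compat_sym)
      next
        case 3
        then show ?thesis using I that by (simp add: I_def c(2))
      qed
    qed
    ultimately show ?thesis using jm unfolding I_def c(1) j_def[symmetric] by auto
  qed
  let ?s = "s(24 := (s 24)(0 := 0))"
  have init: "I ?s" using assms od(6) by (auto simp: I_def same_except_def)
  have im: "t 26 0 = m" if "I t" for t using that assms(6) by (simp add: I_def same_except_def)
  have st: "I (ev (bwd_body K) t) \<and> m - ev (bwd_body K) t 24 0 < m - t 24 0"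
    if "I t" "aval (Sub (var 26) (var 24)) t \<noteq> 0" for t
    using step[OF that(1)] that(2) im[OF that(1)] by simp
  have "runs (Loop (Sub (var 26) (var 24)) (bwd_body K)) ?s ((1 + acost (Sub (var 26) (var 24)) + cost (bwd_body K)) * ((m - ?s 24 0) + 1))
      (\<lambda>t. I t \<and> aval (Sub (var 26) (var 24)) t = 0)"
    by (rule runs_Loop[where I = I and \<mu> = "\<lambda>t. m - t 24 0", OF straight_bwd_body init st])
  then have "runs (Loop (Sub (var 26) (var 24)) (bwd_body K)) ?s ((6 + cost (bwd_body K)) * (m + 1)) (\<lambda>t. I t \<and> t 24 0 = m)"
  proof (rule runs_weaken)
    fix t assume t: "I t \<and> aval (Sub (var 26) (var 24)) t = 0"
    then have "t 24 0 \<le> m" "t 26 0 \<le> t 24 0" by (simp_all add: I_def)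
    then show "I t \<and> t 24 0 = m" using t im[of t] by simp
  qed (simp add: algebra_simps)
  then have "runs (backward K) s (3 + (6 + cost (bwd_body K)) * (m + 1)) (\<lambda>t. I t \<and> t 24 0 = m)"
    unfolding backward_def
    by (rule runs_Seq_straight[rotated 2]) simp_all
  then show ?thesis
  proof (rule runs_weaken)
    fix t assume t: "I t \<and> t 24 0 = m"
    have "t 6 v \<in> {1..K}" if vn: "v < n" for v
    proof (cases "col0 v = 0")
      case True
      then obtain i where "i < m" "v = ord i" using od(4)[OF vn] by auto
      then show ?thesis using t L_sub[of i] by (auto simp: I_def)
    next
      case False
      then have "v \<notin> ord ` {..<m}" using od(3) by auto
      then show ?thesis using t False od(5)[OF vn] by (auto simp: I_def)
    qed
    note r = this
    have "compat (w \<in> B v) (t 6 v) (t 6 w)" if "v < n" "w \<in> N v" for v w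
    proof -
      have "t 6 v \<noteq> 0" "t 6 w \<noteq> 0" using r[of v] r[of w] nb[OF that] that by auto
      then show ?thesis using t that by (simp add: I_def)
    qed
    with r t show "same_except bwd_vars s t \<and>
      (\<forall>v<n. t 6 v \<in> {1..K} \<and> (\<forall>w\<in>N v. compat (w \<in> B v) (t 6 v) (t 6 w)))"
      unfolding I_def by blast
  qed simp
qed

text \<open>Monotone, and colors at distance at least two are sent to colors at distance at least \<open>lam\<close>.\<close>

definition stretch :: "nat \<Rightarrow> nat" where
  "stretch c = (if c \<le> 2 then c else if c \<le> 4 then lam + (c - 2) else 2 * lam + (c - 4))"

lemma write_out:
  assumes "inp s" "\<And>v. v < n \<Longrightarrow> s 6 v \<in> {1..6}"
  shows "runs write_out s (cost table + 3 + (6 + cost write_body) * (n + 1)) (\<lambda>t. \<forall>v<n. t 5 v = stretch (s 6 v))"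
proof -
  let ?s = "ev (Seq table (set_var 24 (Const 0))) s"
  have tab: "?s 11 c = stretch c" if "c \<in> {1..6}" for c
  proof -
    have "c = 1 \<or> c = 2 \<or> c = 3 \<or> c = 4 \<or> c = 5 \<or> c = 6" using that by auto
    then show ?thesis by (auto simp: table_def stretch_def inp_cells[OF assms(1)])
  qed
  define I where "I t \<longleftrightarrow> t 24 0 \<le> n \<and> t 11 = ?s 11 \<and> t 6 = s 6 \<and> t 0 0 = n \<and> (\<forall>v<t 24 0. t 5 v = stretch (s 6 v))" for t :: store
  have "I ?s" using inp_cells[OF assms(1)] by (auto simp: I_def table_def)
  moreover have "I (ev write_body t) \<and> n - ev write_body t 24 0 < n - t 24 0" if "I t" "t 24 0 < n" for t
    using that tab assms(2) by (auto simp: I_def write_body_def less_Suc_eq)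
  ultimately have "runs (Loop (Sub (Cell 0 (Const 0)) (var 24)) write_body) ?s ((1 + acost (Sub (Cell 0 (Const 0)) (var 24)) + cost write_body) * ((n - ?s 24 0) + 1))
      (\<lambda>t. I t \<and> aval (Sub (Cell 0 (Const 0)) (var 24)) t = 0)"
    by (intro runs_Loop[where \<mu> = "\<lambda>t. n - t 24 0"]) (auto simp: write_body_def I_def)
  then have "runs (Loop (Sub (Cell 0 (Const 0)) (var 24)) write_body) ?s ((6 + cost write_body) * (n + 1)) (\<lambda>t. \<forall>v<n. t 5 v = stretch (s 6 v))"
    by (rule runs_weaken) (auto simp: I_def algebra_simps)
  then show ?thesis unfolding write_out_def
    by (rule runs_Seq_straight[OF _ refl, rotated]) (simp_all add: table_def)
qed

definition good_output :: "nat \<Rightarrow> store \<Rightarrow> bool" where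
  "good_output K t \<longleftrightarrow> (\<exists>col. \<forall>v<n. col v \<in> {1..K} \<and> t 5 v = stretch (col v) \<and>
     (\<forall>w\<in>N v. compat (w \<in> B v) (col v) (col w)))"

text \<open>The assumption on \<open>elim_ok\<close> ranges over all \<open>a\<close> and
  \<open>b\<close> because the outcome of the first pass is known only through
  \<open>elim_spec\<close>. It is the interface to the two kinds of backbones.\<close>

lemma engine:
  assumes "inp s" "s 9 = ord" "s 6 = col" "s 7 = (\<lambda>_. 0)" "s 26 0 = m"
    and oo: "order_ok K ord m col"
    and eo: "\<And>a b i. (\<And>i. i < m \<Longrightarrow> elim_spec K wide ord m col a b i) \<Longrightarrow> i < m \<Longrightarrow> elim_ok K ord m col a b i"
    and K: "1 \<le> K" "K \<le> 6" "wide \<or> K \<le> 5"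
  shows "runs (engine K wide) s (engine_cost K wide * (n + 1)) (good_output K)"
proof -
  note od = order_okD[OF oo]
  have "ord ` {..<m} \<subseteq> {..<n}" using od(2) by auto
  then have mn: "m \<le> n" using card_mono[of "{..<n}" "ord ` {..<m}"] od(1) by (simp add: card_image)
  let ?P = "\<lambda>t. same_except fwd_vars s t \<and> (\<forall>i<m. elim_spec K wide ord m col (t 7) (t 8) i)"
  let ?Q = "\<lambda>t. inp t \<and> (\<forall>v<n. t 6 v \<in> {1..K} \<and> (\<forall>w\<in>N v. compat (w \<in> B v) (t 6 v) (t 6 w)))"
  have "runs (engine K wide) s (5 + (3 + cost (fwd_body K wide)) * (m + 1) +
    (3 + (6 + cost (bwd_body K)) * (m + 1) + (cost table + 3 + (6 + cost write_body) * (n + 1)))) (good_output K)"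
    unfolding engine_def
  proof (rule runs_Seq[where Q = ?P])
    show "runs (forward K wide) s (5 + (3 + cost (fwd_body K wide)) * (m + 1)) ?P"
      using assms od by (intro forward) auto
    fix t assume P: "?P t"
    have "inp t" using P same_except_inp[of fwd_vars s t] assms(1) by auto
    show "runs (Seq (backward K) write_out) t (3 + (6 + cost (bwd_body K)) * (m + 1) + (cost table + 3 + (6 + cost write_body) * (n + 1))) (good_output K)"
    proof (rule runs_Seq[where Q = ?Q])
      have eqs: "t 9 = ord" "t 6 = col" "t 26 0 = m"
        using P assms by (auto simp: same_except_def)
      have "runs (backward K) t (3 + (6 + cost (bwd_body K)) * (m + 1))
        (\<lambda>u. same_except bwd_vars t u \<and> (\<forall>v<n. u 6 v \<in> {1..K} \<and> (\<forall>w\<in>N v. compat (w \<in> B v) (u 6 v) (u 6 w))))"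
        by (rule backward[OF \<open>inp t\<close> eqs(1,2) refl refl eqs(3) oo eo K(1,2)]) (use P in auto)
      then show "runs (backward K) t (3 + (6 + cost (bwd_body K)) * (m + 1)) ?Q"
        by (rule runs_weaken) (use \<open>inp t\<close> same_except_inp[of bwd_vars t] in auto)
    next
      fix u assume Q: "?Q u"
      show "runs write_out u (cost table + 3 + (6 + cost write_body) * (n + 1)) (good_output K)"
      proof (rule runs_weaken[OF write_out])
        fix x :: store assume "\<forall>v<n. x 5 v = stretch (u 6 v)"
        then show "good_output K x" using Q unfolding good_output_def by (intro exI[of _ "u 6"]) auto
      qed (use Q K in auto)
    qed
  qed
  moreover have "5 + (3 + cost (fwd_body K wide)) * (m + 1) +
    (3 + (6 + cost (bwd_body K)) * (m + 1) + (cost table + 3 + (6 + cost write_body) * (n + 1)))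
    \<le> engine_cost K wide * (n + 1)"
  proof -
    have "(3 + cost (fwd_body K wide)) * (m + 1) \<le> (3 + cost (fwd_body K wide)) * (n + 1)"
      "(6 + cost (bwd_body K)) * (m + 1) \<le> (6 + cost (bwd_body K)) * (n + 1)"
      using mn by (auto intro!: mult_le_mono)
    moreover have "11 + cost table \<le> (11 + cost table) * (n + 1)" by simp
    ultimately show ?thesis unfolding engine_cost_def by (simp add: algebra_simps)
  qed
  ultimately show ?thesis by (rule runs_weaken)
qed

end

section \<open>Forest backbones\<close>

text \<open>Removal of leaves with a pointer in variable 27. Removing a vertex can turn only its one
  remaining backbone neighbor into a leaf; that neighbor is examined next, and the pointer moves on
  when such a chain ends. The test is nonzero if the current vertex is already removed or has at
  least two remaining backbone neighbors.\<close>

definition peel_body :: com where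
  "peel_body = Seq (set_var 29 (Const 0))
    (Seq (for_adj 3 4 21 (Cond (Cell 12 (var 21)) Skip (Seq (incr 29) (set_var 30 (var 21)))))
    (Cond (Add (Cell 12 (var 20)) (Sub (var 29) (Const 1)))
      (Seq (incr 27) (set_var 20 (var 27)))
      (Seq (set_var 28 (Sub (var 28) (Const 1)))
      (Seq (Assign 9 (var 28) (var 20))
      (Seq (Assign 12 (var 20) (Const 1))
      (Cond (var 29) (set_var 20 (var 30)) Skip))))))"

definition peel :: com where
  "peel = Seq (set_var 28 (Cell 0 (Const 0))) (Loop (Sub (Cell 0 (Const 0)) (var 27)) peel_body)"

definition forest_program :: com where
  "forest_program = Seq peel (Seq (set_var 26 (Cell 0 (Const 0))) (engine 6 True))"

abbreviation peel_vars :: "nat set" where "peel_vars \<equiv> {9, 12, 20, 21, 27, 28, 29, 30}"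

lemma straight_peel_body: "straight peel_body"
  and writes_peel_body: "writes peel_body = peel_vars"
  by (auto simp: peel_body_def)

context instance_lists begin

text \<open>A union bound: the neighbor \<open>w\<close> takes at most \<open>g w\<close> colors
  away.\<close>

lemma card_avail:
  assumes "v < n" "\<And>w. w \<in> N v \<Longrightarrow> {c. forb col a b (w \<in> B v) w c} \<subseteq> F w \<and> finite (F w) \<and> card (F w) \<le> g w"
  shows "K \<le> card (avail K col a b v) + (\<Sum>w\<in>N v. g w)"
proof -
  have "{1..K} \<subseteq> avail K col a b v \<union> (\<Union>w\<in>N v. F w)" using assms(2) by (auto simp: avail_def)
  moreover have fin: "finite (\<Union>w\<in>N v. F w)" using assms(2) by auto
  ultimately have "card {1..K} \<le> card (avail K col a b v \<union> (\<Union>w\<in>N v. F w))"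
    by (intro card_mono) auto
  also have "\<dots> \<le> card (avail K col a b v) + card (\<Union>w\<in>N v. F w)" by (rule card_Un_le)
  also have "card (\<Union>w\<in>N v. F w) \<le> (\<Sum>w\<in>N v. card (F w))" by (rule card_UN_le) simp
  also have "\<dots> \<le> (\<Sum>w\<in>N v. g w)" using assms(2) by (intro sum_mono) auto
  finally show ?thesis by simp
qed

lemma peel_count:
  assumes "inp t" "t 20 0 = u" "u < n"
  defines "t' \<equiv> ev (Seq (set_var 29 (Const 0))
    (for_adj 3 4 21 (Cond (Cell 12 (var 21)) Skip (Seq (incr 29) (set_var 30 (var 21)))))) t"
  defines "R \<equiv> {w \<in> B u. t 12 w = 0}"
  shows "t' 29 0 = card R" "R \<noteq> {} \<Longrightarrow> t' 30 0 \<in> R"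
proof -
  let ?p = "Cond (Cell 12 (var 21)) Skip (Seq (incr 29) (set_var 30 (var 21)))"
  let ?s = "t(29 := (t 29)(0 := 0))"
  define I where "I D x \<longleftrightarrow> x 29 0 = card {w \<in> D. t 12 w = 0} \<and>
      ({w \<in> D. t 12 w = 0} \<noteq> {} \<longrightarrow> x 30 0 \<in> {w \<in> D. t 12 w = 0})" for D :: "nat set" and x :: store
  have "I (B u) (ev (for_adj 3 4 21 ?p) ?s)"
  proof (rule for_adj_rule)
    show "?s 3 = array_of (offsets hadj)" "?s 4 = array_of (concat hadj)"
      using inp_cells[OF assms(1)] by simp_all
    show "length (hadj ! u) \<le> 4" "distinct (hadj ! u)" using hdeg hdist assms by auto
    fix D x s
    assume a: "I D s" "\<forall>k. k \<notin> insert 21 (writes ?p) \<longrightarrow> s k = ?s k" "x \<notin> D" "D \<subseteq> B u"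
    have fin: "finite {w \<in> D. t 12 w = 0}" using finite_subset[OF a(4)] by simp
    have s12: "s 12 = t 12" using a(2) by simp
    show "I (insert x D) (ev ?p (s(21 := (s 21)(0 := x))))"
    proof (cases "t 12 x = 0")
      case True
      then have e: "{w \<in> insert x D. t 12 w = 0} = insert x {w \<in> D. t 12 w = 0}" by auto
      show ?thesis using a(1,3) fin True unfolding I_def e by (simp add: s12)
    next
      case False
      then have e: "{w \<in> insert x D. t 12 w = 0} = {w \<in> D. t 12 w = 0}" by auto
      show ?thesis using a(1) False unfolding I_def e by (simp add: s12)
    qed
  qed (use assms len in \<open>auto simp: I_def\<close>)
  then show "t' 29 0 = card R" "R \<noteq> {} \<Longrightarrow> t' 30 0 \<in> R"
    unfolding I_def t'_def R_def by simp_all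
qed

text \<open>Array 9 is filled from the top downwards, so that the vertex removed first is also the
  first one eliminated by \<open>forward\<close>. In the last clause the current vertex is exempt,
  being the only one up to the pointer that may be a leaf. Once the pointer is at \<open>n\<close>,
  so is the current vertex, and the exemption no longer concerns a vertex of the graph.\<close>

definition peel_inv :: "store \<Rightarrow> bool" where
  "peel_inv t \<longleftrightarrow> t 27 0 \<le> n \<and> t 28 0 \<le> n \<and> (t 27 0 < n \<longrightarrow> t 20 0 < n) \<and> (t 27 0 = n \<longrightarrow> t 20 0 = n) \<and>
     (\<forall>v. t 12 v \<noteq> 0 \<longleftrightarrow> v \<in> t 9 ` {t 28 0..<n}) \<and> inj_on (t 9) {t 28 0..<n} \<and>
     (\<forall>j\<in>{t 28 0..<n}. t 9 j < n \<and> card (B (t 9 j) - t 9 ` {j<..<n}) \<le> 1) \<and>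
     (\<forall>z<n. z \<le> t 27 0 \<and> t 12 z = 0 \<and> z \<noteq> t 20 0 \<longrightarrow> 2 \<le> card (B z - t 9 ` {t 28 0..<n}))"

text \<open>Each step advances the pointer or removes a vertex, which bounds the number of steps by
  \<open>2 * n\<close>. Removing \<open>u\<close> lowers the count of at most one surviving vertex,
  and this vertex becomes the current one, so the last clause of the invariant survives.\<close>

lemma peel_step:
  assumes "inp t" "peel_inv t" "t 27 0 < n"
  shows "peel_inv (ev peel_body t)"
    and "(n - ev peel_body t 27 0) + ev peel_body t 28 0 < (n - t 27 0) + t 28 0"
proof -
  define i where "i = t 27 0"
  define u where "u = t 20 0"
  define k where "k = t 28 0"
  define E where "E = t 9 ` {k..<n}"
  define R where "R = {w \<in> B u. t 12 w = 0}"
  define s where "s = ev (Seq (set_var 29 (Const 0))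
    (for_adj 3 4 21 (Cond (Cell 12 (var 21)) Skip (Seq (incr 29) (set_var 30 (var 21)))))) t"
  note inv = assms(2)[unfolded peel_inv_def, folded i_def u_def k_def E_def]
  have un: "u < n" "i < n" using inv assms(3) by (auto simp: i_def)
  have el: "t 12 v \<noteq> 0 \<longleftrightarrow> v \<in> E" for v using inv by auto
  have el0: "t 12 v = 0 \<longleftrightarrow> v \<notin> E" for v using el by blast
  then have RE: "R = B u - E" by (auto simp: R_def)
  note pc = peel_count[OF assms(1) u_def[symmetric] un(1), folded s_def R_def]
  have fr: "s 12 = t 12" "s 9 = t 9" "s 20 = t 20" "s 27 = t 27" "s 28 = t 28"
    by (simp_all add: s_def ev_frame)
  have ev: "ev peel_body t = ev (Cond (Add (Cell 12 (var 20)) (Sub (var 29) (Const 1)))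
      (Seq (incr 27) (set_var 20 (var 27)))
      (Seq (set_var 28 (Sub (var 28) (Const 1)))
      (Seq (Assign 9 (var 28) (var 20))
      (Seq (Assign 12 (var 20) (Const 1))
      (Cond (var 29) (set_var 20 (var 30)) Skip))))) s"
    by (simp add: peel_body_def s_def)
  have "peel_inv (ev peel_body t) \<and> (n - ev peel_body t 27 0) + ev peel_body t 28 0 < (n - t 27 0) + t 28 0"
  proof (cases "u \<in> E \<or> 2 \<le> card R")
    case True
    then have test: "aval (Add (Cell 12 (var 20)) (Sub (var 29) (Const 1))) s \<noteq> 0"
      using pc(1) el[of u] by (auto simp: fr u_def)
    have e: "ev peel_body t = s(27 := (s 27)(0 := Suc i), 20 := (s 20)(0 := Suc i))"
      unfolding ev using test by (simp add: fr i_def)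
    have "2 \<le> card (B z - E)" if "z < n" "z \<le> i" "z \<notin> E" for z
    proof (cases "z = u")
      case True
      then show ?thesis using \<open>u \<in> E \<or> 2 \<le> card R\<close> that RE by auto
    next
      case False
      then show ?thesis using inv that el0 by blast
    qed
    then have "peel_inv (ev peel_body t)" using inv un(2) unfolding e peel_inv_def
      by (auto simp: fr k_def[symmetric] E_def[symmetric] le_Suc_eq el0)
    then show ?thesis using un(2) by (simp add: e fr i_def)
  next
    case False
    then have uE: "u \<notin> E" and R1: "card R \<le> 1" by auto
    have "E \<subseteq> {..<n} - {u}" using inv uE by (auto simp: E_def)
    then have "card E \<le> n - 1" using card_mono[of "{..<n} - {u}" E] un by simp
    then have kpos: "0 < k" "k \<le> n" using inv un by (auto simp: E_def card_image)
    have test: "aval (Add (Cell 12 (var 20)) (Sub (var 29) (Const 1))) s = 0"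
      using pc(1) el[of u] uE R1 by (auto simp: fr u_def)
    define u' where "u' = (if R = {} then u else s 30 0)"
    have finR: "finite R" by (simp add: R_def)
    have e: "ev peel_body t 12 = (t 12)(u := 1)" "ev peel_body t 9 = (t 9)(k - 1 := u)"
      "ev peel_body t 28 0 = k - 1" "ev peel_body t 27 0 = i" "ev peel_body t 20 0 = u'"
      unfolding ev ev.simps(4) if_not_P[OF not_not[THEN iffD2, OF test]]
      using pc(1) finR by (auto simp: fr u_def k_def i_def u'_def)
    have u'n: "u' < n" using pc(2) un nb[OF un(1)] hsub[OF un(1)] by (auto simp: u'_def R_def)
    let ?o = "(t 9)(k - 1 := u)"
    have im: "?o ` {j<..<n} = t 9 ` {j<..<n}" if "k - 1 \<le> j" for j using that by (intro image_cong) auto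
    have iv: "{k - 1..<n} = insert (k - 1) {k..<n}" "{k - 1<..<n} = {k..<n}" using kpos by auto
    have img: "?o ` {k..<n} = t 9 ` {k..<n}" using kpos by (intro image_cong) auto
    then have E': "?o ` {k - 1..<n} = insert u E" by (simp only: iv(1) image_insert fun_upd_same E_def)
    have B1: "?o j < n \<and> card (B (?o j) - ?o ` {j<..<n}) \<le> 1" if "j \<in> {k - 1..<n}" for j
    proof (cases "j = k - 1")
      case True
      have 1: "?o ` {j<..<n} = E" using im[OF order_refl] unfolding True iv(2) E_def .
      have 2: "?o j = u" using True by simp
      show ?thesis unfolding 1 2 using un R1 RE by simp
    next
      case False
      then have 1: "?o ` {j<..<n} = t 9 ` {j<..<n}" "?o j = t 9 j" "j \<in> {k..<n}"
        using that im[of j] by auto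
      show ?thesis unfolding 1(1,2) using inv 1(3) by blast
    qed
    have B2: "2 \<le> card (B z - insert u E)" if z: "z < n" "z \<le> i" "z \<notin> insert u E" "z \<noteq> u'" for z
    proof -
      have c: "2 \<le> card (B z - E)" using inv z el0 by blast
      have "u \<notin> B z"
      proof
        assume "u \<in> B z"
        then have zR: "z \<in> R" using B_sym[OF z(1) un(1)] z(3) by (auto simp: RE)
        then have "s 30 0 \<in> R" "u' = s 30 0" using pc(2) by (auto simp: u'_def)
        then show False using zR R1 finR z(4) by (metis card_le_Suc0_iff_eq One_nat_def)
      qed
      then have "B z - insert u E = B z - E" by auto
      then show ?thesis using c by simp
    qed
    have "inj_on (t 9) {k..<n}" using inv by blast
    then have "inj_on ?o {k..<n}" using kpos by (auto simp: inj_on_def)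
    moreover have "?o (k - 1) \<notin> ?o ` ({k..<n} - {k - 1})"
      using uE img unfolding E_def fun_upd_same by blast
    ultimately have inj: "inj_on ?o {k - 1..<n}" unfolding iv(1) inj_on_insert by blast
    have z: "((t 12)(u := 1)) v \<noteq> 0 \<longleftrightarrow> v \<in> insert u E" for v using el[of v] by simp
    have B2': "\<forall>z<n. z \<le> i \<and> ((t 12)(u := 1)) z = 0 \<and> z \<noteq> u' \<longrightarrow> 2 \<le> card (B z - insert u E)"
      using B2 z by blast
    have "peel_inv (ev peel_body t)" unfolding peel_inv_def e E'
      by (intro conjI) (use un in simp, use kpos in simp, use u'n in simp, use un in simp, use z in blast,
          rule inj, use B1 in blast, rule B2')
    then show ?thesis using kpos by (simp add: e i_def[symmetric] k_def[symmetric])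
  qed
  then show "peel_inv (ev peel_body t)"
    "(n - ev peel_body t 27 0) + ev peel_body t 28 0 < (n - t 27 0) + t 28 0" by auto
qed

lemma peel:
  assumes "s = input_store lam adj hadj"
    and forest: "\<And>S. S \<subseteq> {..<n} \<Longrightarrow> S \<noteq> {} \<Longrightarrow> \<exists>v\<in>S. card (B v \<inter> S) \<le> 1"
  shows "runs peel s (4 + (6 + cost peel_body) * (2 * n + 1))
    (\<lambda>t. same_except peel_vars s t \<and> inj_on (t 9) {..<n} \<and> t 9 ` {..<n} = {..<n} \<and>
      (\<forall>j<n. card (B (t 9 j) - t 9 ` {j<..<n}) \<le> 1))"
proof -
  have inp: "inp s" by (simp add: assms(1) inp_def)
  have zero: "s k = (\<lambda>_. 0)" if "5 \<le> k" for k using that by (auto simp: assms(1) input_store_def)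
  define I where "I t \<longleftrightarrow> same_except peel_vars s t \<and> peel_inv t" for t
  let ?s = "s(28 := (s 28)(0 := n))"
  have init: "I ?s" by (auto simp: I_def same_except_def peel_inv_def zero)
  have it: "inp t" if "I t" for t using that inp same_except_inp[of peel_vars s t] by (auto simp: I_def)
  let ?b = "Sub (Cell 0 (Const 0)) (var 27)"
  have st: "I (ev peel_body t) \<and> (n - ev peel_body t 27 0) + ev peel_body t 28 0 < (n - t 27 0) + t 28 0"
    if t: "I t" "aval ?b t \<noteq> 0" for t
  proof -
    have "t 27 0 < n" using t(2) inp_cells[OF it[OF t(1)]] by simp
    then show ?thesis using peel_step[OF it[OF t(1)]] t(1)
      same_except_ev[of peel_vars s t peel_body] writes_peel_body by (simp add: I_def)
  qed
  have "runs (Loop ?b peel_body) ?s ((1 + acost ?b + cost peel_body) * ((n - ?s 27 0) + ?s 28 0 + 1)) (\<lambda>t. I t \<and> aval ?b t = 0)"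
    by (rule runs_Loop[where I = I and \<mu> = "\<lambda>t. (n - t 27 0) + t 28 0", OF straight_peel_body init st])
  then have "runs peel s (4 + (1 + acost ?b + cost peel_body) * ((n - ?s 27 0) + ?s 28 0 + 1)) (\<lambda>t. I t \<and> aval ?b t = 0)"
    unfolding peel_def
    by (rule runs_Seq_straight[rotated 2]) (simp_all add: inp_cells[OF inp])
  then show ?thesis
  proof (rule runs_weaken)
    show "4 + (1 + acost ?b + cost peel_body) * ((n - ?s 27 0) + ?s 28 0 + 1) \<le> 4 + (6 + cost peel_body) * (2 * n + 1)"
      by (simp add: zero algebra_simps)
    fix t assume a: "I t \<and> aval ?b t = 0"
    then have t: "I t" "n \<le> t 27 0" using inp_cells[OF it, of t] by auto
    note inv = t(1)[unfolded I_def peel_inv_def]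
    let ?E = "t 9 ` {t 28 0..<n}"
    have En: "?E \<subseteq> {..<n}" using inv by auto
    \<comment> \<open>Otherwise degeneracy yields a survivor with at most one surviving backbone
      neighbor, against the last clause of the invariant.\<close>
    have "{..<n} - ?E = {}"
    proof (rule ccontr)
      assume "{..<n} - ?E \<noteq> {}"
      then obtain v where v: "v \<in> {..<n} - ?E" "card (B v \<inter> ({..<n} - ?E)) \<le> 1"
        using forest[of "{..<n} - ?E"] by auto
      have "B v \<inter> ({..<n} - ?E) = B v - ?E" using v(1) hsub[of v] nb[of v] by auto
      moreover have "2 \<le> card (B v - ?E)" using inv t(2) v(1) by auto
      ultimately show False using v(2) by simp
    qed
    then have E: "?E = {..<n}" using En by auto
    then have "n - t 28 0 = n" using inv card_image[of "t 9" "{t 28 0..<n}"] by simp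
    then have k: "t 28 0 = 0 \<or> n = 0" by arith
    then have "{t 28 0..<n} = {..<n}" by auto
    then show "same_except peel_vars s t \<and> inj_on (t 9) {..<n} \<and> t 9 ` {..<n} = {..<n} \<and>
      (\<forall>j<n. card (B (t 9 j) - t 9 ` {j<..<n}) \<le> 1)"
      using inv E by auto
  qed
qed

text \<open>Because \<open>b = a + 1\<close>, an eliminated neighbor takes at most one color,
  whether it is a backbone neighbor or not. With six colors and at most four neighbors, the list
  exceeds the number of remaining neighbors by two, and hence the number of remaining ordinary
  neighbors by three if there is a \<open>p\<close>.\<close>

lemma forest_elim_ok:
  assumes inj: "inj_on ord {..<n}" and im: "ord ` {..<n} = {..<n}"
    and one: "\<And>j. j < n \<Longrightarrow> card (B (ord j) - ord ` {j<..<n}) \<le> 1"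
    and spec: "\<And>i. i < n \<Longrightarrow> elim_spec 6 True ord n (\<lambda>_. 0) a b i" and i: "i < n"
  shows "elim_ok 6 ord n (\<lambda>_. 0) a b i"
proof -
  define v where "v = ord i"
  define E where "E = ord ` {i<..<n}"
  define P where "P = ord ` {..<i}"
  define L where "L = elim_list 6 ord n (\<lambda>_. 0) a b i"
  have vn: "v < n" using im i by (auto simp: v_def)
  have "{..<n} = insert i ({..<i} \<union> {i<..<n})" using i by auto
  then have "ord ` {..<n} = ord ` insert i ({..<i} \<union> {i<..<n})" by (rule arg_cong)
  then have V: "{..<n} = insert v (P \<union> E)" unfolding im by (simp only: image_insert image_Un v_def P_def E_def)
  have disj: "P \<inter> E = {}"
  proof -
    have False if w: "w \<in> P" "w \<in> E" for w
    proof -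
      obtain x y where "x < i" "w = ord x" "i < y" "y < n" "w = ord y" using w by (auto simp: P_def E_def)
      then show False using inj_onD[OF inj, of x y] i by auto
    qed
    then show ?thesis by blast
  qed
  have NE: "N v \<subseteq> P \<union> E" using nb[OF vn] V by auto
  have bw: "b w = a w + 1" if wn: "w < n" for w
  proof -
    have "w \<in> ord ` {..<n}" using wn unfolding im by simp
    then obtain j where "j < n" "w = ord j" by blast
    then show ?thesis using spec[of j] by (simp add: elim_spec_def)
  qed
  define F where "F w = (if w \<in> E then {if w \<in> B v then a w + 1 else a w} else {})" for w
  define g where "g w = (if w \<in> E then 1 else 0 :: nat)" for w
  have F: "{c. forb (\<lambda>_. 0) (restr a E) b (w \<in> B v) w c} \<subseteq> F w \<and> finite (F w) \<and> card (F w) \<le> g w"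
    if "w \<in> N v" for w
  proof -
    have "b w = a w + 1" using bw nb[OF vn that] by blast
    then show ?thesis by (auto simp: forb_def restr_def F_def g_def)
  qed
  have "6 \<le> card (avail 6 (\<lambda>_. 0) (restr a E) b v) + (\<Sum>w\<in>N v. g w)"
    by (rule card_avail[where F = F and g = g, OF vn F])
  moreover have "(\<Sum>w\<in>N v. g w) = card (N v \<inter> E)"
    by (simp add: g_def sum.If_cases Int_commute)
  moreover have "card (N v) = card (N v \<inter> P) + card (N v \<inter> E)"
  proof -
    have "N v = (N v \<inter> P) \<union> (N v \<inter> E)" using NE by blast
    also have "card \<dots> = card (N v \<inter> P) + card (N v \<inter> E)"
      by (rule card_Un_disjoint) (use disj in auto)
    finally show ?thesis .
  qed
  ultimately have cL: "card (N v \<inter> P) + 2 \<le> card L"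
    using card_N[OF vn] by (simp add: L_def elim_list_def E_def v_def)
  then have "L \<noteq> {}" by auto
  moreover note spec[OF i, unfolded elim_spec_def, folded v_def L_def]
  moreover have "B v \<inter> P = {p} \<and> card (N v \<inter> P - {p}) + 2 \<le> card L \<and> card (N v \<inter> P - {p}) + 3 \<le> card L"
    if p: "p \<in> B v \<inter> P" for p
  proof
    have "B v \<inter> P \<subseteq> B v - E" using disj by auto
    then have "card (B v \<inter> P) \<le> 1" using one[OF i, folded v_def E_def] card_mono[of "B v - E" "B v \<inter> P"] by simp
    then have "\<forall>x\<in>B v \<inter> P. \<forall>y\<in>B v \<inter> P. x = y" using card_le_Suc0_iff_eq[of "B v \<inter> P"] by simp
    then show "B v \<inter> P = {p}" using p by blast
    have "p \<in> N v \<inter> P" using p hsub[OF vn] by auto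
    then show "card (N v \<inter> P - {p}) + 2 \<le> card L \<and> card (N v \<inter> P - {p}) + 3 \<le> card L" using cL card_Suc_Diff1[of "N v \<inter> P" p] by simp
  qed
  ultimately show ?thesis unfolding elim_ok_def v_def[symmetric] L_def[symmetric] P_def[symmetric] by blast
qed

lemma forest_program:
  assumes forest: "\<And>S. S \<subseteq> {..<n} \<Longrightarrow> S \<noteq> {} \<Longrightarrow> \<exists>v\<in>S. card (B v \<inter> S) \<le> 1"
  shows "runs forest_program (input_store lam adj hadj)
    ((20 + 2 * cost peel_body + engine_cost 6 True) * (n + 1)) (good_output 6)"
proof -
  let ?s = "input_store lam adj hadj"
  have inp: "inp ?s" by (simp add: inp_def)
  have zero: "?s k = (\<lambda>_. 0)" if "5 \<le> k" for k using that by (auto simp: input_store_def)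
  have "runs forest_program ?s (4 + (6 + cost peel_body) * (2 * n + 1) + (4 + engine_cost 6 True * (n + 1))) (good_output 6)"
    unfolding forest_program_def
  proof (rule runs_Seq[OF peel[OF refl forest]])
    fix t
    assume t: "same_except peel_vars ?s t \<and> inj_on (t 9) {..<n} \<and> t 9 ` {..<n} = {..<n} \<and>
      (\<forall>j<n. card (B (t 9 j) - t 9 ` {j<..<n}) \<le> 1)"
    then have "inp t" using inp same_except_inp[of peel_vars ?s t] by auto
    let ?t = "t(26 := (t 26)(0 := n))"
    have "runs (engine 6 True) ?t (engine_cost 6 True * (n + 1)) (good_output 6)"
    proof (rule engine[where ord = "t 9" and col = "\<lambda>_. 0" and m = n])
      show "?t 6 = (\<lambda>_. 0)" "?t 7 = (\<lambda>_. 0)" using t zero by (simp_all add: same_except_def)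
      have "t 9 i < n" if "i < n" for i using t that by blast
      then show "order_ok 6 (t 9) n (\<lambda>_. 0)" using t by (auto simp: order_ok_def)
      show "elim_ok 6 (t 9) n (\<lambda>_. 0) a b i"
        if "\<And>i. i < n \<Longrightarrow> elim_spec 6 True (t 9) n (\<lambda>_. 0) a b i" "i < n" for a b i
        by (rule forest_elim_ok) (use t that in auto)
    qed (use \<open>inp t\<close> in auto)
    then show "runs (Seq (set_var 26 (Cell 0 (Const 0))) (engine 6 True)) t (4 + engine_cost 6 True * (n + 1)) (good_output 6)"
      by (rule runs_Seq_straight[rotated 2]) (simp_all add: inp_cells[OF \<open>inp t\<close>])
  qed
  then show ?thesis by (rule runs_weaken) (auto simp: algebra_simps)
qed

end

section \<open>Matching backbones\<close>

locale matching_lists = instance_lists +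
  assumes hmatch: "v < n \<Longrightarrow> length (hadj ! v) \<le> 1"
begin

abbreviation mt :: "nat \<Rightarrow> bool" where "mt v \<equiv> hadj ! v \<noteq> []"
definition pt :: "nat \<Rightarrow> nat" where "pt v = hd (hadj ! v)"
text \<open>The vertices that keep a color out of five even when all their neighbors are eliminated
  before them.\<close>

definition good :: "nat set" where "good = {v. v < n \<and> (\<not> mt v \<or> length (adj ! v) < 4)}"

lemma B_pt: "v < n \<Longrightarrow> mt v \<Longrightarrow> B v = {pt v}"
  using hmatch[of v] by (cases "hadj ! v") (auto simp: pt_def)

lemma pt:
  assumes "v < n" "mt v"
  shows "pt v < n" "pt v \<noteq> v" "pt v \<in> N v" "mt (pt v)" "pt (pt v) = v" "v \<in> N (pt v)"
proof -
  have 1: "pt v \<in> B v" using B_pt assms by simp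
  show 2: "pt v \<in> N v" using 1 hsub assms by auto
  show 3: "pt v < n" "pt v \<noteq> v" "v \<in> N (pt v)" using nb[OF assms(1) 2] by auto
  have 4: "v \<in> B (pt v)" using hsym[OF assms(1) 1] .
  then show 5: "mt (pt v)" by auto
  show "pt (pt v) = v" using B_pt[OF 3(1) 5] 4 by simp
qed

lemma N_sym: "v < n \<Longrightarrow> w \<in> N v \<Longrightarrow> v \<in> N w" using nb by blast

text \<open>The positions from \<open>m1\<close> on belong to the vertices called \<open>u\<close>
  in the overview, which are eliminated first. A list loses one color per eliminated or precolored
  neighbor and one more if an eliminated partner has made two different deletions. While the partner
  is present the extra loss does not occur, and counting suffices; for the second endpoint of a
  matching edge, \<open>root\<close> supplies the color that makes up for it.\<close>

lemma matching_elim_ok: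
  assumes inj: "inj_on ord {..<m}" and m1: "m1 \<le> m"
    and dom: "\<And>i. i < m \<Longrightarrow> ord i < n" "\<And>i. i < m \<Longrightarrow> col (ord i) = 0"
    and cov: "\<And>v. v < n \<Longrightarrow> col v = 0 \<Longrightarrow> v \<in> ord ` {..<m}"
    and pre: "\<And>v. v < n \<Longrightarrow> mt v \<Longrightarrow> col v = 0 \<Longrightarrow> col (pt v) = 0"
    and root: "\<And>i. i < m1 \<Longrightarrow> ord i \<in> good \<or> (\<exists>j<i. ord j \<in> N (ord i)) \<or> pt (ord i) \<in> ord ` {m1..<m}"
    and spec_mt: "\<And>i. m1 \<le> i \<Longrightarrow> i < m \<Longrightarrow> mt (ord i) \<and> pt (ord i) \<in> ord ` {..<m1}"
    and spec_col: "\<And>i. m1 \<le> i \<Longrightarrow> i < m \<Longrightarrow> \<exists>x\<in>N (ord i). col x = 2"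
    and spec_nb: "\<And>i w. m1 \<le> i \<Longrightarrow> i < m \<Longrightarrow> w \<in> N (ord i) \<Longrightarrow> col w \<in> {0, 2, 4} \<and> w \<notin> ord ` {m1..<m}"
    and spec: "\<And>i. i < m \<Longrightarrow> elim_spec 5 False ord m col a b i" and i: "i < m"
  shows "elim_ok 5 ord m col a b i"
proof -
  \<comment> \<open>No neighbor of this vertex has been eliminated yet, and their colors are among 2
    and 4, with 2 occurring. So 1 is in its list and 2 is not, which gives \<open>b = a + 1\<close>
    and costs the partner the single color 2.\<close>
  have special: "a (ord j) = 1 \<and> b (ord j) = 2 \<and> 1 \<in> elim_list 5 ord m col a b j" if j: "m1 \<le> j" "j < m" for j
  proof -
    let ?u = "ord j"
    have un: "?u < n" using dom j by simp
    have mu: "mt ?u" "pt ?u \<in> ord ` {..<m1}" using spec_mt[OF j] by auto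
    have nE: "w \<notin> ord ` {j<..<m}" if "w \<in> N ?u" for w using spec_nb[OF j that] j by auto
    have Bcol: "col w = 0" if "w \<in> B ?u" for w using that B_pt[OF un mu(1)] mu(2) dom m1 by auto
    have F: "forb col (restr a (ord ` {j<..<m})) b (w \<in> B ?u) w c \<longleftrightarrow> col w \<noteq> 0 \<and> c = col w" if "w \<in> N ?u" for w c
      using nE[OF that] Bcol[of w] by (auto simp: forb_def restr_def)
    have "\<not> forb col (restr a (ord ` {j<..<m})) b (w \<in> B ?u) w 1" if "w \<in> N ?u" for w
      using F[OF that, of 1] spec_nb[OF j that] by auto
    then have 1: "1 \<in> elim_list 5 ord m col a b j" unfolding elim_list_def avail_def by simp
    moreover have 2: "2 \<notin> elim_list 6 ord m col a b j"
    proof -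
      obtain x where x: "x \<in> N ?u" "col x = 2" using spec_col[OF j] by auto
      then have "forb col (restr a (ord ` {j<..<m})) b (x \<in> B ?u) x 2" using F[OF x(1), of 2] by simp
      then show ?thesis using x(1) unfolding elim_list_def avail_def by blast
    qed
    moreover note sp = spec[OF j(2), unfolded elim_spec_def]
    ultimately have a1: "a ?u = 1" by (metis atLeastAtMost_iff le_antisym)
    with sp 2 have "b ?u = 2" by (simp add: numeral_2_eq_2)
    with a1 1 show ?thesis by blast
  qed
  define v where "v = ord i"
  define E where "E = ord ` {i<..<m}"
  define P where "P = ord ` {..<i}"
  define L where "L = elim_list 5 ord m col a b i"
  define C where "C = {w. col w \<noteq> 0}"
  have vn: "v < n" and v0: "col v = 0" using dom i by (auto simp: v_def)
  have "{..<m} = insert i ({..<i} \<union> {i<..<m})" using i by auto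
  then have "ord ` {..<m} = ord ` insert i ({..<i} \<union> {i<..<m})" by (rule arg_cong)
  then have V: "ord ` {..<m} = insert v (P \<union> E)" by (simp only: image_insert image_Un v_def P_def E_def)
  have PE: "P \<inter> E = {}" "v \<notin> P" "v \<notin> E"
  proof -
    have False if w: "w \<in> P" "w \<in> E" for w
    proof -
      obtain x y where "x < i" "w = ord x" "i < y" "y < m" "w = ord y" using w by (auto simp: P_def E_def)
      then show False using inj_onD[OF inj, of x y] i by auto
    qed
    then show "P \<inter> E = {}" by blast
    have ne: "ord x \<noteq> v" if "i \<noteq> x" "x < m" for x using inj_onD[OF inj, of i x] that i by (auto simp: v_def)
    show "v \<notin> P"
    proof
      assume "v \<in> P"
      then obtain x where "x < i" "v = ord x" by (auto simp: P_def)
      then show False using ne[of x] i by simp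
    qed
    show "v \<notin> E"
    proof
      assume "v \<in> E"
      then obtain x where "i < x" "x < m" "v = ord x" by (auto simp: E_def)
      then show False using ne[of x] by simp
    qed
  qed
  have PC: "P \<inter> C = {}" using dom(2) i by (auto simp: P_def C_def)
  have cover: "w \<in> P \<union> (E \<union> C)" if "w \<in> N v" for w
    using cov[of w] nb[OF vn that] V by (auto simp: C_def)
  have NN: "card (N v) = card (N v \<inter> P) + card (N v \<inter> (E \<union> C))"
  proof -
    have "N v = (N v \<inter> P) \<union> (N v \<inter> (E \<union> C))" using cover by blast
    also have "card \<dots> = card (N v \<inter> P) + card (N v \<inter> (E \<union> C))"
      by (rule card_Un_disjoint) (use PE PC in auto)
    finally show ?thesis .
  qed
  have BC: "w \<notin> C" if "w \<in> B v" for w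
    using pre[OF vn _ v0] that B_pt[OF vn] by (cases "mt v") (auto simp: C_def)
  \<comment> \<open>The two deletions of an eliminated partner count twice only if \<open>b\<close>
    differs from \<open>a + 1\<close>; this is the third summand of the estimate below.\<close>
  define F where "F w = (if w \<in> C then {col w} else if w \<in> E then (if w \<in> B v then {a w + 1, b w} else {a w}) else {})" for w
  have Fw: "{c. forb col (restr a E) b (w \<in> B v) w c} \<subseteq> F w \<and> finite (F w) \<and> card (F w) \<le> card (F w)" for w
    using BC[of w] by (auto simp: forb_def restr_def F_def C_def)
  have "5 \<le> card (avail 5 col (restr a E) b v) + (\<Sum>w\<in>N v. card (F w))"
    by (rule card_avail[where F = F and g = "\<lambda>w. card (F w)", OF vn Fw])
  then have cL: "5 \<le> card L + (\<Sum>w\<in>N v. card (F w))" by (simp add: L_def elim_list_def E_def v_def)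
  have F1: "card (F w) \<le> (if w \<in> E \<union> C then 1 else 0) + (if w \<in> B v \<inter> E \<and> b w \<noteq> a w + 1 then 1 else 0)" for w
    by (auto simp: F_def card_insert_if)
  have "(\<Sum>w\<in>N v. card (F w)) \<le> (\<Sum>w\<in>N v. (if w \<in> E \<union> C then 1 else 0) + (if w \<in> B v \<inter> E \<and> b w \<noteq> a w + 1 then 1 else 0))"
    by (rule sum_mono) (rule F1)
  also have "\<dots> = card (N v \<inter> (E \<union> C)) + card {w \<in> N v. w \<in> B v \<inter> E \<and> b w \<noteq> a w + 1}"
  proof -
    have "(\<Sum>w\<in>N v. if w \<in> E \<union> C then 1 else 0 :: nat) = card (N v \<inter> (E \<union> C))"
      by (subst sum.inter_restrict[symmetric]) simp_all
    moreover have "(\<Sum>w\<in>N v. if w \<in> B v \<inter> E \<and> b w \<noteq> a w + 1 then 1 else 0 :: nat) = card {w \<in> N v. w \<in> B v \<inter> E \<and> b w \<noteq> a w + 1}"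
      by (subst sum.inter_filter[symmetric]) simp_all
    ultimately show ?thesis by (simp only: sum.distrib)
  qed
  finally have sumF: "5 \<le> card L + card (N v \<inter> (E \<union> C)) + card {w \<in> N v. w \<in> B v \<inter> E \<and> b w \<noteq> a w + 1}"
    using cL by simp
  note sp = spec[OF i, unfolded elim_spec_def, folded v_def L_def]
  have L56: "L \<subseteq> elim_list 6 ord m col a b i" by (auto simp: L_def elim_list_def avail_def)
  \<comment> \<open>If \<open>b\<close> is not \<open>a\<close>, then \<open>a + 1\<close> is
    missing from the list over six colors, which contains \<open>L\<close>.\<close>
  have ab: "b v = a v \<or> a v + 1 \<notin> L" using sp L56 by (metis subsetD)
  show ?thesis
  proof (cases "B v \<inter> P = {}")
    case False
    then obtain p where p: "p \<in> B v" "p \<in> P" by auto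
    then have "mt v" by auto
    then have Bp: "B v = {p}" using B_pt[OF vn] p(1) by simp
    then have "{w \<in> N v. w \<in> B v \<inter> E \<and> b w \<noteq> a w + 1} = {}" using p PE(1) by auto
    then have "5 \<le> card L + card (N v \<inter> (E \<union> C))" using sumF by (simp only: card.empty)
    moreover have "p \<in> N v \<inter> P" using p hsub[OF vn] by auto
    then have "card (N v \<inter> P) = Suc (card (N v \<inter> P - {p}))"
      using card_Suc_Diff1[of "N v \<inter> P" p] by simp
    ultimately have k: "card (N v \<inter> P - {p}) + 2 \<le> card L" using NN card_N[OF vn] by simp
    then have "L \<noteq> {}" by auto
    then have "a v \<in> L" "\<forall>c\<in>L. a v \<le> c" using sp by blast+
    moreover have "B v \<inter> P = {p}" using Bp p by auto
    ultimately show ?thesis unfolding elim_ok_def v_def[symmetric] L_def[symmetric] P_def[symmetric]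
      using k ab by (metis singletonD)
  next
    case True
    have "1 \<le> card L"
    proof (cases "mt v")
      case False
      then have "{w \<in> N v. w \<in> B v \<inter> E \<and> b w \<noteq> a w + 1} = {}" by auto
      then have "5 \<le> card L + card (N v \<inter> (E \<union> C))" using sumF by (simp only: card.empty)
      then show ?thesis using NN card_N[OF vn] by simp
    next
      case mv: True
      note pv = pt[OF vn mv]
      have pE: "pt v \<in> E" using cover[OF pv(3)] True B_pt[OF vn mv] BC[of "pt v"] by auto
      \<comment> \<open>A vertex at a position from \<open>m1\<close> on has its partner below
        \<open>m1\<close>, so the partner would still be present.\<close>
      have i1: "i < m1"
      proof (rule ccontr)
        assume "\<not> i < m1"
        then have "pt v \<in> ord ` {..<m1}" "m1 \<le> i" using spec_mt[of i] i by (auto simp: v_def)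
        then have "pt v \<in> P" by (auto simp: P_def)
        then show False using pE PE by auto
      qed
      have c1: "card {w \<in> N v. w \<in> B v \<inter> E \<and> b w \<noteq> a w + 1} \<le> 1"
        using card_mono[of "{pt v}" "{w \<in> N v. w \<in> B v \<inter> E \<and> b w \<noteq> a w + 1}"] B_pt[OF vn mv] by auto
      consider "length (adj ! v) < 4" | "\<exists>j<i. ord j \<in> N v" | "pt v \<in> ord ` {m1..<m}"
        using root[OF i1] mv by (auto simp: good_def v_def)
      then show ?thesis
      proof cases
        case 1
        then have "card (N v) < 4" using dist[OF vn] by (simp add: distinct_card)
        then show ?thesis using sumF c1 NN by simp
      next
        case 2
        then have "N v \<inter> P \<noteq> {}" by (auto simp: P_def)
        then have "1 \<le> card (N v \<inter> P)" by (simp add: Suc_le_eq card_gt_0_iff)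
        then show ?thesis using sumF c1 NN card_N[OF vn] by linarith
      next
        case 3
        then obtain j where "m1 \<le> j" "j < m" "pt v = ord j" by auto
        then have "b (pt v) = a (pt v) + 1" using special[of j] by simp
        then have "{w \<in> N v. w \<in> B v \<inter> E \<and> b w \<noteq> a w + 1} = {}" using B_pt[OF vn mv] by auto
        then have "5 \<le> card L + card (N v \<inter> (E \<union> C))" using sumF by (simp only: card.empty)
        then show ?thesis using NN card_N[OF vn] by simp
      qed
    qed
    then have "L \<noteq> {}" by auto
    then have "a v \<in> L" "\<forall>c\<in>L. a v \<le> c" using sp by blast+
    then show ?thesis unfolding elim_ok_def v_def[symmetric] L_def[symmetric] P_def[symmetric]
      using True by blast
  qed
qed

end

section \<open>Breadth-first search on matching edges\<close>

context matching_lists begin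

text \<open>
  State of a breadth-first search that visits the endpoints of a matching edge together: \<open>q\<close> is the
  queue, of which the first \<open>h\<close> vertices have been expanded, \<open>pr v\<close> is the number of the edge
  containing \<open>v\<close> in order of discovery (\<open>0\<close> if undiscovered) and \<open>rt v\<close> the start vertex of the
  component of \<open>v\<close>. The vertex that made the latest discovery in the component started at \<open>r\<close> is
  \<open>lu r = fu r\<close>, and \<open>fx r\<close> is the vertex it discovered.
\<close>

definition pair_inv where
  "pair_inv S pr rt lu fu fx q k h \<longleftrightarrow>
     h \<le> 2 * k \<and> inj_on q {..<2 * k} \<and>
     (\<forall>j<2 * k. q j \<in> S \<and> pr (q j) = j div 2 + 1) \<and>
     (\<forall>v. pr v \<noteq> (0::nat) \<longrightarrow> v \<in> q ` {..<2 * k} \<and> pr (pt v) = pr v \<and>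
        pr (rt v) \<noteq> 0 \<and> rt (rt v) = rt v \<and> rt (pt v) = rt v) \<and>
     (\<forall>u v. pr u \<noteq> 0 \<and> pr u = pr v \<longrightarrow> v = u \<or> v = pt u) \<and>
     (\<forall>j<h. \<forall>w\<in>N (q j). pr w \<noteq> 0) \<and>
     (\<forall>u w. pr u \<noteq> 0 \<and> pr w \<noteq> 0 \<and> w \<in> N u \<longrightarrow> rt w = rt u) \<and>
     (\<forall>j. h \<le> j \<and> j < 2 * k \<longrightarrow> rt (q j) = rt (q h)) \<and>
     (\<forall>r. pr r \<noteq> 0 \<and> rt r = r \<longrightarrow>
        pr (lu r) \<noteq> 0 \<and> rt (lu r) = r \<and> pr (lu r) \<le> h div 2 + 1 \<and> fu r = lu r \<and>
        ((\<forall>z. pr z \<noteq> 0 \<and> rt z = r \<longrightarrow> pr z = pr r) \<or>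
         fx r \<in> N (lu r) \<and> rt (fx r) = r \<and> pr (lu r) < pr (fx r))) \<and>
     (\<forall>z. pr z \<noteq> 0 \<longrightarrow> pr z = pr (rt z) \<or>
        (\<exists>c. pr c \<noteq> 0 \<and> rt c = rt z \<and> pr c < pr z \<and> pr c \<le> pr (lu (rt z)) \<and> (c \<in> N z \<or> c \<in> N (pt z))))"

lemma pair_invD:
  assumes "pair_inv S pr rt lu fu fx q k h"
  shows "h \<le> 2 * k" "inj_on q {..<2 * k}"
    "j < 2 * k \<Longrightarrow> q j \<in> S" "j < 2 * k \<Longrightarrow> pr (q j) = j div 2 + 1"
    "pr v \<noteq> 0 \<Longrightarrow> v \<in> q ` {..<2 * k}" "pr v \<noteq> 0 \<Longrightarrow> pr (pt v) = pr v"
    "pr v \<noteq> 0 \<Longrightarrow> pr (rt v) \<noteq> 0" "pr v \<noteq> 0 \<Longrightarrow> rt (rt v) = rt v" "pr v \<noteq> 0 \<Longrightarrow> rt (pt v) = rt v"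
    "pr u \<noteq> 0 \<Longrightarrow> pr u = pr v \<Longrightarrow> v = u \<or> v = pt u"
    "j < h \<Longrightarrow> w \<in> N (q j) \<Longrightarrow> pr w \<noteq> 0"
    "pr u \<noteq> 0 \<Longrightarrow> pr w \<noteq> 0 \<Longrightarrow> w \<in> N u \<Longrightarrow> rt w = rt u"
    "h \<le> j \<Longrightarrow> j < 2 * k \<Longrightarrow> rt (q j) = rt (q h)"
    "pr r \<noteq> 0 \<Longrightarrow> rt r = r \<Longrightarrow> pr (lu r) \<noteq> 0" "pr r \<noteq> 0 \<Longrightarrow> rt r = r \<Longrightarrow> rt (lu r) = r"
    "pr r \<noteq> 0 \<Longrightarrow> rt r = r \<Longrightarrow> pr (lu r) \<le> h div 2 + 1" "pr r \<noteq> 0 \<Longrightarrow> rt r = r \<Longrightarrow> fu r = lu r"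
    "pr r \<noteq> 0 \<Longrightarrow> rt r = r \<Longrightarrow> (\<forall>z. pr z \<noteq> 0 \<and> rt z = r \<longrightarrow> pr z = pr r) \<or>
         fx r \<in> N (lu r) \<and> rt (fx r) = r \<and> pr (lu r) < pr (fx r)"
    "pr z \<noteq> 0 \<Longrightarrow> pr z = pr (rt z) \<or>
        (\<exists>c. pr c \<noteq> 0 \<and> rt c = rt z \<and> pr c < pr z \<and> pr c \<le> pr (lu (rt z)) \<and> (c \<in> N z \<or> c \<in> N (pt z)))"
proof -
  note c = assms[unfolded pair_inv_def]
  note a = c[THEN conjunct1] c[THEN conjunct2, THEN conjunct1]
  note c = c[THEN conjunct2, THEN conjunct2]
  note a = a c[THEN conjunct1] c[THEN conjunct2, THEN conjunct1]
  note c = c[THEN conjunct2, THEN conjunct2]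
  note a = a c[THEN conjunct1] c[THEN conjunct2, THEN conjunct1]
  note c = c[THEN conjunct2, THEN conjunct2]
  note a = a c[THEN conjunct1] c[THEN conjunct2, THEN conjunct1]
  note c = c[THEN conjunct2, THEN conjunct2]
  note a = a c[THEN conjunct1] c[THEN conjunct2]
  show "h \<le> 2 * k" "inj_on q {..<2 * k}" using a(1,2) .
  show "j < 2 * k \<Longrightarrow> q j \<in> S" "j < 2 * k \<Longrightarrow> pr (q j) = j div 2 + 1" using a(3)[rule_format, of j] by blast+
  show "pr v \<noteq> 0 \<Longrightarrow> v \<in> q ` {..<2 * k}" "pr v \<noteq> 0 \<Longrightarrow> pr (pt v) = pr v"
    "pr v \<noteq> 0 \<Longrightarrow> pr (rt v) \<noteq> 0" "pr v \<noteq> 0 \<Longrightarrow> rt (rt v) = rt v" "pr v \<noteq> 0 \<Longrightarrow> rt (pt v) = rt v"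
    using a(4)[THEN spec, of v] by blast+
  show "pr u \<noteq> 0 \<Longrightarrow> pr u = pr v \<Longrightarrow> v = u \<or> v = pt u"
    using a(5)[THEN spec, THEN spec, of u v] by blast
  show "j < h \<Longrightarrow> w \<in> N (q j) \<Longrightarrow> pr w \<noteq> 0" using a(6)[THEN spec, of j] by blast
  show "pr u \<noteq> 0 \<Longrightarrow> pr w \<noteq> 0 \<Longrightarrow> w \<in> N u \<Longrightarrow> rt w = rt u"
    using a(7)[THEN spec, THEN spec, of u w] by blast
  show "h \<le> j \<Longrightarrow> j < 2 * k \<Longrightarrow> rt (q j) = rt (q h)" using a(8)[THEN spec, of j] by blast
  show "pr r \<noteq> 0 \<Longrightarrow> rt r = r \<Longrightarrow> pr (lu r) \<noteq> 0" "pr r \<noteq> 0 \<Longrightarrow> rt r = r \<Longrightarrow> rt (lu r) = r"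
    "pr r \<noteq> 0 \<Longrightarrow> rt r = r \<Longrightarrow> pr (lu r) \<le> h div 2 + 1" "pr r \<noteq> 0 \<Longrightarrow> rt r = r \<Longrightarrow> fu r = lu r"
    "pr r \<noteq> 0 \<Longrightarrow> rt r = r \<Longrightarrow> (\<forall>z. pr z \<noteq> 0 \<and> rt z = r \<longrightarrow> pr z = pr r) \<or>
         fx r \<in> N (lu r) \<and> rt (fx r) = r \<and> pr (lu r) < pr (fx r)"
    using a(9)[THEN spec, of r] by (elim impE, simp_all only: simp_thms)+
  show "pr z \<noteq> 0 \<Longrightarrow> pr z = pr (rt z) \<or>
        (\<exists>c. pr c \<noteq> 0 \<and> rt c = rt z \<and> pr c < pr z \<and> pr c \<le> pr (lu (rt z)) \<and> (c \<in> N z \<or> c \<in> N (pt z)))"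
    using a(10)[THEN spec, of z] by (rule mp)
qed

text \<open>The discoverer \<open>c\<close> is the head of the queue, or \<open>w\<close> itself
  when a new component is started. An expanded vertex has only discovered neighbors, so all
  discovered neighbors of the new edge are still unexpanded; as the unexpanded part of the queue has
  a single root, no edge joins vertices with different roots. The number of the head never
  decreases, so replacing \<open>lu r\<close> by \<open>c\<close> does not lower
  \<open>pr (lu r)\<close>, and earlier discoverers stay below it.\<close>

lemma pair_push:
  assumes I: "pair_inv S pr rt lu fu fx q k h"
    and S: "S \<subseteq> {v. v < n \<and> mt v}" "\<And>v. v \<in> S \<Longrightarrow> pt v \<in> S"
    and w: "w \<in> S" "pr w = 0"
    and case1: "h < 2 * k \<and> c = q h \<and> r = rt c \<and> c \<in> N w \<or> h = 2 * k \<and> c = w \<and> r = w"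
  shows "pair_inv S (pr(w := Suc k, pt w := Suc k)) (rt(w := r, pt w := r))
    (lu(r := c)) (fu(r := c)) (fx(r := w)) (q(2 * k := w, Suc (2 * k) := pt w)) (Suc k) h"
proof -
  note D = pair_invD[OF I]
  define pr1 where "pr1 = pr(w := Suc k, pt w := Suc k)"
  define rt1 where "rt1 = rt(w := r, pt w := r)"
  define lu1 where "lu1 = lu(r := c)"
  define fu1 where "fu1 = fu(r := c)"
  define fx1 where "fx1 = fx(r := w)"
  define q1 where "q1 = q(2 * k := w, Suc (2 * k) := pt w)"
  have wn: "w < n" "mt w" using S w by auto
  note pw = pt[OF wn]
  have pw0: "pr (pt w) = 0" using D(6)[of "pt w"] pw w by auto
  have prk: "pr v \<le> k" if v: "pr v \<noteq> 0" for v
  proof -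
    obtain j where "j < 2 * k" "v = q j" using D(5)[OF v] by auto
    then show ?thesis using D(4)[of j] by auto
  qed
  have old: "v \<noteq> w" "v \<noteq> pt w" "pr1 v = pr v" "rt1 v = rt v" if "pr v \<noteq> 0" for v
    using that w pw0 by (auto simp: pr1_def rt1_def)
  have new: "pr1 w = Suc k" "pr1 (pt w) = Suc k" "rt1 w = r" "rt1 (pt w) = r" by (auto simp: pr1_def rt1_def)
  have lr: "lu1 r = c" "fu1 r = c" "fx1 r = w" "x \<noteq> r \<Longrightarrow> lu1 x = lu x"
    "x \<noteq> r \<Longrightarrow> fu1 x = fu x" "x \<noteq> r \<Longrightarrow> fx1 x = fx x" for x by (auto simp: lu1_def fu1_def fx1_def)
  have qnew: "q1 (2 * k) = w" "q1 (Suc (2 * k)) = pt w" by (auto simp: q1_def)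
  have pr': "pr1 v \<noteq> 0 \<longleftrightarrow> v = w \<or> v = pt w \<or> pr v \<noteq> 0" for v by (auto simp: pr1_def)
  have nw: "x = w \<or> x = pt w \<or> pr x \<noteq> 0 \<and> x \<noteq> w \<and> x \<noteq> pt w" if "pr1 x \<noteq> 0" for x
    using that pr' old by blast
  have qold: "q1 j = q j" if "j < 2 * k" for j using that by (simp add: q1_def)
  have notexp: "x \<notin> q ` {..<h}" if "x \<in> N w \<or> x \<in> N (pt w)" for x
  proof
    assume "x \<in> q ` {..<h}"
    then obtain j where j: "j < h" "x = q j" by auto
    have "w \<in> N x \<or> pt w \<in> N x" using that N_sym wn pw by blast
    then show False using D(11)[OF j(1)] j(2) w(2) pw0 by blast
  qed
  have cr: "pr1 c \<noteq> 0" "rt1 c = r" "pr1 c = h div 2 + 1" "pr1 r \<noteq> 0" "rt1 r = r"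
    and rold: "h < 2 * k \<Longrightarrow> pr r \<noteq> 0 \<and> rt r = r \<and> pr c \<noteq> 0"
  proof -
    have u: "pr c = h div 2 + 1 \<and> pr r \<noteq> 0 \<and> rt r = r \<and> rt c = r" if "h < 2 * k"
      using case1 that D(4)[of h] D(7,8)[of c] by auto
    have v: "c = w \<and> r = w \<and> h div 2 = k" if "\<not> h < 2 * k" using case1 that by auto
    have "pr1 c \<noteq> 0 \<and> rt1 c = r \<and> pr1 c = h div 2 + 1 \<and> pr1 r \<noteq> 0 \<and> rt1 r = r"
    proof (cases "h < 2 * k")
      case True
      have "pr c \<noteq> 0" "pr r \<noteq> 0" using u[OF True] by simp_all
      then show ?thesis using u[OF True] old(3,4)[of c] old(3,4)[of r] by simp
    next
      case False
      then show ?thesis using v new by simp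
    qed
    then show "pr1 c \<noteq> 0" "rt1 c = r" "pr1 c = h div 2 + 1" "pr1 r \<noteq> 0" "rt1 r = r" by blast+
    show "pr r \<noteq> 0 \<and> rt r = r \<and> pr c \<noteq> 0" if "h < 2 * k" using u[OF that] by simp
  qed
  have nbr: "rt x = r" if x: "pr x \<noteq> 0" "x \<in> N w \<or> x \<in> N (pt w)" for x
  proof -
    obtain j where j: "j < 2 * k" "x = q j" using D(5)[OF x(1)] by auto
    then have "h \<le> j" using notexp[OF x(2)] by (metis imageI lessThan_iff not_le_imp_less)
    then show ?thesis using D(13)[of j] j case1 by auto
  qed
  have 1: "inj_on q1 {..<2 * Suc k}"
  proof -
    have e: "{..<2 * Suc k} = insert (Suc (2 * k)) (insert (2 * k) {..<2 * k})" by auto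
    have im: "q1 ` {..<2 * k} = q ` {..<2 * k}" using qold by (intro image_cong) auto
    have "inj_on q1 {..<2 * k}" using D(2) qold by (simp add: inj_on_def)
    moreover have wq: "w \<notin> q ` {..<2 * k}" "pt w \<notin> q ` {..<2 * k}" using D(4) w(2) pw0 by auto
    ultimately have "inj_on q1 (insert (2 * k) {..<2 * k})" using qnew im by (simp add: inj_on_insert)
    moreover have "pt w \<notin> q1 ` insert (2 * k) {..<2 * k}" using qnew im wq pw(2) by auto
    ultimately show ?thesis unfolding e inj_on_insert using qnew by auto
  qed
  have 2: "q1 j \<in> S \<and> pr1 (q1 j) = j div 2 + 1" if "j < 2 * Suc k" for j
  proof -
    consider "j < 2 * k" | "j = 2 * k" | "j = Suc (2 * k)" using \<open>j < 2 * Suc k\<close> by atomize_elim auto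
    then show ?thesis
    proof cases
      case 1
      then show ?thesis using D(3,4)[of j] old(3)[of "q j"] by (simp add: qold)
    qed (use w S new qnew in auto)
  qed
  have 3: "v \<in> q1 ` {..<2 * Suc k} \<and> pr1 (pt v) = pr1 v \<and> pr1 (rt1 v) \<noteq> 0 \<and> rt1 (rt1 v) = rt1 v \<and> rt1 (pt v) = rt1 v"
    if v: "pr1 v \<noteq> 0" for v
  proof -
    consider "v = w" | "v = pt w" | "pr v \<noteq> 0" "v \<noteq> w" "v \<noteq> pt w" using nw[OF v] by auto
    then show ?thesis
    proof cases
      case 1
      then show ?thesis using cr new qnew by (auto intro!: image_eqI[of _ _ "2 * k"])
    next
      case 2
      then show ?thesis using cr new pw qnew by (auto intro!: image_eqI[of _ _ "Suc (2 * k)"])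
    next
      case 3
      obtain j where "j < 2 * k" "v = q j" using D(5)[OF 3(1)] by auto
      then have "v \<in> q1 ` {..<2 * Suc k}" using qold[of j] by (intro image_eqI[of _ _ j]) auto
      moreover have "pr (pt v) \<noteq> 0" using D(6)[of v] 3 by simp
      ultimately show ?thesis using D(6-9)[of v] 3 old(3,4)[of "pt v"] old(3,4)[of v] old(3,4)[of "rt v"] by metis
    qed
  qed
  have 4: "v = u \<or> v = pt u" if "pr1 u \<noteq> 0" "pr1 u = pr1 v" for u v
  proof -
    have "pr u \<noteq> 0 \<and> pr v \<noteq> 0 \<and> pr u = pr v \<or> (u = w \<or> u = pt w) \<and> (v = w \<or> v = pt w)"
      using that nw[of u] nw[of v] prk[of u] prk[of v] old(3)[of u] old(3)[of v] new by (metis Suc_n_not_le_n)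
    then show ?thesis using D(10)[of u v] pw(5) by auto
  qed
  have 5: "pr1 x \<noteq> 0" if "j < h" "x \<in> N (q1 j)" for j x
    using D(11)[of j x] that D(1) qold[of j] pr' by auto
  have 6: "rt1 x = rt1 u" if ux: "pr1 u \<noteq> 0" "pr1 x \<noteq> 0" "x \<in> N u" for u x
  proof -
    consider "u = w \<or> u = pt w" "x = w \<or> x = pt w" | "u = w \<or> u = pt w" "pr x \<noteq> 0"
      | "pr u \<noteq> 0" "x = w \<or> x = pt w" | "pr u \<noteq> 0" "pr x \<noteq> 0"
      using nw[OF ux(1)] nw[OF ux(2)] by blast
    then show ?thesis
    proof cases
      case 1 then show ?thesis using new by auto
    next
      case 2
      then show ?thesis using nbr[of x] that(3) old(4)[of x] new by auto
    next
      case 3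
      then obtain j where "j < 2 * k" "u = q j" using D(5)[of u] by auto
      then have "u < n" using D(3)[of j] S(1) by auto
      then have "u \<in> N x" using N_sym ux(3) by blast
      then show ?thesis using nbr[of u] 3 old(4)[of u] new by auto
    next
      case 4 then show ?thesis using D(12)[of u x] ux(3) old(4)[of u] old(4)[of x] by simp
    qed
  qed
  have 7: "rt1 (q1 j) = rt1 (q1 h)" if "h \<le> j" "j < 2 * Suc k" for j
  proof -
    have "rt1 (q1 j) = r" if "h \<le> j" "j < 2 * Suc k" for j
    proof -
      consider "j < 2 * k" | "j = 2 * k" | "j = Suc (2 * k)" using \<open>j < 2 * Suc k\<close> by atomize_elim auto
      then show ?thesis
      proof cases
        case 1
        then have "rt1 (q1 j) = rt (q j)" using D(4)[of j] old(4)[of "q j"] by (simp add: qold)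
        then show ?thesis using D(13)[of j] 1 \<open>h \<le> j\<close> case1 by auto
      qed (use new qnew in auto)
    qed
    from this[of j] this[of h] that D(1) show ?thesis by simp
  qed
  have 8: "pr1 (lu1 x) \<noteq> 0 \<and> rt1 (lu1 x) = x \<and> pr1 (lu1 x) \<le> h div 2 + 1 \<and> fu1 x = lu1 x \<and>
        ((\<forall>z. pr1 z \<noteq> 0 \<and> rt1 z = x \<longrightarrow> pr1 z = pr1 x) \<or>
         fx1 x \<in> N (lu1 x) \<and> rt1 (fx1 x) = x \<and> pr1 (lu1 x) < pr1 (fx1 x))"
    if x: "pr1 x \<noteq> 0" "rt1 x = x" for x
  proof (cases "x = r")
    case True
    have l: "lu1 x = c" "fu1 x = c" "fx1 x = w" using True lr by auto
    have "(\<forall>z. pr1 z \<noteq> 0 \<and> rt1 z = r \<longrightarrow> pr1 z = pr1 r) \<or> w \<in> N c \<and> rt1 w = r \<and> pr1 c < pr1 w"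
    proof (cases "h < 2 * k")
      case True
      then have c: "c = q h" "c \<in> N w" "pr c \<noteq> 0" using case1 D(4)[of h] by auto
      then show ?thesis using N_sym[OF wn(1) c(2)] prk[of c] old(3)[of c] new by auto
    next
      case False
      have "pr1 z = pr1 r" if z: "pr1 z \<noteq> 0" "rt1 z = r" for z
      proof (rule ccontr)
        assume ne: "pr1 z \<noteq> pr1 r"
        have "r = w" using False case1 by auto
        then have "pr z \<noteq> 0" using nw[OF z(1)] ne new by auto
        then have "pr (rt z) \<noteq> 0" "rt z = w" using D(7)[of z] old(4)[of z] z(2) \<open>r = w\<close> by auto
        then show False using w(2) by simp
      qed
      then show ?thesis by blast
    qed
    then show ?thesis unfolding True lr(1-3) using cr by (simp only: simp_thms order_refl)
  next
    case False
    then have l: "lu1 x = lu x" "fu1 x = fu x" "fx1 x = fx x" using lr by auto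
    have px: "pr x \<noteq> 0" "rt x = x" using nw[OF x(1)] x(2) False new old(4)[of x] by auto
    have lx: "pr (lu x) \<noteq> 0" "rt (lu x) = x" "pr (lu x) \<le> h div 2 + 1" "fu x = lu x" using D(14-17)[of x] px by auto
    have "(\<forall>z. pr1 z \<noteq> 0 \<and> rt1 z = x \<longrightarrow> pr1 z = pr1 x) \<or> fx x \<in> N (lu x) \<and> rt1 (fx x) = x \<and> pr1 (lu x) < pr1 (fx x)"
    proof -
      from D(18)[of x] px consider "\<forall>z. pr z \<noteq> 0 \<and> rt z = x \<longrightarrow> pr z = pr x"
        | "fx x \<in> N (lu x)" "rt (fx x) = x" "pr (lu x) < pr (fx x)" by auto
      then show ?thesis
      proof cases
        case 1
        have "pr1 z = pr1 x" if z: "pr1 z \<noteq> 0" "rt1 z = x" for z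
        proof -
          have "pr z \<noteq> 0" using nw[OF z(1)] z(2) False new by auto
          then show ?thesis using 1 z old(3,4)[of z] old(3)[of x] px by metis
        qed
        then show ?thesis by blast
      next
        case 2
        then have "pr (fx x) \<noteq> 0" by auto
        then show ?thesis using 2 old(3,4)[of "fx x"] old(3)[of "lu x"] lx(1) by metis
      qed
    qed
    then show ?thesis unfolding l using lx old(3,4)[of "lu x"] by metis
  qed
  have 9: "pr1 z = pr1 (rt1 z) \<or>
        (\<exists>d. pr1 d \<noteq> 0 \<and> rt1 d = rt1 z \<and> pr1 d < pr1 z \<and> pr1 d \<le> pr1 (lu1 (rt1 z)) \<and> (d \<in> N z \<or> d \<in> N (pt z)))"
    if z: "pr1 z \<noteq> 0" for z
  proof (cases "z = w \<or> z = pt w")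
    case True
    then have zr: "rt1 z = r" "pr1 z = Suc k" "lu1 (rt1 z) = c" using new lr by auto
    show ?thesis
    proof (cases "h < 2 * k")
      case h: True
      then have c: "c \<in> N w" "pr c \<noteq> 0" using case1 rold by auto
      have "pr1 c < pr1 z" using prk[OF c(2)] old(3)[OF c(2)] zr by simp
      moreover have "c \<in> N z \<or> c \<in> N (pt z)" using True c pw by auto
      ultimately show ?thesis using cr zr by (intro disjI2 exI[of _ c]) (simp only: order_refl simp_thms)
    next
      case False
      then have "r = w" using case1 by auto
      then show ?thesis using zr new by simp
    qed
  next
    case False
    then have pz: "pr z \<noteq> 0" using nw[OF z] by auto
    have rz: "rt1 z = rt z" "pr1 z = pr z" "pr1 (rt z) = pr (rt z)" using old(3,4)[of z] old(3)[of "rt z"] D(7) pz by auto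
    have lu: "pr (lu (rt z)) \<le> pr1 (lu1 (rt z))"
    proof (cases "rt z = r")
      case True
      then have "pr (lu (rt z)) \<le> h div 2 + 1" using D(16)[of "rt z"] D(7,8)[of z] pz by auto
      then show ?thesis using True cr(3) lr by simp
    next
      case False
      then show ?thesis using lr(4) D(14)[of "rt z"] D(7,8)[of z] pz old(3)[of "lu (rt z)"] by auto
    qed
    from D(19)[OF pz] consider "pr z = pr (rt z)"
      | d where "pr d \<noteq> 0" "rt d = rt z" "pr d < pr z" "pr d \<le> pr (lu (rt z))" "d \<in> N z \<or> d \<in> N (pt z)" by blast
    then show ?thesis
    proof cases
      case 1 then show ?thesis using rz by simp
    next
      case 2
      then show ?thesis unfolding rz(1,2) using old(3,4)[of d] lu by (intro disjI2 exI[of _ d]) (metis order_trans)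
    qed
  qed
  have 0: "h \<le> 2 * Suc k" using D(1) by simp
  have "pair_inv S pr1 rt1 lu1 fu1 fx1 q1 (Suc k) h" unfolding pair_inv_def
    by (intro conjI)
      (rule 0, rule 1, (intro allI impI, rule 2, assumption), (intro allI impI, rule 3, assumption),
       (intro allI impI, elim conjE, rule 4, assumption, assumption),
       (intro allI impI ballI, rule 5, assumption, assumption),
       (intro allI impI, elim conjE, rule 6, assumption, assumption, assumption),
       (intro allI impI, elim conjE, rule 7, assumption, assumption),
       (intro allI impI, elim conjE, rule 8, assumption, assumption),
       (intro allI impI, rule 9, assumption))
  then show ?thesis by (simp only: pr1_def rt1_def lu1_def fu1_def fx1_def q1_def)
qed

lemma pair_advance:
  assumes I: "pair_inv S pr rt lu fu fx q k h" and h: "h < 2 * k" and ex: "\<And>w. w \<in> N (q h) \<Longrightarrow> pr w \<noteq> 0"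
  shows "pair_inv S pr rt lu fu fx q k (Suc h)"
proof -
  note D = pair_invD[OF I]
  have 5: "pr w \<noteq> 0" if "j < Suc h" "w \<in> N (q j)" for j w
    using that D(11)[of j w] ex[of w] by (cases "j = h") auto
  have 7: "rt (q j) = rt (q (Suc h))" if "Suc h \<le> j" "j < 2 * k" for j
    using D(13)[of j] D(13)[of "Suc h"] that by simp
  have 8: "pr (lu r) \<noteq> 0 \<and> rt (lu r) = r \<and> pr (lu r) \<le> Suc h div 2 + 1 \<and> fu r = lu r \<and>
        ((\<forall>z. pr z \<noteq> 0 \<and> rt z = r \<longrightarrow> pr z = pr r) \<or>
         fx r \<in> N (lu r) \<and> rt (fx r) = r \<and> pr (lu r) < pr (fx r))" if r: "pr r \<noteq> 0" "rt r = r" for r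
  proof -
    have "pr (lu r) \<le> Suc h div 2 + 1" using D(16)[OF r] div_le_mono[of h "Suc h" 2] by simp
    then show ?thesis using D(14,15,17,18)[OF r] by (simp only: simp_thms)
  qed
  show ?thesis unfolding pair_inv_def
    by (intro conjI)
      (use h in simp, rule D(2), (use D(3,4) in blast), (intro allI impI conjI; rule D(5-9), assumption),
       (intro allI impI, elim conjE, rule D(10), assumption, assumption),
       (intro allI impI ballI, rule 5, assumption, assumption),
       (intro allI impI, elim conjE, rule D(12), assumption, assumption, assumption),
       (intro allI impI, elim conjE, rule 7, assumption, assumption),
       (intro allI impI, elim conjE, rule 8, assumption, assumption),
       (intro allI impI, rule D(19), assumption))
qed

text \<open>
  Edges numbered above \<open>pr (lu r)\<close> have discovered nothing, so the component stays connected when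
  any of them are removed.
\<close>

definition comp_triple :: "(nat \<Rightarrow> nat) \<Rightarrow> (nat \<Rightarrow> nat) \<Rightarrow> (nat \<Rightarrow> nat) \<Rightarrow> nat \<Rightarrow> nat \<Rightarrow> nat \<Rightarrow> bool" where
  "comp_triple pr rt lu r u x \<longleftrightarrow> pr u \<noteq> 0 \<and> rt u = r \<and> pr x \<noteq> 0 \<and> rt x = r \<and> x \<in> N u \<and> pr u \<noteq> pr x \<and>
     pr (lu r) < pr x \<and> (u = lu r \<or> pr (lu r) < pr u)"

text \<open>For \<open>i = n\<close> this says that late matching edges of the component are not
  joined to each other, so that \<open>u\<close> and \<open>x\<close> cannot be chosen on two of
  them.\<close>

definition late_independent :: "(nat \<Rightarrow> nat) \<Rightarrow> (nat \<Rightarrow> nat) \<Rightarrow> (nat \<Rightarrow> nat) \<Rightarrow> nat \<Rightarrow> nat \<Rightarrow> bool" where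
  "late_independent pr rt lu r i \<longleftrightarrow>
     (\<forall>z<i. pr z \<noteq> 0 \<and> rt z = r \<and> pr (lu r) < pr z \<longrightarrow> (\<forall>w\<in>N z. w \<noteq> pt z \<longrightarrow> pr w \<le> pr (lu r)))"

end

section \<open>Connectedness of a component after the removal of three vertices\<close>

locale pair_done = matching_lists +
  fixes S :: "nat set" and pr rt lu fu0 fx0 q :: "nat \<Rightarrow> nat" and k :: nat
  assumes I: "pair_inv S pr rt lu fu0 fx0 q k (2 * k)"
    and S: "v \<in> S \<Longrightarrow> v < n \<and> mt v \<and> length (adj ! v) = 4 \<and> N v \<subseteq> S"
    and full: "v \<in> S \<Longrightarrow> pr v \<noteq> 0"
begin

lemma pr_S: "pr v \<noteq> 0 \<Longrightarrow> v \<in> S"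
  using pair_invD(3,5)[OF I] by auto

lemma comp_closed:
  assumes "pr z \<noteq> 0"
  shows "w \<in> N z \<Longrightarrow> pr w \<noteq> 0 \<and> rt w = rt z" "pr (pt z) = pr z" "rt (pt z) = rt z" "pt z \<in> N z" "pt z \<noteq> z"
    "pt (pt z) = z" "z < n" "mt z"
proof -
  have z: "z \<in> S" using pr_S assms .
  then show zn: "z < n" "mt z" using S by auto
  show "w \<in> N z \<Longrightarrow> pr w \<noteq> 0 \<and> rt w = rt z"
    using S[OF z] full[of w] pair_invD(12)[OF I assms, of w] by blast
  show "pr (pt z) = pr z" "rt (pt z) = rt z" using pair_invD(6,9)[OF I assms] by auto
  show "pt z \<in> N z" "pt z \<noteq> z" "pt (pt z) = z" using pt[OF zn] by auto
qed

text \<open>Mainly used with the endpoints of a second matching edge as \<open>s\<close> and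
  \<open>t\<close>: a vertex of degree four cannot have all its neighbors on its own edge and one
  other.\<close>

lemma third_nb:
  assumes "pr z \<noteq> 0"
  obtains w where "w \<in> N z" "w \<noteq> pt z" "w \<noteq> s" "w \<noteq> t"
proof -
  have "z \<in> S" using pr_S assms .
  then have "card (N z) = 4" using S[of z] dist[of z] by (simp add: distinct_card)
  moreover have "card {pt z, s, t} \<le> 3" by (simp add: card_insert_if)
  ultimately have "\<not> N z \<subseteq> {pt z, s, t}" using card_mono[of "{pt z, s, t}" "N z"] by auto
  then show ?thesis using that by blast
qed

text \<open>Numbers decrease from an edge to the discoverer of one of its endpoints, and this
  descent can end only at the edge of the root.\<close>

lemma root_min:
  assumes "pr r \<noteq> 0" "rt r = r" "pr z \<noteq> 0" "rt z = r"
  shows "pr r \<le> pr z"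
  using assms(3,4)
proof (induction "pr z" arbitrary: z rule: less_induct)
  case less
  from pair_invD(19)[OF I less.prems(1)] consider "pr z = pr (rt z)"
    | c where "pr c \<noteq> 0" "rt c = rt z" "pr c < pr z" by blast
  then show ?case
  proof cases
    case 1 then show ?thesis using less.prems by simp
  next
    case 2 then show ?thesis using less.hyps[of c] less.prems by simp
  qed
qed

text \<open>The fallback choice. By its degree the root has a neighbor off its own edge, so a
  discovery was recorded, and the vertex discovered last lies on an edge numbered above its
  discoverer.\<close>

lemma default_triple:
  assumes "pr r \<noteq> 0" "rt r = r"
  shows "comp_triple pr rt lu r (lu r) (fx0 r)"
proof -
  obtain w where w: "w \<in> N r" "w \<noteq> pt r" using third_nb[OF assms(1)] by metis
  have "w \<noteq> r" using nb[of r w] w comp_closed(7)[OF assms(1)] by auto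
  then have "pr w \<noteq> pr r" using pair_invD(10)[OF I assms(1), of w] w by auto
  then have "fx0 r \<in> N (lu r) \<and> rt (fx0 r) = r \<and> pr (lu r) < pr (fx0 r)"
    using pair_invD(18)[OF I assms] comp_closed(1)[OF assms(1) w(1)] assms by metis
  then show ?thesis using pair_invD(14,15)[OF I assms] by (auto simp: comp_triple_def)
qed

text \<open>Connectedness is expressed by predicates that agree along edges, and it will be applied
  to being visited. Discoverers have numbers up to \<open>pr (lu r)\<close>, so the edges up to this
  bound are joined by a tree without late edges, and each late edge is attached to it. If
  \<open>u\<close> is \<open>lu r\<close> itself, the tree is cut one number lower, and
  \<open>late_independent\<close> provides links from the late vertices to that smaller tree. The
  vertex \<open>pt u\<close>, deprived of its partner, is attached at the end by a neighbor outside
  the removed vertices.\<close>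

lemma comp_connected:
  assumes r: "pr r \<noteq> 0" "rt r = r" and T: "comp_triple pr rt lu r u x"
    and B: "pr (lu r) < pr u \<or> late_independent pr rt lu r n"
    and P: "\<And>a b. \<lbrakk>pr a \<noteq> 0; rt a = r; b \<in> N a; a \<notin> {x, pt x, u}; b \<notin> {x, pt x, u}\<rbrakk> \<Longrightarrow> P a = P b"
    and z: "pr z \<noteq> 0" "rt z = r" "z \<notin> {x, pt x, u}"
  shows "P z = P (pt u)" and "pt u \<notin> {x, pt x, u}"
proof -
  note T = T[unfolded comp_triple_def]
  define \<tau> where "\<tau> = pr (lu r)"
  have u: "pr u \<noteq> 0" "rt u = r" and x: "pr x \<noteq> 0" "rt x = r" "\<tau> < pr x" and xu: "x \<in> N u" "pr u \<noteq> pr x"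
    and ul: "u = lu r \<or> \<tau> < pr u" using T by (auto simp: \<tau>_def)
  note cu = comp_closed[OF u(1)] and cx = comp_closed[OF x(1)]
  show vT: "pt u \<notin> {x, pt x, u}" using cu cx xu(2) by (metis insert_iff singletonD)
  have same: "a = b \<or> a = pt b" if "pr b \<noteq> 0" "pr a = pr b" for a b
    using pair_invD(10)[OF I that(1), of a] that(2) by simp
  \<comment> \<open>The edges numbered up to \<open>\<beta>\<close> are untouched by the removal.
    The bound is \<open>\<tau>\<close> if \<open>u\<close> is late and \<open>\<tau> - 1\<close> if
    \<open>u\<close> lies on the edge numbered \<open>\<tau>\<close>.\<close>
  have core: "P z = P r" if "pr r \<le> \<beta>" "\<beta> < pr x" "\<beta> < pr u" "pr z \<noteq> 0" "rt z = r" "pr z \<le> \<beta>" "\<beta> \<le> \<tau>" for \<beta> z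
    using that(4,5,6)
  proof (induction "pr z" arbitrary: z rule: less_induct)
    case less
    have out: "a \<notin> {x, pt x, u}" if "pr a \<le> \<beta>" for a
      using that \<open>\<beta> < pr x\<close> \<open>\<beta> < pr u\<close> cx(2) by auto
    note cz = comp_closed[OF less.prems(1)]
    have pz: "P z = P (pt z)" using P[of z "pt z"] less.prems cz out[of z] out[of "pt z"] by simp
    from pair_invD(19)[OF I less.prems(1)] consider "pr z = pr (rt z)"
      | c where "pr c \<noteq> 0" "rt c = rt z" "pr c < pr z" "c \<in> N z \<or> c \<in> N (pt z)" by blast
    then show ?case
    proof cases
      case 1
      then have "z = r \<or> z = pt r" using same[of r z] r less.prems by simp
      then show ?thesis using pz comp_closed(6)[OF r(1)] by auto
    next
      case 2
      have c: "P c = P r" using less.hyps[of c] 2 less.prems by simp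
      have "P z = P c \<or> P (pt z) = P c"
        using 2 P[of z c] P[of "pt z" c] less.prems cz out[of z] out[of "pt z"] out[of c] by auto
      then show ?thesis using c pz by auto
    qed
  qed
  \<comment> \<open>The argument needs \<open>z\<close> off the edge of \<open>u\<close>, so
    \<open>pt u\<close> is treated separately afterwards.\<close>
  have all: "P z = P r" if z: "pr z \<noteq> 0" "rt z = r" "z \<notin> {x, pt x, u}" "z \<noteq> pt u" for z
  proof (cases "\<tau> < pr u")
    case True
    have rl: "pr r \<le> \<tau>" using root_min[OF r, of "lu r"] pair_invD(14,15)[OF I r] by (simp add: \<tau>_def)
    note core' = core[of \<tau>, OF rl x(3) True _ _ _ order_refl]
    show ?thesis
    proof (cases "pr z \<le> \<tau>")
      case True then show ?thesis using core' z by blast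
    next
      case False
      note cz = comp_closed[OF z(1)]
      have zr: "pr z \<noteq> pr (rt z)" using False rl z(2) by simp
      then obtain c where c: "pr c \<noteq> 0" "rt c = r" "pr c \<le> \<tau>" "c \<in> N z \<or> c \<in> N (pt z)"
        using pair_invD(19)[OF I z(1)] z(2) by (auto simp: \<tau>_def)
      have pzT: "pt z \<notin> {x, pt x, u}" using z(3,4) cz(6) cx(6) by auto
      have cT: "c \<notin> {x, pt x, u}" using c(3) x(3) True cx(2) by auto
      have "P z = P (pt z)" using P[of z "pt z"] z pzT cz by blast
      moreover have "P z = P c \<or> P (pt z) = P c"
        using c(4) P[of z c] P[of "pt z" c] z pzT cT cz by auto
      ultimately show ?thesis using core'[of c] c by auto
    qed
  next
    case False
    then have ulr: "u = lu r" "pr u = \<tau>" using ul by (auto simp: \<tau>_def)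
    have ind: "pr w \<le> \<tau>" if "pr a \<noteq> 0" "rt a = r" "\<tau> < pr a" "w \<in> N a" "w \<noteq> pt a" for a w
      using B that comp_closed(7)[OF that(1)] ulr by (auto simp: late_independent_def \<tau>_def)
    \<comment> \<open>Of the neighbors other than the partner, at most two lie on the edge of
      \<open>u\<close>. Another one is not late by independence, and its number is not
      \<open>\<tau>\<close>, which belongs to the edge of \<open>u\<close>.\<close>
    have low: "\<exists>w\<in>N a. pr w \<noteq> 0 \<and> rt w = r \<and> pr w < \<tau>" if a: "pr a \<noteq> 0" "rt a = r" "\<tau> < pr a" for a
    proof -
      obtain w where w: "w \<in> N a" "w \<noteq> pt a" "w \<noteq> u" "w \<noteq> pt u" using third_nb[OF a(1)] by metis
      have "pr w \<noteq> 0" "rt w = r" using comp_closed(1)[OF a(1) w(1)] a(2) by auto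
      moreover have "pr w \<noteq> pr u" using same[of u w] w u by auto
      ultimately show ?thesis using ind[OF a w(1,2)] w(1) ulr by auto
    qed
    obtain w0 where "pr w0 \<noteq> 0" "rt w0 = r" "pr w0 < \<tau>" using low[OF x] by auto
    then have rl: "pr r \<le> \<tau> - 1" "0 < \<tau>" using root_min[OF r, of w0] by auto
    have lowP: "P a = P r" if "pr a \<noteq> 0" "rt a = r" "pr a < \<tau>" for a
      using core[of "\<tau> - 1" a] rl x(3) ulr that by simp
    show ?thesis
    proof (cases "pr z < \<tau>")
      case True then show ?thesis using lowP z by blast
    next
      case False
      have "pr z \<noteq> pr u" using same[of u z] z u by auto
      then have "\<tau> < pr z" using False ulr by auto
      then obtain w where w: "w \<in> N z" "pr w \<noteq> 0" "rt w = r" "pr w < \<tau>" using low[of z] z by auto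
      have "w \<notin> {x, pt x, u}" using w(4) x(3) cx(2) ulr by auto
      then show ?thesis using P[of z w] z w lowP[of w] by auto
    qed
  qed
  have "P (pt u) = P r"
  proof -
    obtain w where w: "w \<in> N (pt u)" "w \<noteq> pt (pt u)" "w \<noteq> x" "w \<noteq> pt x"
      using third_nb[of "pt u"] cu(2) u(1) by metis
    have pu: "pr (pt u) \<noteq> 0" "rt (pt u) = r" using cu u by auto
    note cp = comp_closed[OF pu(1)]
    have w': "pr w \<noteq> 0" "rt w = r" "w \<notin> {x, pt x, u}" "w \<noteq> pt u"
      using cp(1)[OF w(1)] pu w cu(6) nb[OF cp(7) w(1)] by auto
    then show ?thesis using P[OF pu w(1) vT w'(3)] all[OF w'] by simp
  qed
  then show "P z = P (pt u)" using all[of z] z by auto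
qed

end

section \<open>The program for matching backbones\<close>

definition push :: "aexp \<Rightarrow> com" where
  "push e = Seq (Assign 12 e (Const 1)) (Seq (Assign 9 (var 26) e) (incr 26))"

definition visit :: com where
  "visit = Cond (Cell 12 (var 21)) Skip (push (var 21))"

definition search_body :: com where
  "search_body = Seq (set_var 20 (Cell 9 (var 28))) (Seq (for_adj 1 2 21 visit) (incr 28))"

definition search :: com where
  "search = Loop (Sub (var 26) (var 28)) search_body"

text \<open>Differences of consecutive offsets are degrees. By truncated subtraction the sum is
  nonzero exactly for unmatched vertices and vertices of degree below four.\<close>

definition roots_body :: com where
  "roots_body = Seq (Cond (Add
       (Sub (Const 1) (Sub (Cell 3 (Add (var 27) (Const 1))) (Cell 3 (var 27))))
       (Sub (Const 4) (Sub (Cell 1 (Add (var 27) (Const 1))) (Cell 1 (var 27)))))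
     (push (var 27)) Skip) (incr 27)"

definition roots :: com where
  "roots = Loop (Sub (Cell 0 (Const 0)) (var 27)) roots_body"

text \<open>The discoverer goes into both 15 and 16: array 16 may later be overwritten by a better
  choice of \<open>u\<close>, while 15 keeps the bound that decides which edges are late.\<close>

definition add_pair :: com where
  "add_pair = Seq (set_var 33 (Cell 4 (Cell 3 (var 21))))
     (Seq (Assign 18 (Add (var 32) (var 32)) (var 21))
     (Seq (Assign 18 (Add (Add (var 32) (var 32)) (Const 1)) (var 33))
     (Seq (incr 32)
     (Seq (Assign 13 (var 21) (var 32)) (Seq (Assign 13 (var 33) (var 32))
     (Seq (Assign 14 (var 21) (var 34)) (Seq (Assign 14 (var 33) (var 34))
     (Seq (Assign 15 (var 34) (var 20)) (Seq (Assign 16 (var 34) (var 20))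
     (Assign 17 (var 34) (var 21)))))))))))"

definition discover :: com where
  "discover = Cond (Cell 13 (var 21)) Skip add_pair"

definition expand :: com where
  "expand = Seq (set_var 20 (Cell 18 (var 31))) (Seq (set_var 34 (Cell 14 (var 20)))
     (Seq (for_adj 1 2 21 discover) (incr 31)))"

text \<open>For \<open>add_pair\<close>, variable 20 is the discoverer and 34 the root; a start
  vertex plays both parts for itself.\<close>

definition start :: com where
  "start = Seq (set_var 20 (var 27)) (Seq (set_var 21 (var 27)) (Seq (set_var 34 (var 27))
     (Seq (Cond (Add (Cell 12 (var 27)) (Cell 13 (var 27))) Skip add_pair) (incr 27))))"

text \<open>Expansions and the search for start vertices share one loop, so that its body is
  straight-line; at most \<open>n\<close> steps of either kind occur.\<close>

definition pair_body :: com where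
  "pair_body = Cond (Sub (Add (var 32) (var 32)) (var 31)) expand start"

definition pair_search :: com where
  "pair_search = Seq (set_var 27 (Const 0))
     (Loop (Add (Sub (Cell 0 (Const 0)) (var 27)) (Sub (Add (var 32) (var 32)) (var 31))) pair_body)"

lemma straight_bodies: "straight search_body" "straight roots_body" "straight pair_body"
  by (simp_all add: search_body_def visit_def push_def roots_body_def pair_body_def expand_def start_def discover_def add_pair_def)

lemma writes_bodies: "writes search_body = {9, 12, 20, 21, 26, 28}" "writes roots_body = {9, 12, 26, 27}"
  "writes pair_body = {13, 14, 15, 16, 17, 18, 20, 21, 27, 31, 32, 33, 34}"
  by (auto simp: search_body_def visit_def push_def roots_body_def pair_body_def expand_def start_def discover_def add_pair_def)

section \<open>Breadth-first search with blocked vertices\<close>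

context instance_lists begin

lemma inp_deg:
  assumes "inp t" "v < n"
  shows "t 1 (Suc v) - t 1 v = length (adj ! v)" "t 3 (Suc v) - t 3 v = length (hadj ! v)"
proof -
  show "t 1 (Suc v) - t 1 v = length (adj ! v)"
    unfolding inp_cells(4)[OF assms(1)] offsets_diff[OF assms(2)] by simp
  have "v < length hadj" using assms(2) len by simp
  then show "t 3 (Suc v) - t 3 v = length (hadj ! v)"
    unfolding inp_cells(6)[OF assms(1)] by (subst offsets_diff) simp_all
qed

text \<open>Vertices in \<open>Blk\<close> count as visited but never enter the queue. The neighbor
  at an earlier position is what the elimination needs: the order is eliminated backwards, so that
  neighbor is still present when the vertex is eliminated.\<close>

definition search_inv ::
    "nat set \<Rightarrow> nat set \<Rightarrow> (nat \<Rightarrow> nat) \<Rightarrow> (nat \<Rightarrow> nat) \<Rightarrow> nat \<Rightarrow> nat \<Rightarrow> bool" where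
  "search_inv Blk Root ord vis m h \<longleftrightarrow> h \<le> m \<and> inj_on ord {..<m} \<and>
     (\<forall>j<m. ord j < n \<and> ord j \<notin> Blk \<and> (ord j \<in> Root \<or> (\<exists>i<j. ord i \<in> N (ord j)))) \<and>
     (\<forall>v<n. vis v \<noteq> 0 \<longleftrightarrow> v \<in> ord ` {..<m} \<or> v \<in> Blk) \<and>
     (\<forall>j<h. \<forall>w\<in>N (ord j). vis w \<noteq> 0)"

lemma search_invD:
  assumes "search_inv Blk Root ord vis m h"
  shows "h \<le> m" "inj_on ord {..<m}" "j < m \<Longrightarrow> ord j < n" "j < m \<Longrightarrow> ord j \<notin> Blk"
    "j < m \<Longrightarrow> ord j \<in> Root \<or> (\<exists>i<j. ord i \<in> N (ord j))"
    "v < n \<Longrightarrow> vis v \<noteq> 0 \<longleftrightarrow> v \<in> ord ` {..<m} \<or> v \<in> Blk"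
    "j < h \<Longrightarrow> w \<in> N (ord j) \<Longrightarrow> vis w \<noteq> 0" "m \<le> n"
proof -
  have a: "h \<le> m" "inj_on ord {..<m}"
    "\<forall>j<m. ord j < n \<and> ord j \<notin> Blk \<and> (ord j \<in> Root \<or> (\<exists>i<j. ord i \<in> N (ord j)))"
    "\<forall>v<n. vis v \<noteq> 0 \<longleftrightarrow> v \<in> ord ` {..<m} \<or> v \<in> Blk" "\<forall>j<h. \<forall>w\<in>N (ord j). vis w \<noteq> 0"
    using assms unfolding search_inv_def by - (elim conjE, assumption)+
  show "h \<le> m" "inj_on ord {..<m}" using a(1,2) .
  show "j < m \<Longrightarrow> ord j < n" "j < m \<Longrightarrow> ord j \<notin> Blk"
    "j < m \<Longrightarrow> ord j \<in> Root \<or> (\<exists>i<j. ord i \<in> N (ord j))" using a(3)[THEN spec, of j] by blast+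
  show "v < n \<Longrightarrow> vis v \<noteq> 0 \<longleftrightarrow> v \<in> ord ` {..<m} \<or> v \<in> Blk" using a(4)[THEN spec, of v] by (rule mp)
  show "j < h \<Longrightarrow> w \<in> N (ord j) \<Longrightarrow> vis w \<noteq> 0" using a(5)[THEN spec, of j] by blast
  have "ord ` {..<m} \<subseteq> {..<n}" using a(3) by auto
  then show "m \<le> n" using card_mono[of "{..<n}" "ord ` {..<m}"] a(2) by (simp add: card_image)
qed

lemma search_push:
  assumes I: "search_inv Blk Root ord vis m h" and w: "w < n" "vis w = 0"
    and r: "w \<in> Root' \<or> (\<exists>i<m. ord i \<in> N w)" "Root \<subseteq> Root'"
  shows "search_inv Blk Root' (ord(m := w)) (vis(w := 1)) (Suc m) h"
proof -
  note D = search_invD[OF I]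
  have wn: "w \<notin> ord ` {..<m}" "w \<notin> Blk" using D(6)[OF w(1)] w(2) by auto
  have im: "(ord(m := w)) ` {..<Suc m} = insert w (ord ` {..<m})"
    unfolding lessThan_Suc image_insert by (auto intro: image_cong)
  have "inj_on (ord(m := w)) {..<m}" using D(2) by (auto simp: inj_on_def)
  moreover have "(ord(m := w)) ` {..<m} = ord ` {..<m}" by (intro image_cong) auto
  ultimately have 1: "inj_on (ord(m := w)) {..<Suc m}" unfolding lessThan_Suc inj_on_insert using wn by auto
  have 2: "(ord(m := w)) j < n \<and> (ord(m := w)) j \<notin> Blk \<and> ((ord(m := w)) j \<in> Root' \<or> (\<exists>i<j. (ord(m := w)) i \<in> N ((ord(m := w)) j)))"
    if "j < Suc m" for j
  proof (cases "j = m")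
    case True
    then show ?thesis using w wn r(1) by auto
  next
    case False
    then have "j < m" using that by simp
    have "ord j \<in> Root' \<or> (\<exists>i<j. (ord(m := w)) i \<in> N (ord j))"
    proof (cases "ord j \<in> Root")
      case True
      then show ?thesis using r(2) by auto
    next
      case False
      then obtain i where "i < j" "ord i \<in> N (ord j)" using D(5)[OF \<open>j < m\<close>] by auto
      then show ?thesis using \<open>j < m\<close> by (intro disjI2 exI[of _ i]) auto
    qed
    then show ?thesis using D(3,4)[OF \<open>j < m\<close>] \<open>j < m\<close> by simp
  qed
  have 3: "(vis(w := 1)) v \<noteq> 0 \<longleftrightarrow> v \<in> (ord(m := w)) ` {..<Suc m} \<or> v \<in> Blk" if "v < n" for v
    unfolding im using D(6)[OF that] by auto
  have 4: "(vis(w := 1)) x \<noteq> 0" if "j < h" "x \<in> N ((ord(m := w)) j)" for j x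
  proof -
    have "j \<noteq> m" using that D(1) by simp
    then show ?thesis using D(7)[of j x] that by simp
  qed
  show ?thesis unfolding search_inv_def
    by (intro conjI) (use D(1) in simp, rule 1, use 2 in blast, use 3 in blast, use 4 in blast)
qed

lemma search_block:
  assumes I: "search_inv Blk Root ord vis m h" and w: "w < n" "vis w = 0"
  shows "search_inv (insert w Blk) Root ord (vis(w := 1)) m h"
proof -
  note D = search_invD[OF I]
  have wn: "w \<notin> ord ` {..<m}" using D(6)[OF w(1)] w(2) by auto
  have 2: "ord j < n \<and> ord j \<notin> insert w Blk \<and> (ord j \<in> Root \<or> (\<exists>i<j. ord i \<in> N (ord j)))" if "j < m" for j
    using D(3,4,5)[OF that] wn that by auto
  have 3: "(vis(w := 1)) v \<noteq> 0 \<longleftrightarrow> v \<in> ord ` {..<m} \<or> v \<in> insert w Blk" if "v < n" for v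
    using D(6)[OF that] by auto
  have 4: "(vis(w := 1)) x \<noteq> 0" if "j < h" "x \<in> N (ord j)" for j x using D(7)[of j x] that by simp
  show ?thesis unfolding search_inv_def
    by (intro conjI) (rule D(1), rule D(2), use 2 in blast, use 3 in blast, use 4 in blast)
qed

definition search_st :: "nat set \<Rightarrow> nat set \<Rightarrow> store \<Rightarrow> bool" where
  "search_st Blk Root t \<longleftrightarrow> search_inv Blk Root (t 9) (t 12) (t 26 0) (t 28 0)"

lemma search_step:
  assumes "inp t" and I: "search_st Blk Root t" and h: "t 28 0 < t 26 0"
  shows "search_st Blk Root (ev search_body t)" "ev search_body t 28 0 = Suc (t 28 0)"
    "t 12 x \<noteq> 0 \<Longrightarrow> ev search_body t 12 x \<noteq> 0"
proof -
  define v where "v = t 9 (t 28 0)"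
  note D = search_invD[OF I[unfolded search_st_def]]
  have vn: "v < n" using D(3)[OF h] by (simp add: v_def)
  let ?s = "t(20 := (t 20)(0 := v))"
  define J where "J D u \<longleftrightarrow> search_st Blk Root u \<and> u 28 0 = t 28 0 \<and> u 28 0 < u 26 0 \<and> u 9 (u 28 0) = v \<and>
    (\<forall>x\<in>D. u 12 x \<noteq> 0) \<and> (\<forall>x. t 12 x \<noteq> 0 \<longrightarrow> u 12 x \<noteq> 0)" for D :: "nat set" and u :: store
  have J: "J (N v) (ev (for_adj 1 2 21 visit) ?s)"
  proof (rule for_adj_rule)
    show "?s 1 = array_of (offsets adj)" "?s 2 = array_of (concat adj)" using inp_cells[OF assms(1)] by simp_all
    show "length (adj ! v) \<le> 4" "distinct (adj ! v)" using deg dist vn by auto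
    show "J {} ?s" using I h by (simp add: J_def search_st_def v_def)
    fix D x u
    assume x: "x \<in> N v" and Ju: "J D u"
    have xn: "x < n" "v \<in> N x" using nb[OF vn x] by auto
    show "J (insert x D) (ev visit (u(21 := (u 21)(0 := x))))"
    proof (cases "u 12 x = 0")
      case False
      then have "ev visit (u(21 := (u 21)(0 := x))) = u(21 := (u 21)(0 := x))" by (simp add: visit_def)
      then show ?thesis using Ju False by (auto simp: J_def search_st_def)
    next
      case True
      define u' where "u' = ev visit (u(21 := (u 21)(0 := x)))"
      have u': "u' 9 = (u 9)(u 26 0 := x)" "u' 12 = (u 12)(x := 1)" "u' 26 0 = Suc (u 26 0)" "u' 28 0 = u 28 0"
        using True by (auto simp: u'_def visit_def push_def fun_eq_iff)
      have "\<exists>i<u 26 0. u 9 i \<in> N x" using Ju xn by (auto simp: J_def)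
      then have "search_st Blk Root u'" unfolding search_st_def u'
        using Ju True xn by (intro search_push[where Root = Root]) (auto simp: J_def search_st_def)
      moreover have "u' 9 (u' 28 0) = v" "u' 28 0 < u' 26 0" using Ju by (auto simp: u' J_def)
      moreover have "\<forall>y\<in>insert x D. u' 12 y \<noteq> 0" "\<forall>y. t 12 y \<noteq> 0 \<longrightarrow> u' 12 y \<noteq> 0" using Ju by (auto simp: u' J_def)
      ultimately show ?thesis using Ju unfolding u'_def[symmetric] by (simp add: J_def u'(4))
    qed
  qed (use vn in \<open>auto simp: visit_def push_def\<close>)
  define u where "u = ev (for_adj 1 2 21 visit) ?s"
  note J = J[folded u_def, unfolded J_def]
  define t' where "t' = ev search_body t"
  have e: "t' = u(28 := (u 28)(0 := Suc (u 28 0)))" by (simp add: t'_def search_body_def u_def v_def)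
  have t': "t' 28 0 = Suc (t 28 0)" "t' 9 = u 9" "t' 12 = u 12" "t' 26 = u 26"
    using J by (simp_all add: e)
  have "search_inv Blk Root (u 9) (u 12) (u 26 0) (u 28 0)" using J unfolding search_st_def by blast
  then have "search_inv Blk Root (u 9) (u 12) (u 26 0) (Suc (u 28 0))"
    using J unfolding search_inv_def by (auto simp: less_Suc_eq)
  then show "search_st Blk Root (ev search_body t)" using J by (simp add: search_st_def t'_def[symmetric] t')
  show "ev search_body t 28 0 = Suc (t 28 0)" using t'(1) by (simp add: t'_def)
  show "t 12 x \<noteq> 0 \<Longrightarrow> ev search_body t 12 x \<noteq> 0" using J t'(3) by (simp add: t'_def)
qed

abbreviation search_vars :: "nat set" where "search_vars \<equiv> {9, 12, 20, 21, 26, 28}"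

text \<open>Nothing requires an empty queue at the beginning. So the search can be resumed after
  further vertices have been blocked or pushed, and array 9 collects one order for all
  components.\<close>

lemma search:
  assumes "inp s" "search_st Blk Root s"
  shows "runs search s ((6 + cost search_body) * (n + 1))
    (\<lambda>t. same_except search_vars s t \<and> search_st Blk Root t \<and> t 28 0 = t 26 0 \<and> (\<forall>v. s 12 v \<noteq> 0 \<longrightarrow> t 12 v \<noteq> 0))"
proof -
  define I where "I t \<longleftrightarrow> same_except search_vars s t \<and> search_st Blk Root t \<and> (\<forall>v. s 12 v \<noteq> 0 \<longrightarrow> t 12 v \<noteq> 0)" for t
  let ?b = "Sub (var 26) (var 28)"
  have init: "I s" using assms by (simp add: I_def same_except_def)
  have st: "I (ev search_body t) \<and> n - ev search_body t 28 0 < n - t 28 0" if t: "I t" "aval ?b t \<noteq> 0" for t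
  proof -
    have "inp t" using t(1) assms(1) same_except_inp[of search_vars s t] by (auto simp: I_def)
    have h: "t 28 0 < t 26 0" using t(2) by simp
    have T: "search_st Blk Root t" using t(1) by (simp add: I_def)
    note s = search_step[OF \<open>inp t\<close> T h]
    have "t 26 0 \<le> n" using search_invD(8) T by (auto simp: search_st_def)
    moreover have "same_except search_vars s (ev search_body t)"
      using t(1) same_except_ev[of search_vars s t search_body] by (simp add: I_def writes_bodies)
    ultimately show ?thesis using s t(1) h unfolding I_def by auto
  qed
  have "runs (Loop ?b search_body) s ((1 + acost ?b + cost search_body) * ((n - s 28 0) + 1)) (\<lambda>t. I t \<and> aval ?b t = 0)"
    by (rule runs_Loop[where I = I and \<mu> = "\<lambda>t. n - t 28 0", OF straight_bodies(1) init st])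
  then show ?thesis unfolding search_def
  proof (rule runs_weaken)
    show "(1 + acost ?b + cost search_body) * ((n - s 28 0) + 1) \<le> (6 + cost search_body) * (n + 1)"
      by (intro mult_le_mono) auto
    fix t assume t: "I t \<and> aval ?b t = 0"
    then have "t 28 0 \<le> t 26 0" using search_invD(1) by (auto simp: I_def search_st_def)
    then show "same_except search_vars s t \<and> search_st Blk Root t \<and> t 28 0 = t 26 0 \<and> (\<forall>v. s 12 v \<noteq> 0 \<longrightarrow> t 12 v \<noteq> 0)"
      using t by (auto simp: I_def)
  qed
qed

end

context matching_lists begin

lemma inp_pt: "inp t \<Longrightarrow> v < n \<Longrightarrow> mt v \<Longrightarrow> t 4 (t 3 v) = pt v"
  using array_of_concat[of v hadj 0] len by (simp add: inp_cells pt_def hd_conv_nth)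

abbreviation roots_vars :: "nat set" where "roots_vars \<equiv> {9, 12, 26, 27}"

lemma roots:
  assumes "s = input_store lam adj hadj"
  shows "runs roots s ((6 + cost roots_body) * (n + 1))
    (\<lambda>t. same_except roots_vars s t \<and> search_st {} good t \<and> (\<forall>v\<in>good. t 12 v \<noteq> 0))"
proof -
  have inp: "inp s" by (simp add: assms(1) inp_def)
  have zero: "s k = (\<lambda>_. 0)" if "5 \<le> k" for k using that by (auto simp: assms(1) input_store_def)
  define I where "I t \<longleftrightarrow> same_except roots_vars s t \<and> search_st {} good t \<and> t 27 0 \<le> n \<and>
    (\<forall>v<n. if v < t 27 0 then v \<in> good \<longrightarrow> t 12 v \<noteq> 0 else t 12 v = 0)" for t
  let ?b = "Sub (Cell 0 (Const 0)) (var 27)"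
  have init: "I s" by (auto simp: I_def same_except_def search_st_def search_inv_def zero)
  have it: "inp t" if "I t" for t using that inp same_except_inp[of roots_vars s t] by (auto simp: I_def)
  have st: "I (ev roots_body t) \<and> n - ev roots_body t 27 0 < n - t 27 0" if t: "I t" "aval ?b t \<noteq> 0" for t
  proof -
    define i where "i = t 27 0"
    have i: "i < n" using t(2) inp_cells[OF it[OF t(1)]] by (simp add: i_def)
    note dg = inp_deg[OF it[OF t(1)] i]
    have test: "aval (Add
       (Sub (Const 1) (Sub (Cell 3 (Add (var 27) (Const 1))) (Cell 3 (var 27))))
       (Sub (Const 4) (Sub (Cell 1 (Add (var 27) (Const 1))) (Cell 1 (var 27))))) t \<noteq> 0 \<longleftrightarrow> i \<in> good"
      using dg i by (auto simp: good_def i_def Suc_le_eq)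
    have sa: "same_except roots_vars s (ev roots_body t)"
      using t(1) same_except_ev[of roots_vars s t roots_body] by (simp add: I_def writes_bodies)
    define t' where "t' = ev roots_body t"
    have T: "search_inv {} good (t 9) (t 12) (t 26 0) (t 28 0)" and t12: "t 12 i = 0"
      and old: "\<And>v. v < n \<Longrightarrow> if v < i then v \<in> good \<longrightarrow> t 12 v \<noteq> 0 else t 12 v = 0"
      using t(1) i unfolding I_def search_st_def i_def by (auto split: if_splits)
    show ?thesis
    proof (cases "i \<in> good")
      case True
      then have e: "t' = ev (Seq (push (var 27)) (incr 27)) t" unfolding t'_def roots_body_def using test by simp
      have t': "t' 9 = (t 9)(t 26 0 := i)" "t' 12 = (t 12)(i := 1)" "t' 26 0 = Suc (t 26 0)" "t' 28 0 = t 28 0" "t' 27 0 = Suc i"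
        unfolding e by (auto simp: push_def i_def fun_eq_iff)
      have "search_st {} good t'" unfolding search_st_def t'
        by (rule search_push[OF T i t12]) (use True in auto)
      moreover have "\<forall>v<n. if v < Suc i then v \<in> good \<longrightarrow> t' 12 v \<noteq> 0 else t' 12 v = 0"
      proof (intro allI impI)
        fix v assume v: "v < n"
        show "if v < Suc i then v \<in> good \<longrightarrow> t' 12 v \<noteq> 0 else t' 12 v = 0"
          using old[OF v] by (auto simp: t' less_Suc_eq split: if_splits)
      qed
      ultimately show ?thesis using sa i unfolding I_def t'_def[symmetric] t'(5) by (simp add: i_def[symmetric])
    next
      case False
      then have e: "t' = ev (incr 27) t" unfolding t'_def roots_body_def using test by simp
      have t': "t' 9 = t 9" "t' 12 = t 12" "t' 26 0 = t 26 0" "t' 28 0 = t 28 0" "t' 27 0 = Suc i"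
        unfolding e by (auto simp: i_def)
      have "search_st {} good t'" using T unfolding search_st_def t' .
      moreover have "\<forall>v<n. if v < Suc i then v \<in> good \<longrightarrow> t' 12 v \<noteq> 0 else t' 12 v = 0"
      proof (intro allI impI)
        fix v assume v: "v < n"
        show "if v < Suc i then v \<in> good \<longrightarrow> t' 12 v \<noteq> 0 else t' 12 v = 0"
          using old[OF v] False by (auto simp: t' less_Suc_eq split: if_splits)
      qed
      ultimately show ?thesis using sa i unfolding I_def t'_def[symmetric] t'(5) by (simp add: i_def[symmetric])
    qed
  qed
  have "runs (Loop ?b roots_body) s ((1 + acost ?b + cost roots_body) * ((n - s 27 0) + 1)) (\<lambda>t. I t \<and> aval ?b t = 0)"
    by (rule runs_Loop[where I = I and \<mu> = "\<lambda>t. n - t 27 0", OF straight_bodies(2) init st])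
  then show ?thesis unfolding roots_def
  proof (rule runs_weaken)
    show "(1 + acost ?b + cost roots_body) * ((n - s 27 0) + 1) \<le> (6 + cost roots_body) * (n + 1)"
      by (intro mult_le_mono) auto
    fix t assume t: "I t \<and> aval ?b t = 0"
    then have "t 27 0 = n" using inp_cells[OF it, of t] by (auto simp: I_def)
    moreover have "good \<subseteq> {..<n}" by (auto simp: good_def)
    ultimately show "same_except roots_vars s t \<and> search_st {} good t \<and> (\<forall>v\<in>good. t 12 v \<noteq> 0)"
      using t by (auto simp: I_def)
  qed
qed

section \<open>Numbering the matching edges of the unvisited components\<close>

definition pair_st :: "nat set \<Rightarrow> store \<Rightarrow> bool" where
  "pair_st S t \<longleftrightarrow> pair_inv S (t 13) (t 14) (t 15) (t 16) (t 17) (t 18) (t 32 0) (t 31 0)"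

lemma add_pair:
  assumes "inp t" "t 21 0 = w" "t 20 0 = c" "t 34 0 = r" "t 32 0 = k" "w < n" "mt w"
  defines "t' \<equiv> ev add_pair t"
  shows "t' 13 = (t 13)(w := Suc k, pt w := Suc k)" "t' 14 = (t 14)(w := r, pt w := r)"
    "t' 15 = (t 15)(r := c)" "t' 16 = (t 16)(r := c)" "t' 17 = (t 17)(r := w)"
    "t' 18 = (t 18)(2 * k := w, Suc (2 * k) := pt w)" "t' 32 0 = Suc k" "t' 31 = t 31" "t' 20 = t 20" "t' 34 = t 34" "t' 27 = t 27"
  using assms(2-5) inp_pt[OF assms(1,6,7)] unfolding t'_def
  by (auto simp: add_pair_def fun_eq_iff mult_2)

lemma pair_expand:
  assumes "inp t" and I: "pair_st S t" and h: "t 31 0 < 2 * t 32 0"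
    and S: "\<And>v. v \<in> S \<Longrightarrow> v < n \<and> mt v \<and> N v \<subseteq> S"
  shows "pair_st S (ev expand t)" "ev expand t 31 0 = Suc (t 31 0)" "t 13 x \<noteq> 0 \<Longrightarrow> ev expand t 13 x \<noteq> 0"
    "ev expand t 27 = t 27"
proof -
  define v where "v = t 18 (t 31 0)"
  define r where "r = t 14 v"
  note D = pair_invD[OF I[unfolded pair_st_def]]
  have vS: "v \<in> S" using D(3)[OF h] by (simp add: v_def)
  then have vn: "v < n" using S by auto
  let ?s = "t(20 := (t 20)(0 := v), 34 := (t 34)(0 := r))"
  define J where "J D u \<longleftrightarrow> pair_st S u \<and> u 31 0 = t 31 0 \<and> u 31 0 < 2 * u 32 0 \<and> u 18 (u 31 0) = v \<and> u 14 v = r \<and>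
    u 34 0 = r \<and> (\<forall>x\<in>D. u 13 x \<noteq> 0) \<and> (\<forall>x. t 13 x \<noteq> 0 \<longrightarrow> u 13 x \<noteq> 0)" for D :: "nat set" and u :: store
  have wr: "writes discover = {13, 14, 15, 16, 17, 18, 32, 33}" by (auto simp: discover_def add_pair_def)
  have J: "J (N v) (ev (for_adj 1 2 21 discover) ?s)"
  proof (rule for_adj_rule)
    show "?s 1 = array_of (offsets adj)" "?s 2 = array_of (concat adj)" using inp_cells[OF assms(1)] by simp_all
    show "length (adj ! v) \<le> 4" "distinct (adj ! v)" using deg dist vn by auto
    show "J {} ?s" using I h by (simp add: J_def pair_st_def v_def r_def)
    fix D x u
    assume x: "x \<in> N v" and Ju: "J D u" and fr: "\<forall>k. k \<notin> insert 21 (writes discover) \<longrightarrow> u k = ?s k"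
    have xS: "x \<in> S" using S[OF vS] x by auto
    have xn: "x < n" "mt x" "v \<in> N x" using S[OF xS] nb[OF vn x] by auto
    have iu: "inp u" using assms(1) by (rule inp_cong) (use fr in \<open>auto simp: wr\<close>)
    have u20: "u 20 0 = v" using fr by (auto simp: wr)
    show "J (insert x D) (ev discover (u(21 := (u 21)(0 := x))))"
    proof (cases "u 13 x = 0")
      case False
      then have "ev discover (u(21 := (u 21)(0 := x))) = u(21 := (u 21)(0 := x))" by (simp add: discover_def)
      then show ?thesis using Ju False by (auto simp: J_def pair_st_def)
    next
      case True
      let ?u = "u(21 := (u 21)(0 := x))"
      define u' where "u' = ev discover ?u"
      have e: "u' = ev add_pair ?u" using True by (simp add: u'_def discover_def)
      have "?u 21 0 = x" "?u 20 0 = v" "?u 34 0 = r" "?u 32 0 = u 32 0" "inp ?u" using Ju u20 iu by (auto simp: J_def)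
      note ap = add_pair[OF this(5,1-4) xn(1,2), folded e]
      have Iu: "pair_inv S (u 13) (u 14) (u 15) (u 16) (u 17) (u 18) (u 32 0) (u 31 0)"
        using Ju unfolding J_def pair_st_def by blast
      have "pair_inv S ((u 13)(x := Suc (u 32 0), pt x := Suc (u 32 0))) ((u 14)(x := r, pt x := r))
        ((u 15)(r := v)) ((u 16)(r := v)) ((u 17)(r := x)) ((u 18)(2 * u 32 0 := x, Suc (2 * u 32 0) := pt x)) (Suc (u 32 0)) (u 31 0)"
      proof (rule pair_push[OF Iu _ _ xS True])
        show "S \<subseteq> {v. v < n \<and> mt v}" using S by auto
        show "\<And>v. v \<in> S \<Longrightarrow> pt v \<in> S" using S pt(3) by blast
        show "u 31 0 < 2 * u 32 0 \<and> v = u 18 (u 31 0) \<and> r = u 14 v \<and> v \<in> N x \<or> u 31 0 = 2 * u 32 0 \<and> v = x \<and> r = x"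
          using Ju xn by (auto simp: J_def)
      qed
      then have "pair_st S u'" unfolding pair_st_def using ap by simp
      moreover have pv: "u 13 v \<noteq> 0"
      proof -
        have "u 31 0 < 2 * u 32 0" "u 18 (u 31 0) = v" using Ju unfolding J_def by blast+
        then show ?thesis using pair_invD(4)[OF Iu, of "u 31 0"] by simp
      qed
      then have "v \<noteq> x" "v \<noteq> pt x" using True pair_invD(6)[OF Iu pv] pt[OF xn(1,2)] by auto
      then have "u' 14 v = r" using Ju ap by (simp add: J_def)
      moreover have "u' 18 (u' 31 0) = v" "u' 31 0 < 2 * u' 32 0" "u' 31 0 = t 31 0" "u' 34 0 = r"
        using Ju ap by (auto simp: J_def)
      moreover have "\<forall>y\<in>insert x D. u' 13 y \<noteq> 0" "\<forall>y. t 13 y \<noteq> 0 \<longrightarrow> u' 13 y \<noteq> 0" using Ju ap by (auto simp: J_def)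
      ultimately show ?thesis unfolding u'_def[symmetric] J_def by blast
    qed
  qed (use vn in \<open>auto simp: wr\<close>)
  define u where "u = ev (for_adj 1 2 21 discover) ?s"
  note J = J[folded u_def, unfolded J_def]
  have u27: "u 27 = t 27" by (simp add: u_def ev_frame wr)
  define t' where "t' = ev expand t"
  have e: "t' = u(31 := (u 31)(0 := Suc (u 31 0)))" by (simp add: t'_def expand_def u_def v_def r_def)
  have t': "t' 31 0 = Suc (t 31 0)" "t' 13 = u 13" "t' 14 = u 14" "t' 15 = u 15" "t' 16 = u 16" "t' 17 = u 17" "t' 18 = u 18"
    "t' 32 = u 32" "t' 27 = t 27"
    using J u27 by (simp_all add: e)
  have "pair_inv S (u 13) (u 14) (u 15) (u 16) (u 17) (u 18) (u 32 0) (Suc (u 31 0))"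
    using J by (intro pair_advance) (auto simp: pair_st_def)
  then show "pair_st S (ev expand t)" using J by (simp add: pair_st_def t'_def[symmetric] t')
  show "ev expand t 31 0 = Suc (t 31 0)" "ev expand t 27 = t 27" using t' by (simp_all add: t'_def)
  show "t 13 x \<noteq> 0 \<Longrightarrow> ev expand t 13 x \<noteq> 0" using J t'(2) by (simp add: t'_def)
qed

lemma pair_start:
  assumes "inp t" and I: "pair_st S t" and h: "t 31 0 = 2 * t 32 0" and i: "t 27 0 = i" "i < n"
    and S: "\<And>v. v \<in> S \<longleftrightarrow> v < n \<and> t 12 v = 0" "\<And>v. v \<in> S \<Longrightarrow> mt v \<and> N v \<subseteq> S"
  shows "pair_st S (ev start t)" "ev start t 31 0 = t 31 0" "t 13 x \<noteq> 0 \<Longrightarrow> ev start t 13 x \<noteq> 0"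
    "ev start t 27 0 = Suc i" "i \<in> S \<Longrightarrow> ev start t 13 i \<noteq> 0"
proof -
  let ?s = "t(20 := (t 20)(0 := i), 21 := (t 21)(0 := i), 34 := (t 34)(0 := i))"
  have e: "ev start t = ev (Seq (Cond (Add (Cell 12 (var 27)) (Cell 13 (var 27))) Skip add_pair) (incr 27)) ?s"
    using i by (simp add: start_def)
  have goal: "pair_st S (ev start t) \<and> ev start t 31 0 = t 31 0 \<and> (\<forall>x. t 13 x \<noteq> 0 \<longrightarrow> ev start t 13 x \<noteq> 0) \<and>
    ev start t 27 0 = Suc i \<and> (i \<in> S \<longrightarrow> ev start t 13 i \<noteq> 0)"
  proof (cases "t 12 i = 0 \<and> t 13 i = 0")
    case False
    then have e': "ev start t = ev (incr 27) ?s" unfolding e using i(1) by auto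
    define t' where "t' = ev start t"
    have t': "t' 13 = t 13" "t' 14 = t 14" "t' 15 = t 15" "t' 16 = t 16" "t' 17 = t 17" "t' 18 = t 18"
      "t' 31 = t 31" "t' 32 = t 32" "t' 27 0 = Suc i"
      unfolding t'_def e' using i(1) by simp_all
    have "i \<in> S \<longrightarrow> t 13 i \<noteq> 0" using False S(1)[of i] by auto
    then show ?thesis using I unfolding t'_def[symmetric] pair_st_def t' by blast
  next
    case True
    then have iS: "i \<in> S" using S(1) i by auto
    then have mi: "mt i" using S by auto
    have "inp ?s" using assms(1) by simp
    have s: "?s 21 0 = i" "?s 20 0 = i" "?s 34 0 = i" "?s 32 0 = t 32 0" by auto
    define u where "u = ev add_pair ?s"
    note ap = add_pair[OF \<open>inp ?s\<close> s i(2) mi, folded u_def]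
    have e': "ev start t = ev (incr 27) u" unfolding e using True i(1) by (simp add: u_def)
    define t' where "t' = ev start t"
    have t': "t' 13 = (t 13)(i := Suc (t 32 0), pt i := Suc (t 32 0))" "t' 14 = (t 14)(i := i, pt i := i)"
      "t' 15 = (t 15)(i := i)" "t' 16 = (t 16)(i := i)" "t' 17 = (t 17)(i := i)"
      "t' 18 = (t 18)(2 * t 32 0 := i, Suc (2 * t 32 0) := pt i)" "t' 32 0 = Suc (t 32 0)" "t' 31 0 = t 31 0" "t' 27 0 = Suc i"
      unfolding t'_def e' using ap i(1) by (auto simp: fun_eq_iff)
    have "pair_st S t'" unfolding pair_st_def t'
    proof (rule pair_push[OF I[unfolded pair_st_def] _ _ iS])
      show "S \<subseteq> {v. v < n \<and> mt v}" using S by auto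
      show "\<And>v. v \<in> S \<Longrightarrow> pt v \<in> S" using S pt(3) by blast
    qed (use True h in auto)
    moreover have "\<forall>x. t 13 x \<noteq> 0 \<longrightarrow> t' 13 x \<noteq> 0" "t' 13 i \<noteq> 0" unfolding t'(1) by simp_all
    ultimately show ?thesis using t'(8,9) unfolding t'_def[symmetric] by blast
  qed
  then show "pair_st S (ev start t)" "ev start t 31 0 = t 31 0" "t 13 x \<noteq> 0 \<Longrightarrow> ev start t 13 x \<noteq> 0"
    "ev start t 27 0 = Suc i" "i \<in> S \<Longrightarrow> ev start t 13 i \<noteq> 0" by blast+
qed

abbreviation pair_vars :: "nat set" where
  "pair_vars \<equiv> {13, 14, 15, 16, 17, 18, 20, 21, 27, 31, 32, 33, 34}"

lemma pair_search:
  assumes inp: "inp s" and zero: "\<And>k. k \<in> {13, 14, 15, 16, 17, 18, 31, 32} \<Longrightarrow> s k = (\<lambda>_. 0)"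
    and S: "\<And>v. v \<in> S \<longleftrightarrow> v < n \<and> s 12 v = 0" "\<And>v. v \<in> S \<Longrightarrow> mt v \<and> N v \<subseteq> S"
  shows "runs pair_search s (3 + (15 + cost pair_body) * (2 * n + 1))
    (\<lambda>t. same_except pair_vars s t \<and> pair_inv S (t 13) (t 14) (t 15) (t 16) (t 17) (t 18) (t 32 0) (2 * t 32 0) \<and>
      (\<forall>v\<in>S. t 13 v \<noteq> 0))"
proof -
  define I where "I t \<longleftrightarrow> same_except pair_vars s t \<and> pair_st S t \<and> t 27 0 \<le> n \<and>
    (\<forall>v\<in>S. v < t 27 0 \<longrightarrow> t 13 v \<noteq> 0)" for t
  let ?b = "Add (Sub (Cell 0 (Const 0)) (var 27)) (Sub (Add (var 32) (var 32)) (var 31))"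
  let ?s = "s(27 := (s 27)(0 := 0))"
  have init: "I ?s" using zero by (auto simp: I_def same_except_def pair_st_def pair_inv_def)
  have it: "inp t" "t 12 = s 12" if "I t" for t
    using that inp same_except_inp[of pair_vars s t] by (auto simp: I_def same_except_def)
  have kn: "2 * t 32 0 \<le> n" "t 31 0 \<le> 2 * t 32 0" if t: "I t" for t
  proof -
    have I: "pair_inv S (t 13) (t 14) (t 15) (t 16) (t 17) (t 18) (t 32 0) (t 31 0)" using t by (simp add: I_def pair_st_def)
    have "t 18 ` {..<2 * t 32 0} \<subseteq> {..<n}" using pair_invD(3)[OF I] S(1) by auto
    then show "2 * t 32 0 \<le> n" using card_mono[of "{..<n}" "t 18 ` {..<2 * t 32 0}"] pair_invD(2)[OF I] by (simp add: card_image)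
    show "t 31 0 \<le> 2 * t 32 0" using pair_invD(1)[OF I] .
  qed
  have st: "I (ev pair_body t) \<and> (n - ev pair_body t 27 0) + (n - ev pair_body t 31 0) < (n - t 27 0) + (n - t 31 0)"
    if t: "I t" "aval ?b t \<noteq> 0" for t
  proof -
    have sa: "same_except pair_vars s (ev pair_body t)"
      using t(1) same_except_ev[of pair_vars s t pair_body] by (simp add: I_def writes_bodies)
    have P: "pair_st S t" using t(1) by (simp add: I_def)
    show ?thesis
    proof (cases "t 31 0 < 2 * t 32 0")
      case True
      then have e: "ev pair_body t = ev expand t" by (simp add: pair_body_def mult_2)
      note x = pair_expand[OF it(1)[OF t(1)] P True, folded e]
      have "pair_st S (ev pair_body t)" "ev pair_body t 31 0 = Suc (t 31 0)"
        "\<And>y. t 13 y \<noteq> 0 \<Longrightarrow> ev pair_body t 13 y \<noteq> 0" "ev pair_body t 27 = t 27"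
        using x S by blast+
      then show ?thesis using t(1) sa kn[OF t(1)] True unfolding I_def by auto
    next
      case False
      then have h: "t 31 0 = 2 * t 32 0" using kn(2)[OF t(1)] by simp
      have i: "t 27 0 < n" using t(2) False inp_cells[OF it(1)[OF t(1)]] by (auto simp: h mult_2)
      have e: "ev pair_body t = ev start t" using h by (simp add: pair_body_def mult_2)
      have x': "pair_st S (ev pair_body t)" "ev pair_body t 31 0 = t 31 0"
        "\<And>y. t 13 y \<noteq> 0 \<Longrightarrow> ev pair_body t 13 y \<noteq> 0" "ev pair_body t 27 0 = Suc (t 27 0)"
        "t 27 0 \<in> S \<Longrightarrow> ev pair_body t 13 (t 27 0) \<noteq> 0"
        using pair_start[OF it(1)[OF t(1)] P h refl i, folded e] S it(2)[OF t(1)] by auto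
      have "ev pair_body t 13 v \<noteq> 0" if "v \<in> S" "v < Suc (t 27 0)" for v
        using that x'(3)[of v] x'(5) t(1) by (cases "v = t 27 0") (auto simp: I_def)
      then show ?thesis using x'(1,2,4) sa i unfolding I_def by auto
    qed
  qed
  have "runs (Loop ?b pair_body) ?s ((1 + acost ?b + cost pair_body) * ((n - ?s 27 0) + (n - ?s 31 0) + 1)) (\<lambda>t. I t \<and> aval ?b t = 0)"
    by (rule runs_Loop[where I = I and \<mu> = "\<lambda>t. (n - t 27 0) + (n - t 31 0)", OF straight_bodies(3) init st])
  then have "runs pair_search s (3 + (1 + acost ?b + cost pair_body) * ((n - ?s 27 0) + (n - ?s 31 0) + 1)) (\<lambda>t. I t \<and> aval ?b t = 0)"
    unfolding pair_search_def by (rule runs_Seq_straight[rotated 2]) simp_all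
  then show ?thesis
  proof (rule runs_weaken)
    show "3 + (1 + acost ?b + cost pair_body) * ((n - ?s 27 0) + (n - ?s 31 0) + 1) \<le> 3 + (15 + cost pair_body) * (2 * n + 1)"
      by (intro add_left_mono mult_le_mono) auto
    fix t assume t: "I t \<and> aval ?b t = 0"
    then have "n \<le> t 27 0" "2 * t 32 0 \<le> t 31 0" using inp_cells[OF it(1), of t] by auto
    then have "t 31 0 = 2 * t 32 0" "t 27 0 = n" using t kn[of t] by (auto simp: I_def)
    then show "same_except pair_vars s t \<and> pair_inv S (t 13) (t 14) (t 15) (t 16) (t 17) (t 18) (t 32 0) (2 * t 32 0) \<and>
      (\<forall>v\<in>S. t 13 v \<noteq> 0)" using t S(1) unfolding I_def pair_st_def by auto
  qed
qed

end

text \<open>By truncated subtraction this decides whether the vertex in variable \<open>x\<close> is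
  late, with the bound taken from the component of the current vertex.\<close>

definition late_test :: "nat \<Rightarrow> aexp" where
  "late_test x = Sub (Cell 13 (var x)) (Cell 13 (Cell 15 (Cell 14 (var 20))))"

text \<open>Two adjacent late vertices that are not partners replace the fallback choice: the
  neighbor becomes \<open>u\<close> and the current vertex becomes \<open>x\<close>.\<close>

definition improve :: com where
  "improve = Cond (late_test 21) (Cond (neq (var 21) (Cell 4 (Cell 3 (var 20))))
     (Seq (Assign 16 (Cell 14 (var 20)) (var 21)) (Assign 17 (Cell 14 (var 20)) (var 20))) Skip) Skip"

definition scan_body :: com where
  "scan_body = Seq (set_var 20 (var 27)) (Seq (Cond (late_test 20) (for_adj 1 2 21 improve) Skip) (incr 27))"

definition on_roots :: "com \<Rightarrow> com" where
  "on_roots p = Seq (Cond (Cell 13 (var 27)) (Cond (neq (Cell 14 (var 27)) (var 27)) Skip p) Skip) (incr 27)"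

definition block :: com where
  "block = Seq (set_var 20 (Cell 16 (var 27))) (Seq (set_var 21 (Cell 17 (var 27)))
     (Seq (set_var 33 (Cell 4 (Cell 3 (var 21))))
     (Seq (Assign 6 (var 21) (Const 2)) (Seq (Assign 6 (var 33) (Const 4))
     (Seq (Assign 12 (var 21) (Const 1)) (Seq (Assign 12 (var 33) (Const 1)) (Seq (Assign 12 (var 20) (Const 1))
     (Seq (set_var 34 (Cell 4 (Cell 3 (var 20)))) (push (var 34))))))))))"

definition append_u :: com where
  "append_u = Seq (Assign 9 (var 26) (Cell 16 (var 27))) (incr 26)"

definition over_vertices :: "com \<Rightarrow> com" where
  "over_vertices p = Seq (set_var 27 (Const 0)) (Loop (Sub (Cell 0 (Const 0)) (var 27)) p)"

definition matching_program :: com where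
  "matching_program = Seq roots (Seq search (Seq pair_search (Seq (over_vertices scan_body)
     (Seq (over_vertices (on_roots block)) (Seq search (Seq (over_vertices (on_roots append_u)) (engine 5 False)))))))"

lemma writes_improve: "writes improve = {16, 17}" by (auto simp: improve_def)

context matching_lists begin

lemma over_vertices:
  assumes "inp s" "straight p" "writes p \<subseteq> X" "27 \<in> X" "X \<inter> {..<5} = {}"
    and init: "J 0 s" and J: "\<And>i t u. J i t \<Longrightarrow> same_except {27} t u \<Longrightarrow> J i u"
    and step: "\<And>i t. i < n \<Longrightarrow> t 27 0 = i \<Longrightarrow> J i t \<Longrightarrow> same_except X s t \<Longrightarrow> inp t \<Longrightarrow>
      J (Suc i) (ev p t) \<and> ev p t 27 0 = Suc i"
  shows "runs (over_vertices p) s (3 + (6 + cost p) * (n + 1)) (\<lambda>t. same_except X s t \<and> J n t)"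
proof -
  define I where "I t \<longleftrightarrow> same_except X s t \<and> t 27 0 \<le> n \<and> J (t 27 0) t" for t
  let ?b = "Sub (Cell 0 (Const 0)) (var 27)"
  let ?s = "s(27 := (s 27)(0 := 0))"
  have "same_except {27} s ?s" by (simp add: same_except_def)
  then have init: "I ?s" using J[OF init] assms(4) by (simp add: I_def same_except_def)
  have it: "inp t" if "I t" for t using that assms(1,5) same_except_inp[of X s t] by (auto simp: I_def)
  have st: "I (ev p t) \<and> n - ev p t 27 0 < n - t 27 0" if t: "I t" "aval ?b t \<noteq> 0" for t
  proof -
    have i: "t 27 0 < n" using t(2) inp_cells[OF it[OF t(1)]] by simp
    have "J (Suc (t 27 0)) (ev p t) \<and> ev p t 27 0 = Suc (t 27 0)"
      using t(1) by (intro step[of "t 27 0" t, OF i refl _ _ it[OF t(1)]]) (auto simp: I_def)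
    moreover have "same_except X s (ev p t)"
      using t(1) same_except_ev[of X s t p] assms(3) by (simp add: I_def)
    ultimately show ?thesis using i by (simp add: I_def)
  qed
  have "runs (Loop ?b p) ?s ((1 + acost ?b + cost p) * ((n - ?s 27 0) + 1)) (\<lambda>t. I t \<and> aval ?b t = 0)"
    by (rule runs_Loop[where I = I and \<mu> = "\<lambda>t. n - t 27 0", OF assms(2) init st])
  then have "runs (over_vertices p) s (3 + (1 + acost ?b + cost p) * ((n - ?s 27 0) + 1)) (\<lambda>t. I t \<and> aval ?b t = 0)"
    unfolding over_vertices_def by (rule runs_Seq_straight[rotated 2]) simp_all
  then show ?thesis
  proof (rule runs_weaken)
    show "3 + (1 + acost ?b + cost p) * ((n - ?s 27 0) + 1) \<le> 3 + (6 + cost p) * (n + 1)" by (simp add: algebra_simps)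
    fix t assume t: "I t \<and> aval ?b t = 0"
    then have "t 27 0 = n" using inp_cells[OF it, of t] by (auto simp: I_def)
    then show "same_except X s t \<and> J n t" using t unfolding I_def by auto
  qed
qed

end

section \<open>Choice of the removed vertices in every component\<close>

context pair_done begin

text \<open>\<open>D\<close> is the inspected part of the neighborhood of the current vertex
  \<open>z\<close>. For \<open>D = {}\<close> the clause on \<open>z\<close> is vacuous, so 0 can
  stand for \<open>z\<close> between two vertices. A component has either got its improved choice or
  shown no joined late edges so far.\<close>

definition scan_inv :: "nat set \<Rightarrow> nat \<Rightarrow> nat \<Rightarrow> (nat \<Rightarrow> nat) \<Rightarrow> (nat \<Rightarrow> nat) \<Rightarrow> bool" where
  "scan_inv D z i fu fx \<longleftrightarrow> (\<forall>r. pr r \<noteq> 0 \<and> rt r = r \<longrightarrow> comp_triple pr rt lu r (fu r) (fx r) \<and>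
     (pr (lu r) < pr (fu r) \<or> late_independent pr rt lu r i \<and>
       (pr z \<noteq> 0 \<and> rt z = r \<and> pr (lu r) < pr z \<longrightarrow> (\<forall>w\<in>D. w \<noteq> pt z \<longrightarrow> pr w \<le> pr (lu r)))))"

lemma scan_inv_done:
  assumes "scan_inv (N i) i i fu fx"
  shows "scan_inv {} 0 (Suc i) fu fx"
  using assms unfolding scan_inv_def late_independent_def by (auto simp: less_Suc_eq)

lemma scan_inv_start: "scan_inv {} 0 i fu fx \<Longrightarrow> scan_inv {} i i fu fx"
  unfolding scan_inv_def by auto

text \<open>Only partners share a number, so the two late vertices lie on different edges and form a
  legal triple with late \<open>u\<close>. The component then satisfies the first alternative for
  good.\<close>

lemma scan_inv_improve:
  assumes "scan_inv D z i fu fx" "pr z \<noteq> 0" "w \<in> N z" "w \<noteq> pt z" "pr (lu (rt z)) < pr z" "pr (lu (rt z)) < pr w"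
  shows "scan_inv D' z i (fu(rt z := w)) (fx(rt z := z))"
proof -
  note cz = comp_closed[OF assms(2)]
  have w: "pr w \<noteq> 0" "rt w = rt z" using cz(1)[OF assms(3)] by auto
  have "w \<noteq> z" "z \<in> N w" using nb[OF cz(7) assms(3)] by auto
  then have "pr w \<noteq> pr z" using pair_invD(10)[OF I assms(2), of w] assms(4) by auto
  then have "comp_triple pr rt lu (rt z) w z" using assms w \<open>z \<in> N w\<close> by (simp add: comp_triple_def)
  then show ?thesis using assms(1,6) unfolding scan_inv_def by auto
qed

lemma scan_step:
  assumes "inp t" "t 13 = pr" "t 14 = rt" "t 15 = lu" "t 27 0 = i" "i < n" and J: "scan_inv {} 0 i (t 16) (t 17)"
  shows "scan_inv {} 0 (Suc i) (ev scan_body t 16) (ev scan_body t 17)" "ev scan_body t 27 0 = Suc i"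
proof -
  let ?s = "t(20 := (t 20)(0 := i))"
  define u where "u = ev (Cond (late_test 20) (for_adj 1 2 21 improve) Skip) ?s"
  have e: "ev scan_body t = ev (incr 27) u" using assms(5) by (simp add: scan_body_def u_def)
  have u27: "u 27 = t 27" unfolding u_def by (subst ev_frame) (simp_all add: writes_improve)
  show "ev scan_body t 27 0 = Suc i" using u27 assms(5) by (simp add: e)
  have "scan_inv (N i) i i (u 16) (u 17)"
  proof (cases "pr (lu (rt i)) < pr i")
    case False
    then have "u = ?s" using assms by (simp add: u_def late_test_def)
    then have "u 16 = t 16" "u 17 = t 17" by simp_all
    then show ?thesis using J False unfolding scan_inv_def by auto
  next
    case True
    then have pi: "pr i \<noteq> 0" by simp
    note ci = comp_closed[OF pi]
    have pti: "t 4 (t 3 i) = pt i" using inp_pt[OF assms(1,6) ci(8)] .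
    have u: "u = ev (for_adj 1 2 21 improve) ?s" using True assms by (simp add: u_def late_test_def)
    define K where "K D v \<longleftrightarrow> scan_inv D i i (v 16) (v 17)" for D and v :: store
    have "K (N i) (ev (for_adj 1 2 21 improve) ?s)"
    proof (rule for_adj_rule)
      show "?s 1 = array_of (offsets adj)" "?s 2 = array_of (concat adj)" using inp_cells[OF assms(1)] by simp_all
      show "length (adj ! i) \<le> 4" "distinct (adj ! i)" using deg dist assms by auto
      show "K {} ?s" using scan_inv_start[OF J] by (simp add: K_def)
      fix D x v
      assume x: "x \<in> N i" and Kv: "K D v" and fr: "\<forall>k. k \<notin> insert 21 (writes improve) \<longrightarrow> v k = ?s k"
      have v: "v 13 = pr" "v 14 = rt" "v 15 = lu" "v 20 0 = i" "v 3 = t 3" "v 4 = t 4"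
        using fr assms by (auto simp: writes_improve)
      let ?v = "v(21 := (v 21)(0 := x))"
      show "K (insert x D) (ev improve ?v)"
      proof (cases "pr (lu (rt i)) < pr x \<and> x \<noteq> pt i")
        case True
        then have "ev improve ?v = ?v(16 := (v 16)(rt i := x), 17 := (v 17)(rt i := i))"
          using v pti by (simp add: improve_def late_test_def)
        then show ?thesis using scan_inv_improve[OF Kv[unfolded K_def] pi x] True \<open>pr (lu (rt i)) < pr i\<close>
          by (simp add: K_def)
      next
        case False
        then have "ev improve ?v = ?v" using v pti by (auto simp: improve_def late_test_def)
        then show ?thesis using Kv False unfolding K_def scan_inv_def by auto
      qed
    qed (use assms in \<open>auto simp: writes_improve\<close>)
    then show ?thesis by (simp add: u K_def)
  qed
  then have "scan_inv {} 0 (Suc i) (u 16) (u 17)" by (rule scan_inv_done)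
  then show "scan_inv {} 0 (Suc i) (ev scan_body t 16) (ev scan_body t 17)" by (simp add: e)
qed

abbreviation scan_vars :: "nat set" where "scan_vars \<equiv> {16, 17, 20, 21, 27}"

lemma scan:
  assumes "inp s" "s 13 = pr" "s 14 = rt" "s 15 = lu" "s 16 = fu0" "s 17 = fx0"
  shows "runs (over_vertices scan_body) s (3 + (6 + cost scan_body) * (n + 1))
    (\<lambda>t. same_except scan_vars s t \<and> scan_inv {} 0 n (t 16) (t 17))"
proof (rule over_vertices[where J = "\<lambda>i t. scan_inv {} 0 i (t 16) (t 17)"])
  show "straight scan_body" by (simp add: scan_body_def improve_def)
  show "writes scan_body \<subseteq> scan_vars" by (auto simp: scan_body_def writes_improve)
  have "comp_triple pr rt lu r (fu0 r) (fx0 r)" if "pr r \<noteq> 0" "rt r = r" for r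
    using default_triple[OF that] pair_invD(17)[OF I that] by simp
  then show "scan_inv {} 0 0 (s 16) (s 17)" using assms by (simp add: scan_inv_def late_independent_def)
  show "scan_inv {} 0 i (u 16) (u 17)" if "scan_inv {} 0 i (t 16) (t 17)" "same_except {27} t u" for i t u
    using that by (simp add: same_except_def)
  fix i t assume t: "i < n" "t 27 0 = i" "scan_inv {} 0 i (t 16) (t 17)" "same_except scan_vars s t" "inp t"
  have "t 13 = pr" "t 14 = rt" "t 15 = lu" using t(4) assms by (auto simp: same_except_def)
  then show "scan_inv {} 0 (Suc i) (ev scan_body t 16) (ev scan_body t 17) \<and> ev scan_body t 27 0 = Suc i"
    using scan_step[OF t(5) _ _ _ t(2,1,3)] by blast
qed (use assms in auto)

end

section \<open>Precoloring and the final order\<close>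

locale pair_triples = pair_done +
  fixes fu fx :: "nat \<Rightarrow> nat"
  assumes triples: "scan_inv {} 0 n fu fx"
begin

definition R :: "nat \<Rightarrow> nat set" where "R i = {r. r < i \<and> pr r \<noteq> 0 \<and> rt r = r}"

definition Blk :: "nat \<Rightarrow> nat set" where "Blk i = (\<Union>r\<in>R i. {fx r, pt (fx r), fu r})"

definition Rts :: "nat \<Rightarrow> nat set" where "Rts i = good \<union> (\<lambda>r. pt (fu r)) ` R i"

definition precol :: "nat \<Rightarrow> nat \<Rightarrow> nat" where
  "precol i z = (if z \<in> fx ` R i then 2 else if z \<in> (\<lambda>r. pt (fx r)) ` R i then 4 else 0)"

lemma R_Suc: "R (Suc i) = (if pr i \<noteq> 0 \<and> rt i = i then insert i (R i) else R i)"
  by (auto simp: R_def less_Suc_eq)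

lemma triple:
  assumes r: "pr r \<noteq> 0" "rt r = r"
  shows "pr (fu r) \<noteq> 0" "rt (fu r) = r" "pr (fx r) \<noteq> 0" "rt (fx r) = r" "fx r \<in> N (fu r)" "pr (fu r) \<noteq> pr (fx r)"
    "pr (pt (fx r)) = pr (fx r)" "rt (pt (fx r)) = r" "pr (pt (fu r)) = pr (fu r)" "rt (pt (fu r)) = r"
    "pt (fx r) \<noteq> fx r" "fu r \<noteq> fx r" "fu r \<noteq> pt (fx r)" "pt (fu r) \<notin> {fx r, pt (fx r), fu r}"
proof -
  have T: "comp_triple pr rt lu r (fu r) (fx r)" using triples r by (simp add: scan_inv_def)
  show a: "pr (fu r) \<noteq> 0" "rt (fu r) = r" "pr (fx r) \<noteq> 0" "rt (fx r) = r" "fx r \<in> N (fu r)" "pr (fu r) \<noteq> pr (fx r)"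
    using T by (simp_all add: comp_triple_def)
  note cu = comp_closed[OF a(1)] and cx = comp_closed[OF a(3)]
  show b: "pr (pt (fx r)) = pr (fx r)" "rt (pt (fx r)) = r" "pr (pt (fu r)) = pr (fu r)" "rt (pt (fu r)) = r"
    "pt (fx r) \<noteq> fx r" using a cu cx by auto
  show "fu r \<noteq> fx r" "fu r \<noteq> pt (fx r)" using a b by auto
  show "pt (fu r) \<notin> {fx r, pt (fx r), fu r}" using a b cu(5) by auto
qed

lemma RD: "r \<in> R i \<Longrightarrow> pr r \<noteq> 0 \<and> rt r = r \<and> r < i" by (simp add: R_def)

text \<open>Each root changes only its own component, so the components with roots from
  \<open>i\<close> on are still unvisited and can be blocked and seeded. \<open>vis\<close> stands
  for the state before blocking, whose visited vertices remain visited.\<close>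

lemma block_step:
  assumes "inp t" "t 13 = pr" "t 14 = rt" "t 16 = fu" "t 17 = fx" "t 27 0 = i" "i < n"
    and J: "search_st (Blk i) (Rts i) t" "t 6 = precol i" "\<And>v. pr v \<noteq> 0 \<Longrightarrow> i \<le> rt v \<Longrightarrow> t 12 v = 0"
      "\<And>v. vis v \<noteq> 0 \<Longrightarrow> t 12 v \<noteq> (0::nat)" "\<And>r. r \<in> R i \<Longrightarrow> t 12 (pt (fu r)) \<noteq> 0"
  defines "t' \<equiv> ev (on_roots block) t"
  shows "search_st (Blk (Suc i)) (Rts (Suc i)) t'" "t' 6 = precol (Suc i)"
    "pr v \<noteq> 0 \<Longrightarrow> Suc i \<le> rt v \<Longrightarrow> t' 12 v = 0" "vis v \<noteq> (0::nat) \<Longrightarrow> t' 12 v \<noteq> 0" "t' 27 0 = Suc i"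
    "r \<in> R (Suc i) \<Longrightarrow> t' 12 (pt (fu r)) \<noteq> 0"
proof -
  have goal: "search_st (Blk (Suc i)) (Rts (Suc i)) t' \<and> t' 6 = precol (Suc i) \<and>
    (\<forall>v. pr v \<noteq> 0 \<longrightarrow> Suc i \<le> rt v \<longrightarrow> t' 12 v = 0) \<and> (\<forall>v. vis v \<noteq> 0 \<longrightarrow> t' 12 v \<noteq> 0) \<and> t' 27 0 = Suc i \<and>
    (\<forall>r\<in>R (Suc i). t' 12 (pt (fu r)) \<noteq> 0)"
  proof (cases "pr i \<noteq> 0 \<and> rt i = i")
    case False
    then have e: "t' = ev (incr 27) t" using assms(2,3,6) by (auto simp: t'_def on_roots_def)
    have t': "t' 9 = t 9" "t' 12 = t 12" "t' 26 = t 26" "t' 28 = t 28" "t' 6 = t 6" "t' 27 0 = Suc i"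
      unfolding e using assms(6) by simp_all
    have RR: "R (Suc i) = R i" using False by (auto simp: R_Suc)
    then have "Blk (Suc i) = Blk i" "Rts (Suc i) = Rts i" "precol (Suc i) = precol i"
      by (simp_all add: Blk_def Rts_def precol_def fun_eq_iff)
    then show ?thesis using J unfolding search_st_def t' RR by auto
  next
    case True
    then have r: "pr i \<noteq> 0" "rt i = i" by auto
    define x y u v where "x = fx i" and "y = pt x" and "u = fu i" and "v = pt u"
    note T = triple[OF r, folded x_def u_def, folded y_def v_def]
    note cu = comp_closed[OF T(1)] and cx = comp_closed[OF T(3)]
    have vn: "x < n" "y < n" "u < n" "v < n" using cu cx pt(1) by (auto simp: y_def v_def)
    have pts: "t 4 (t 3 x) = y" "t 4 (t 3 u) = v" using inp_pt[OF assms(1)] cu cx by (auto simp: y_def v_def)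
    have z: "t 12 x = 0" "t 12 y = 0" "t 12 u = 0" "t 12 v = 0" using J(3) T by auto
    have e: "t' = ev (incr 27) (ev block t)" using assms(2,3,6) r by (simp add: t'_def on_roots_def)
    have t': "t' 9 = (t 9)(t 26 0 := v)" "t' 12 = (t 12)(x := 1, y := 1, u := 1, v := 1)" "t' 26 0 = Suc (t 26 0)"
      "t' 28 = t 28" "t' 6 = (t 6)(x := 2, y := 4)" "t' 27 0 = Suc i"
      unfolding e using assms(4-6) pts by (auto simp: block_def push_def x_def u_def fun_eq_iff)
    have Rs: "R (Suc i) = insert i (R i)" using r by (simp add: R_Suc)
    have "search_inv (insert u (insert y (insert x (Blk i)))) (Rts (Suc i)) ((t 9)(t 26 0 := v))
      ((t 12)(x := 1, y := 1, u := 1, v := 1)) (Suc (t 26 0)) (t 28 0)"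
    proof (rule search_push)
      show "search_inv (insert u (insert y (insert x (Blk i)))) (Rts i) (t 9) ((t 12)(x := 1, y := 1, u := 1)) (t 26 0) (t 28 0)"
        using T vn z J(1)[unfolded search_st_def] by (intro search_block) auto
      show "((t 12)(x := 1, y := 1, u := 1)) v = 0" using z T by auto
      show "v \<in> Rts (Suc i) \<or> (\<exists>i<t 26 0. t 9 i \<in> N v)" by (auto simp: Rts_def Rs v_def u_def)
      show "Rts i \<subseteq> Rts (Suc i)" by (auto simp: Rts_def Rs)
    qed (use vn in auto)
    moreover have "insert u (insert y (insert x (Blk i))) = Blk (Suc i)" by (auto simp: Blk_def Rs x_def y_def u_def)
    ultimately have 1: "search_st (Blk (Suc i)) (Rts (Suc i)) t'" by (simp add: search_st_def t')
    have "y \<notin> fx ` R i"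
    proof
      assume "y \<in> fx ` R i"
      then obtain r' where "r' \<in> R i" "y = fx r'" by auto
      then show False using triple(4)[of r'] RD[of r'] T(8) by auto
    qed
    then have 2: "t' 6 = precol (Suc i)" unfolding t' J(2)
      using T(11) by (auto simp: precol_def Rs fun_eq_iff x_def[symmetric] y_def[symmetric])
    have 3: "t' 12 w = 0" if "pr w \<noteq> 0" "Suc i \<le> rt w" for w
      using J(3)[of w] that T by (auto simp: t')
    have 4: "t' 12 w \<noteq> 0" if "vis w \<noteq> 0" for w using J(4)[of w] that by (auto simp: t')
    have 5: "t' 12 (pt (fu r)) \<noteq> 0" if "r \<in> R (Suc i)" for r
      using J(5)[of r] that unfolding Rs t' by (auto simp: v_def u_def)
    show ?thesis using 1 2 3 4 5 t'(6) by blast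
  qed
  then show "search_st (Blk (Suc i)) (Rts (Suc i)) t'" "t' 6 = precol (Suc i)"
    "pr v \<noteq> 0 \<Longrightarrow> Suc i \<le> rt v \<Longrightarrow> t' 12 v = 0" "vis v \<noteq> 0 \<Longrightarrow> t' 12 v \<noteq> 0" "t' 27 0 = Suc i"
    "r \<in> R (Suc i) \<Longrightarrow> t' 12 (pt (fu r)) \<noteq> 0" by blast+
qed

abbreviation block_vars :: "nat set" where "block_vars \<equiv> {6, 9, 12, 20, 21, 26, 27, 33, 34}"

lemma block:
  assumes "inp s" "s 13 = pr" "s 14 = rt" "s 16 = fu" "s 17 = fx" "s 6 = (\<lambda>_. 0)"
    and "search_st {} good s" "\<And>v. pr v \<noteq> 0 \<Longrightarrow> s 12 v = 0"
  shows "runs (over_vertices (on_roots block)) s (3 + (6 + cost (on_roots block)) * (n + 1))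
    (\<lambda>t. same_except block_vars s t \<and> search_st (Blk n) (Rts n) t \<and> t 6 = precol n \<and> (\<forall>v. s 12 v \<noteq> 0 \<longrightarrow> t 12 v \<noteq> 0) \<and>
      (\<forall>r\<in>R n. t 12 (pt (fu r)) \<noteq> 0))"
proof -
  define J where "J i t \<longleftrightarrow> search_st (Blk i) (Rts i) t \<and> t 6 = precol i \<and> (\<forall>v. pr v \<noteq> 0 \<longrightarrow> i \<le> rt v \<longrightarrow> t 12 v = 0) \<and>
    (\<forall>v. s 12 v \<noteq> 0 \<longrightarrow> t 12 v \<noteq> 0) \<and> (\<forall>r\<in>R i. t 12 (pt (fu r)) \<noteq> 0)" for i and t :: store
  have "runs (over_vertices (on_roots block)) s (3 + (6 + cost (on_roots block)) * (n + 1)) (\<lambda>t. same_except block_vars s t \<and> J n t)"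
  proof (rule over_vertices)
    show "straight (on_roots block)" by (simp add: on_roots_def block_def push_def)
    show "writes (on_roots block) \<subseteq> block_vars" by (auto simp: on_roots_def block_def push_def)
    have "R 0 = {}" by (auto simp: R_def)
    then show "J 0 s" using assms by (simp add: J_def Blk_def Rts_def precol_def fun_eq_iff)
    show "J i u" if "J i t" "same_except {27} t u" for i t u
      using that by (simp add: J_def same_except_def search_st_def)
    fix i t assume t: "i < n" "t 27 0 = i" "J i t" "same_except block_vars s t" "inp t"
    have e: "t 13 = pr" "t 14 = rt" "t 16 = fu" "t 17 = fx" using t(4) assms by (auto simp: same_except_def)
    have j: "search_st (Blk i) (Rts i) t" "t 6 = precol i" "\<And>v. pr v \<noteq> 0 \<Longrightarrow> i \<le> rt v \<Longrightarrow> t 12 v = 0"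
      "\<And>v. s 12 v \<noteq> 0 \<Longrightarrow> t 12 v \<noteq> 0" "\<And>r. r \<in> R i \<Longrightarrow> t 12 (pt (fu r)) \<noteq> 0" using t(3) unfolding J_def by blast+
    show "J (Suc i) (ev (on_roots block) t) \<and> ev (on_roots block) t 27 0 = Suc i"
      using block_step[OF t(5) e t(2,1) j] unfolding J_def by blast
  qed (use assms in auto)
  then show ?thesis by (rule runs_weaken) (auto simp: J_def)
qed

text \<open>The vertices \<open>fu r\<close> are put behind all searched vertices and are therefore
  eliminated first. They lie in different components, so they are not adjacent and their mutual
  order is immaterial.\<close>

definition tail_inv :: "(nat \<Rightarrow> nat) \<Rightarrow> nat \<Rightarrow> nat \<Rightarrow> (nat \<Rightarrow> nat) \<Rightarrow> nat \<Rightarrow> bool" where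
  "tail_inv ord1 m1 i ord m \<longleftrightarrow> m1 \<le> m \<and> (\<forall>j<m1. ord j = ord1 j) \<and> inj_on ord {..<m} \<and> ord ` {m1..<m} = fu ` R i"

abbreviation tail_vars :: "nat set" where "tail_vars \<equiv> {9, 26, 27}"

lemma tail:
  assumes "inp s" "s 13 = pr" "s 14 = rt" "s 16 = fu" and inj: "inj_on (s 9) {..<s 26 0}"
    and fresh: "\<And>r. pr r \<noteq> 0 \<Longrightarrow> rt r = r \<Longrightarrow> fu r \<notin> s 9 ` {..<s 26 0}"
  shows "runs (over_vertices (on_roots append_u)) s (3 + (6 + cost (on_roots append_u)) * (n + 1))
    (\<lambda>t. same_except tail_vars s t \<and> tail_inv (s 9) (s 26 0) n (t 9) (t 26 0))"
proof (rule over_vertices[where J = "\<lambda>i t. tail_inv (s 9) (s 26 0) i (t 9) (t 26 0)"])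
  show "straight (on_roots append_u)" by (simp add: on_roots_def append_u_def)
  show "writes (on_roots append_u) \<subseteq> tail_vars" by (auto simp: on_roots_def append_u_def)
  have "R 0 = {}" by (auto simp: R_def)
  then show "tail_inv (s 9) (s 26 0) 0 (s 9) (s 26 0)" using inj by (simp add: tail_inv_def)
  show "tail_inv (s 9) (s 26 0) i (u 9) (u 26 0)" if "tail_inv (s 9) (s 26 0) i (t 9) (t 26 0)" "same_except {27} t u" for i t u
    using that by (simp add: same_except_def)
  fix i t assume t: "i < n" "t 27 0 = i" "tail_inv (s 9) (s 26 0) i (t 9) (t 26 0)" "same_except tail_vars s t" "inp t"
  have e: "t 13 = pr" "t 14 = rt" "t 16 = fu" using t(4) assms by (auto simp: same_except_def)
  define t' where "t' = ev (on_roots append_u) t"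
  define m where "m = t 26 0"
  have "tail_inv (s 9) (s 26 0) (Suc i) (t' 9) (t' 26 0) \<and> t' 27 0 = Suc i"
  proof (cases "pr i \<noteq> 0 \<and> rt i = i")
    case False
    then have "t' = ev (incr 27) t" using e t(2) by (auto simp: t'_def on_roots_def)
    then have "t' 9 = t 9" "t' 26 = t 26" "t' 27 0 = Suc i" using t(2) by simp_all
    moreover have "R (Suc i) = R i" using False by (auto simp: R_Suc)
    ultimately show ?thesis using t(3) by (simp add: tail_inv_def)
  next
    case True
    then have "t' = ev (incr 27) (ev append_u t)" using e t(2) by (simp add: t'_def on_roots_def)
    then have t': "t' 9 = (t 9)(m := fu i)" "t' 26 0 = Suc m" "t' 27 0 = Suc i"
      using e t(2) by (simp_all add: append_u_def m_def fun_eq_iff)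
    note tr = t(3)[unfolded tail_inv_def, folded m_def]
    have Rs: "R (Suc i) = insert i (R i)" using True by (simp add: R_Suc)
    have "fu i \<notin> fu ` R i"
    proof
      assume "fu i \<in> fu ` R i"
      then obtain r' where "r' \<in> R i" "fu i = fu r'" by auto
      then show False using triple(2)[of i] triple(2)[of r'] True RD[of r' i] by (metis less_irrefl)
    qed
    moreover have sp: "{..<m} = {..<s 26 0} \<union> {s 26 0..<m}" using tr by auto
    then have "t 9 ` {..<m} = s 9 ` {..<s 26 0} \<union> fu ` R i"
      unfolding sp image_Un using tr by (auto intro!: image_cong arg_cong2[where f = "(\<union>)"])
    ultimately have nw: "fu i \<notin> t 9 ` {..<m}" using fresh[of i] True by auto
    have im: "(t 9)(m := fu i) ` {..<m} = t 9 ` {..<m}" "(t 9)(m := fu i) ` {s 26 0..<m} = t 9 ` {s 26 0..<m}"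
      by (intro image_cong; simp)+
    have "inj_on ((t 9)(m := fu i)) {..<m}" using tr by (auto simp: inj_on_def)
    then have "inj_on ((t 9)(m := fu i)) {..<Suc m}" unfolding lessThan_Suc inj_on_insert using nw im(1) by auto
    moreover have sp2: "{s 26 0..<Suc m} = insert m {s 26 0..<m}" using tr by auto
    have "(t 9)(m := fu i) ` {s 26 0..<Suc m} = fu ` R (Suc i)"
      unfolding Rs sp2 image_insert im(2) fun_upd_same using tr by simp
    moreover have "\<forall>j<s 26 0. ((t 9)(m := fu i)) j = s 9 j" using tr by auto
    ultimately show ?thesis using tr unfolding t' tail_inv_def by auto
  qed
  then show "tail_inv (s 9) (s 26 0) (Suc i) (ev (on_roots append_u) t 9) (ev (on_roots append_u) t 26 0) \<and>
    ev (on_roots append_u) t 27 0 = Suc i" by (simp add: t'_def)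
qed (use assms in auto)

end

definition finish_cost :: nat where
  "finish_cost = 30 + cost (on_roots block) + cost search_body + cost (on_roots append_u) + engine_cost 5 False"

definition matching_cost :: nat where
  "matching_cost = 100 + cost roots_body + cost search_body + 2 * cost pair_body + cost scan_body + finish_cost"

context pair_triples begin

lemma pr_lt: "pr v \<noteq> 0 \<Longrightarrow> v < n" using comp_closed(7) .

lemma R_n: "pr r \<noteq> 0 \<Longrightarrow> rt r = r \<Longrightarrow> r \<in> R n" using pr_lt by (simp add: R_def)

lemma root_of: "pr v \<noteq> 0 \<Longrightarrow> pr (rt v) \<noteq> 0 \<and> rt (rt v) = rt v \<and> rt v \<in> R n"
  using pair_invD(7,8)[OF I] R_n by blast

lemma Blk_rt:
  assumes "v \<in> Blk n"
  shows "pr v \<noteq> 0" "rt v \<in> R n" "v \<in> {fx (rt v), pt (fx (rt v)), fu (rt v)}"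
proof -
  obtain r where r: "r \<in> R n" "v \<in> {fx r, pt (fx r), fu r}" using assms by (auto simp: Blk_def)
  note T = triple[of r] and rD = RD[OF r(1)]
  have "pr v \<noteq> 0 \<and> rt v = r" using r(2) T rD by auto
  then show "pr v \<noteq> 0" "rt v \<in> R n" "v \<in> {fx (rt v), pt (fx (rt v)), fu (rt v)}" using r by auto
qed

lemma precol_values: "precol n v \<in> {0, 2, 4}" by (simp add: precol_def)

text \<open>The precolored vertices belonging to a root lie in its component, so the root
  \<open>rt v\<close> alone decides the color of \<open>v\<close>.\<close>

lemma precol_zero:
  assumes "pr v \<noteq> 0"
  shows "precol n v = (if v = fx (rt v) then 2 else if v = pt (fx (rt v)) then 4 else 0)"
proof -
  note ro = root_of[OF assms]
  have "v \<in> fx ` R n \<longleftrightarrow> v = fx (rt v)"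
  proof
    assume "v \<in> fx ` R n"
    then obtain r where r: "r \<in> R n" "v = fx r" by auto
    then have "rt v = r" using triple(4)[of r] RD[OF r(1)] by simp
    then show "v = fx (rt v)" using r(2) by (simp only:)
  qed (use ro in blast)
  moreover have "v \<in> (\<lambda>r. pt (fx r)) ` R n \<longleftrightarrow> v = pt (fx (rt v))"
  proof
    assume "v \<in> (\<lambda>r. pt (fx r)) ` R n"
    then obtain r where r: "r \<in> R n" "v = pt (fx r)" by auto
    then have "rt v = r" using triple(8)[of r] RD[OF r(1)] by simp
    then show "v = pt (fx (rt v))" using r(2) by (simp only:)
  qed (use ro in blast)
  ultimately show ?thesis by (simp only: precol_def)
qed

lemma precol_pr: "precol n v \<noteq> 0 \<Longrightarrow> pr v \<noteq> 0"
proof -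
  assume "precol n v \<noteq> 0"
  then have "v \<in> Blk n" by (auto simp: precol_def Blk_def split: if_splits)
  then show ?thesis by (rule Blk_rt)
qed

lemma precol_Blk: "v \<notin> Blk n \<Longrightarrow> precol n v = 0"
  by (auto simp: precol_def Blk_def)

lemma precol_fu:
  assumes "r \<in> R n" shows "precol n (fu r) = 0"
proof -
  have r: "pr r \<noteq> 0" "rt r = r" using RD[OF assms] by auto
  note T = triple[OF r]
  show ?thesis using precol_zero[OF T(1)] unfolding T(2) using T(12,13) by simp
qed

text \<open>In the finished search every queued vertex has been expanded, so being visited is
  constant along the edges between vertices that were not removed. Connectedness carries it from the
  start \<open>pt (fu r)\<close> through the component.\<close>

lemma all_visited:
  assumes S: "search_st (Blk n) (Rts n) t" "t 28 0 = t 26 0"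
    and vis: "\<And>v. v < n \<Longrightarrow> pr v = 0 \<Longrightarrow> t 12 v \<noteq> 0" "\<And>r. r \<in> R n \<Longrightarrow> t 12 (pt (fu r)) \<noteq> 0"
    and v: "v < n"
  shows "t 12 v \<noteq> 0"
proof (cases "pr v = 0")
  case True
  then show ?thesis using vis(1) v by blast
next
  case False
  define r where "r = rt v"
  have r: "pr r \<noteq> 0" "rt r = r" "r \<in> R n" using root_of[OF False] by (auto simp: r_def)
  note D = search_invD[OF S(1)[unfolded search_st_def]]
  have exp: "t 12 b \<noteq> 0" if a: "pr a \<noteq> 0" "rt a = r" "a \<notin> {fx r, pt (fx r), fu r}" "t 12 a \<noteq> 0" "b \<in> N a" for a b
  proof -
    have "a \<notin> Blk n" using Blk_rt(3)[of a] a(2,3) by auto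
    then obtain j where "j < t 26 0" "a = t 9 j" using D(6)[OF pr_lt[OF a(1)]] a(4) by auto
    then show ?thesis using D(7)[of j b] S(2) a(5) by simp
  qed
  show ?thesis
  proof (cases "v \<in> {fx r, pt (fx r), fu r}")
    case True
    then have "v \<in> Blk n" using r(3) by (auto simp: Blk_def)
    then show ?thesis using D(6)[OF v] by blast
  next
    case False
    have T: "comp_triple pr rt lu r (fu r) (fx r)" "pr (lu r) < pr (fu r) \<or> late_independent pr rt lu r n"
      using triples r unfolding scan_inv_def by blast+
    have "(t 12 v \<noteq> 0) = (t 12 (pt (fu r)) \<noteq> 0)"
    proof (rule comp_connected(1)[OF r(1,2) T, where P = "\<lambda>z. t 12 z \<noteq> 0"])
      fix a b
      assume a: "pr a \<noteq> 0" "rt a = r" "b \<in> N a" "a \<notin> {fx r, pt (fx r), fu r}" "b \<notin> {fx r, pt (fx r), fu r}"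
      have b: "pr b \<noteq> 0" "rt b = r" "a \<in> N b" using comp_closed(1)[OF a(1,3)] a(2) nb[OF pr_lt[OF a(1)] a(3)] by auto
      show "(t 12 a \<noteq> 0) = (t 12 b \<noteq> 0)" using exp[OF a(1,2,4) _ a(3)] exp[OF b(1,2) a(5) _ b(3)] by blast
    qed (use \<open>pr v \<noteq> 0\<close> False in \<open>auto simp: r_def\<close>)
    then show ?thesis using vis(2)[OF r(3)] by blast
  qed
qed

text \<open>This establishes the hypotheses of \<open>matching_elim_ok\<close>. A searched vertex is
  good, has a neighbor at an earlier position, or is the partner of a vertex in the tail. Precolored
  vertices come as complete matching edges, so an uncolored vertex never has a colored
  partner.\<close>

lemma final_order:
  assumes S: "search_inv (Blk n) (Rts n) ord1 vis m1 h" and all: "\<And>v. v < n \<Longrightarrow> vis v \<noteq> 0"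
    and T: "tail_inv ord1 m1 n ord m"
  shows "order_ok 5 ord m (precol n)"
    and "(\<And>i. i < m \<Longrightarrow> elim_spec 5 False ord m (precol n) a b i) \<Longrightarrow> i < m \<Longrightarrow> elim_ok 5 ord m (precol n) a b i"
proof -
  note D = search_invD[OF S]
  have m1: "m1 \<le> m" and o1: "\<And>j. j < m1 \<Longrightarrow> ord j = ord1 j" and inj: "inj_on ord {..<m}"
    and tl: "ord ` {m1..<m} = fu ` R n" using T by (auto simp: tail_inv_def)
  have hd: "ord ` {..<m1} = ord1 ` {..<m1}" using o1 by (intro image_cong) auto
  have cls: "v \<in> ord ` {..<m1} \<or> v \<in> Blk n" if "v < n" for v using D(6)[OF that] all[OF that] hd by blast
  have hB: "ord j \<notin> Blk n" if "j < m1" for j using D(4)[OF that] o1[OF that] by simp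
  have tlD: "\<exists>r\<in>R n. ord j = fu r" if "m1 \<le> j" "j < m" for j using tl imageI[of j "{m1..<m}" ord] that by auto
  have dom: "ord j < n" "precol n (ord j) = 0" if j: "j < m" for j
  proof -
    have "ord j < n \<and> precol n (ord j) = 0"
    proof (cases "j < m1")
      case True
      then show ?thesis using D(3)[OF True] o1[OF True] hB[OF True] precol_Blk by simp
    next
      case False
      then obtain r where r: "r \<in> R n" "ord j = fu r" using tlD[of j] j by auto
      then show ?thesis using precol_fu[OF r(1)] pr_lt triple(1)[of r] RD[OF r(1)] by simp
    qed
    then show "ord j < n" "precol n (ord j) = 0" by auto
  qed
  have cov: "v \<in> ord ` {..<m}" if v: "v < n" "precol n v = 0" for v
  proof (cases "v \<in> ord ` {..<m1}")
    case True
    then show ?thesis using m1 by auto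
  next
    case False
    then have B: "v \<in> Blk n" using cls[OF v(1)] by blast
    note br = Blk_rt[OF B]
    have "v = fu (rt v)" using br(3) precol_zero[OF br(1)] v(2) by (auto split: if_splits)
    then have "v \<in> ord ` {m1..<m}" unfolding tl using br(2) by blast
    then show ?thesis by auto
  qed
  have pre: "precol n (pt v) = 0" if v: "v < n" "mt v" "precol n v = 0" for v
  proof (rule ccontr)
    assume c: "precol n (pt v) \<noteq> 0"
    have p: "pr (pt v) \<noteq> 0" using precol_pr[OF c] .
    note cp = comp_closed[OF p]
    have pv: "pt (pt v) = v" using pt(5)[OF v(1,2)] .
    have "pr v \<noteq> 0" "rt v = rt (pt v)" using cp(2,3) p unfolding pv by auto
    define r where "r = rt v"
    have r: "pr r \<noteq> 0" "rt r = r" using root_of[OF \<open>pr v \<noteq> 0\<close>] by (auto simp: r_def)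
    have fx2: "pt (pt (fx r)) = fx r" using comp_closed(6)[OF triple(3)[OF r]] .
    have "pt v = fx r \<or> pt v = pt (fx r)"
      using c precol_zero[OF p] \<open>rt v = rt (pt v)\<close> by (auto simp: r_def split: if_splits)
    then have "v = pt (fx r) \<or> v = fx r" using pv fx2 by metis
    then show False using v(3) precol_zero[OF \<open>pr v \<noteq> 0\<close>] by (auto simp: r_def split: if_splits)
  qed
  have rootc: "ord i \<in> good \<or> (\<exists>j<i. ord j \<in> N (ord i)) \<or> pt (ord i) \<in> ord ` {m1..<m}" if i: "i < m1" for i
  proof -
    consider "ord1 i \<in> good" | r where "r \<in> R n" "ord1 i = pt (fu r)" | j where "j < i" "ord1 j \<in> N (ord1 i)"
      using D(5)[OF i] by (auto simp: Rts_def)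
    then show ?thesis
    proof cases
      case 2
      then have "pt (ord i) = fu r" using o1[OF i] comp_closed(6)[OF triple(1)[of r]] RD[of r n] by simp
      then show ?thesis unfolding tl using 2(1) by auto
    next
      case 3
      then show ?thesis using o1[OF i] o1[of j] i by auto
    qed (use o1[OF i] in simp)
  qed
  have sp: "mt (ord i) \<and> pt (ord i) \<in> ord ` {..<m1}" "\<exists>x\<in>N (ord i). precol n x = 2"
    "w \<in> N (ord i) \<Longrightarrow> precol n w \<in> {0, 2, 4} \<and> w \<notin> ord ` {m1..<m}" if i: "m1 \<le> i" "i < m" for i w
  proof -
    obtain r where r: "r \<in> R n" "ord i = fu r" using tlD[OF i] by auto
    have r': "pr r \<noteq> 0" "rt r = r" using RD[OF r(1)] by auto
    note T = triple[OF r'] and cu = comp_closed[OF triple(1)[OF r']]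
    have "pt (fu r) \<notin> Blk n"
    proof
      assume B: "pt (fu r) \<in> Blk n"
      have "pt (fu r) \<in> {fx r, pt (fx r), fu r}" using Blk_rt(3)[OF B] unfolding T(10) .
      then show False using T(14) by blast
    qed
    moreover have "pt (fu r) < n" using pr_lt[of "pt (fu r)"] T(1,9) by simp
    ultimately show "mt (ord i) \<and> pt (ord i) \<in> ord ` {..<m1}" using cls[of "pt (fu r)"] cu(8) r(2) by simp
    have "precol n (fx r) = 2" using precol_zero[OF T(3)] unfolding T(4) by simp
    then show "\<exists>x\<in>N (ord i). precol n x = 2" using T(5) r(2) by auto
    show "precol n w \<in> {0, 2, 4} \<and> w \<notin> ord ` {m1..<m}" if w: "w \<in> N (ord i)"
    proof
      have wr: "rt w = r" "w \<noteq> fu r" using cu(1)[of w] nb[OF cu(7), of w] w T(2) by (auto simp: r(2))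
      show "w \<notin> ord ` {m1..<m}" unfolding tl
      proof
        assume "w \<in> fu ` R n"
        then obtain r2 where r2: "r2 \<in> R n" "w = fu r2" by auto
        then have "r2 = r" using triple(2)[of r2] RD[OF r2(1)] wr(1) by simp
        then show False using r2(2) wr(2) by simp
      qed
    qed (rule precol_values)
  qed
  have comp: "compat (w \<in> B v) (precol n v) (precol n w)"
    if v: "v < n" "w \<in> N v" "precol n v \<noteq> 0" "precol n w \<noteq> 0" for v w
  proof -
    have p: "pr v \<noteq> 0" "pr w \<noteq> 0" using precol_pr v by auto
    have "rt w = rt v" "v \<noteq> w" using comp_closed(1)[OF p(1) v(2)] nb[OF v(1,2)] by auto
    then have "precol n v = 2 \<and> precol n w = 4 \<or> precol n v = 4 \<and> precol n w = 2"
      using precol_zero[OF p(1)] precol_zero[OF p(2)] v(3,4) by (auto split: if_splits)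
    then show ?thesis by (auto simp: compat_def)
  qed
  have le: "precol n v \<le> 5" for v using precol_values[of v] by auto
  have nz: "precol n v = 0 \<longleftrightarrow> v \<in> ord ` {..<m}" if "v < n" for v using cov[OF that] dom(2) by auto
  show "order_ok 5 ord m (precol n)" unfolding order_ok_def
    by (intro conjI allI impI ballI) (rule inj, erule dom(1), rule le, erule nz, elim conjE, rule comp)
  show "elim_ok 5 ord m (precol n) a b i"
    if "\<And>i. i < m \<Longrightarrow> elim_spec 5 False ord m (precol n) a b i" "i < m"
    by (rule matching_elim_ok[OF inj m1 dom cov pre rootc sp(1,2) sp(3) that])
qed

lemma finish:
  assumes t: "inp t" "t 13 = pr" "t 14 = rt" "t 16 = fu" "t 17 = fx" "t 6 = (\<lambda>_. 0)" "t 7 = (\<lambda>_. 0)"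
    and s: "search_st {} good t" and v0: "\<And>v. pr v \<noteq> 0 \<Longrightarrow> t 12 v = 0" and v1: "\<And>v. v < n \<Longrightarrow> pr v = 0 \<Longrightarrow> t 12 v \<noteq> 0"
  shows "runs (Seq (over_vertices (on_roots block)) (Seq search (Seq (over_vertices (on_roots append_u)) (engine 5 False)))) t
    (finish_cost * (n + 1)) (good_output 5)"
proof -
  let ?p2 = "Seq (over_vertices (on_roots append_u)) (engine 5 False)" and ?c2 = "(3 + (6 + cost (on_roots append_u)) * (n + 1)) + engine_cost 5 False * (n + 1)"
  let ?p3 = "Seq search ?p2" and ?c3 = "(6 + cost search_body) * (n + 1) + ?c2"
  let ?p4 = "Seq (over_vertices (on_roots block)) ?p3"
  let ?P = "\<lambda>u. same_except block_vars t u \<and> search_st (Blk n) (Rts n) u \<and> u 6 = precol n \<and>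
    (\<forall>v. t 12 v \<noteq> 0 \<longrightarrow> u 12 v \<noteq> 0) \<and> (\<forall>r\<in>R n. u 12 (pt (fu r)) \<noteq> 0)"
  have "runs ?p4 t
    ((3 + (6 + cost (on_roots block)) * (n + 1)) + ?c3) (good_output 5)"
  proof (rule runs_Seq[where Q = ?P])
    show "runs (over_vertices (on_roots block)) t (3 + (6 + cost (on_roots block)) * (n + 1)) ?P"
      by (rule block[OF t(1-6) s v0])
    fix u assume u: "?P u"
    have iu: "inp u" using same_except_inp[of block_vars t u] u t(1) by auto
    have su: "search_st (Blk n) (Rts n) u" using u by blast
    let ?Q = "\<lambda>w. same_except search_vars u w \<and> search_st (Blk n) (Rts n) w \<and> w 28 0 = w 26 0 \<and> (\<forall>v. u 12 v \<noteq> 0 \<longrightarrow> w 12 v \<noteq> 0)"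
    show "runs ?p3 u
      ?c3 (good_output 5)"
    proof (rule runs_Seq[where Q = ?Q])
      show "runs search u ((6 + cost search_body) * (n + 1)) ?Q" by (rule search[OF iu su])
      fix w assume w: "?Q w"
      have iw: "inp w" using same_except_inp[of search_vars u w] w iu by auto
      have frw: "w k = t k" if "k \<notin> block_vars \<union> search_vars" for k
        using u w that unfolding same_except_def by auto
      have w6: "w 6 = precol n" using u w unfolding same_except_def by auto
      have sw: "search_st (Blk n) (Rts n) w" using w by blast
      have allv: "w 12 v \<noteq> 0" if "v < n" for v
      proof (rule all_visited[OF sw _ _ _ that])
        show "w 28 0 = w 26 0" using w by blast
        show "\<And>v. v < n \<Longrightarrow> pr v = 0 \<Longrightarrow> w 12 v \<noteq> 0" using v1 u w by blast
        show "\<And>r. r \<in> R n \<Longrightarrow> w 12 (pt (fu r)) \<noteq> 0" using u w by blast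
      qed
      note D = search_invD[OF sw[unfolded search_st_def]]
      let ?T = "\<lambda>x. same_except tail_vars w x \<and> tail_inv (w 9) (w 26 0) n (x 9) (x 26 0)"
      show "runs ?p2 w
        ?c2 (good_output 5)"
      proof (rule runs_Seq[where Q = ?T])
        show "runs (over_vertices (on_roots append_u)) w (3 + (6 + cost (on_roots append_u)) * (n + 1)) ?T"
        proof (rule tail[OF iw _ _ _ D(2)])
          show "w 13 = pr" "w 14 = rt" "w 16 = fu" using frw t by auto
          fix r assume r: "pr r \<noteq> 0" "rt r = r"
          then have "fu r \<in> Blk n" using R_n[OF r] by (auto simp: Blk_def)
          then show "fu r \<notin> w 9 ` {..<w 26 0}" using D(4) by auto
        qed
        fix x assume x: "?T x"
        have ix: "inp x" using same_except_inp[of tail_vars w x] x iw by auto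
        have tx: "tail_inv (w 9) (w 26 0) n (x 9) (x 26 0)" using x by blast
        have x67: "x 6 = precol n" "x 7 = (\<lambda>_. 0)" using x w6 frw[of 7] t(7) by (auto simp: same_except_def)
        note fo = final_order[OF sw[unfolded search_st_def] allv tx]
        show "runs (engine 5 False) x (engine_cost 5 False * (n + 1)) (good_output 5)"
          by (rule engine[OF ix refl x67 refl fo(1)]) (use fo(2) in auto)
      qed
    qed
  qed
  then show ?thesis by (rule runs_weaken) (simp_all add: finish_cost_def algebra_simps)
qed

end

context matching_lists begin

lemma matching_program:
  "runs matching_program (input_store lam adj hadj) (matching_cost * (n + 1)) (good_output 5)"
proof -
  let ?p4 = "Seq (over_vertices (on_roots block)) (Seq search (Seq (over_vertices (on_roots append_u)) (engine 5 False)))"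
  let ?p5 = "Seq (over_vertices scan_body) ?p4" and ?c5 = "(3 + (6 + cost scan_body) * (n + 1)) + finish_cost * (n + 1)"
  let ?p6 = "Seq pair_search ?p5" and ?c6 = "(3 + (15 + cost pair_body) * (2 * n + 1)) + ?c5"
  let ?p7 = "Seq search ?p6" and ?c7 = "(6 + cost search_body) * (n + 1) + ?c6"
  let ?s = "input_store lam adj hadj"
  have inp: "inp ?s" by (simp add: inp_def)
  have zero: "?s k = (\<lambda>_. 0)" if "5 \<le> k" for k using that by (auto simp: input_store_def)
  let ?P = "\<lambda>t. same_except roots_vars ?s t \<and> search_st {} good t \<and> (\<forall>v\<in>good. t 12 v \<noteq> 0)"
  have "runs matching_program ?s ((6 + cost roots_body) * (n + 1) + ?c7) (good_output 5)"
    unfolding matching_program_def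
  proof (rule runs_Seq[where Q = ?P])
    show "runs roots ?s ((6 + cost roots_body) * (n + 1)) ?P" by (rule roots[OF refl])
    fix t assume t: "?P t"
    have it: "inp t" using same_except_inp[of roots_vars ?s t] t inp by auto
    have st: "search_st {} good t" using t by blast
    let ?Q = "\<lambda>u. same_except search_vars t u \<and> search_st {} good u \<and> u 28 0 = u 26 0 \<and> (\<forall>v. t 12 v \<noteq> 0 \<longrightarrow> u 12 v \<noteq> 0)"
    show "runs ?p7 t
      ?c7 (good_output 5)"
    proof (rule runs_Seq[where Q = ?Q])
      show "runs search t ((6 + cost search_body) * (n + 1)) ?Q" by (rule search[OF it st])
      fix u assume u: "?Q u"
      have iu: "inp u" using same_except_inp[of search_vars t u] u it by auto
      have zu: "u k = (\<lambda>_. 0)" if "5 \<le> k" "k \<notin> search_vars \<union> roots_vars" for k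
        using t u that zero[of k] unfolding same_except_def by auto
      have su: "search_inv {} good (u 9) (u 12) (u 26 0) (u 28 0)" using u unfolding search_st_def by blast
      \<comment> \<open>The vertices missed by the first search are closed under adjacency and
        contain no good vertex; thus they form the 4-regular, perfectly matched components.\<close>
      define S where "S = {v. v < n \<and> u 12 v = 0}"
      have S: "v < n \<and> mt v \<and> length (adj ! v) = 4 \<and> N v \<subseteq> S" if v: "v \<in> S" for v
      proof -
        have vn: "v < n" "u 12 v = 0" using v by (auto simp: S_def)
        have "v \<notin> good" using t u vn(2) by blast
        then have "mt v" "length (adj ! v) = 4" using vn(1) deg[OF vn(1)] by (auto simp: good_def)
        moreover have "w \<in> S" if w: "w \<in> N v" for w
        proof (rule ccontr)
          assume "w \<notin> S"
          have wn: "w < n" "v \<in> N w" using nb[OF vn(1) w] by auto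
          then have "u 12 w \<noteq> 0" using \<open>w \<notin> S\<close> by (simp add: S_def)
          then obtain j where "j < u 26 0" "w = u 9 j" using search_invD(6)[OF su wn(1)] by auto
          then show False using search_invD(7)[OF su, of j v] u wn(2) vn(2) by simp
        qed
        ultimately show ?thesis using vn(1) by auto
      qed
      let ?T = "\<lambda>x. same_except pair_vars u x \<and> pair_inv S (x 13) (x 14) (x 15) (x 16) (x 17) (x 18) (x 32 0) (2 * x 32 0) \<and>
        (\<forall>v\<in>S. x 13 v \<noteq> 0)"
      show "runs ?p6 u
        ?c6 (good_output 5)"
      proof (rule runs_Seq[where Q = ?T])
        show "runs pair_search u (3 + (15 + cost pair_body) * (2 * n + 1)) ?T"
        proof (rule pair_search[OF iu])
          show "\<And>k. k \<in> {13, 14, 15, 16, 17, 18, 31, 32} \<Longrightarrow> u k = (\<lambda>_. 0)" using zu by auto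
          show "\<And>v. v \<in> S \<longleftrightarrow> v < n \<and> u 12 v = 0" by (simp add: S_def)
          show "\<And>v. v \<in> S \<Longrightarrow> mt v \<and> N v \<subseteq> S" using S by blast
        qed
        fix x assume x: "?T x"
        have ix: "inp x" using same_except_inp[of pair_vars u x] x iu by auto
        interpret pd: pair_done adj hadj lam S "x 13" "x 14" "x 15" "x 16" "x 17" "x 18" "x 32 0"
          by unfold_locales (use x S in blast)+
        let ?U = "\<lambda>y. same_except pd.scan_vars x y \<and> pd.scan_inv {} 0 n (y 16) (y 17)"
        show "runs ?p5 x
          ?c5 (good_output 5)"
        proof (rule runs_Seq[where Q = ?U])
          show "runs (over_vertices scan_body) x (3 + (6 + cost scan_body) * (n + 1)) ?U"
            by (rule pd.scan[OF ix refl refl refl refl refl])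
          fix y assume y: "?U y"
          have iy: "inp y" using same_except_inp[of pd.scan_vars x y] y ix by auto
          interpret pt: pair_triples adj hadj lam S "x 13" "x 14" "x 15" "x 16" "x 17" "x 18" "x 32 0" "y 16" "y 17"
            by unfold_locales (use y in blast)
          have fr: "y k = u k" if "k \<notin> pair_vars \<union> pd.scan_vars" for k using x y that unfolding same_except_def by auto
          show "runs ?p4 y
            (finish_cost * (n + 1)) (good_output 5)"
          proof (rule pt.finish[OF iy _ _ refl refl])
            show "y 13 = x 13" "y 14 = x 14" using y by (auto simp: same_except_def)
            show "y 6 = (\<lambda>_. 0)" "y 7 = (\<lambda>_. 0)" using fr zu by auto
            have "y 9 = u 9" "y 12 = u 12" "y 26 = u 26" "y 28 = u 28" using fr by auto
            then show "search_st {} good y" using su by (simp add: search_st_def)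
            show "y 12 v = 0" if "x 13 v \<noteq> 0" for v
              using pd.pr_S[OF that] \<open>y 12 = u 12\<close> by (simp add: S_def)
            show "y 12 v \<noteq> 0" if "v < n" "x 13 v = 0" for v
            proof
              assume "y 12 v = 0"
              then have "v \<in> S" using that(1) \<open>y 12 = u 12\<close> by (simp add: S_def)
              then show False using x that(2) by blast
            qed
          qed
        qed
      qed
    qed
  qed
  then show ?thesis by (rule runs_weaken) (simp_all add: matching_cost_def algebra_simps)
qed

end

section \<open>Graphs and adjacency lists\<close>

text \<open>A finite check. Colors two apart are sent to values exactly \<open>lam\<close> apart,
  and \<open>2 \<le> lam\<close> keeps all six values distinct.\<close>

lemma (in instance_lists) stretch_compat:
  assumes "2 \<le> lam" "c \<in> {1..6}" "d \<in> {1..6}" "compat h c d"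
  shows "stretch c \<noteq> stretch d" "h \<Longrightarrow> int lam \<le> \<bar>int (stretch c) - int (stretch d)\<bar>"
proof -
  have "c = 1 \<or> c = 2 \<or> c = 3 \<or> c = 4 \<or> c = 5 \<or> c = 6" "d = 1 \<or> d = 2 \<or> d = 3 \<or> d = 4 \<or> d = 5 \<or> d = 6"
    using assms by auto
  then show "stretch c \<noteq> stretch d" "h \<Longrightarrow> int lam \<le> \<bar>int (stretch c) - int (stretch d)\<bar>"
    using assms(1,4) by (elim disjE; simp add: stretch_def compat_def)+
qed

lemma (in instance_lists) stretch_range:
  assumes "2 \<le> lam" "c \<in> {1..K}" "K \<in> {5, 6}"
  shows "1 \<le> stretch c" "stretch c \<le> 2 * lam + (K - 4)"
  using assms by (auto simp: stretch_def)

lemma card_nb_le_degree: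
  assumes "finite (edges G)"
  shows "card {u. {v, u} \<in> edges G} \<le> degree G v"
proof -
  have "inj_on (\<lambda>u. {v, u}) {u. {v, u} \<in> edges G}" by (auto simp: inj_on_def doubleton_eq_iff)
  then have "card {u. {v, u} \<in> edges G} = card ((\<lambda>u. {v, u}) ` {u. {v, u} \<in> edges G})" by (simp add: card_image)
  also have "\<dots> \<le> degree G v" unfolding degree_def using assms by (intro card_mono) auto
  finally show ?thesis .
qed

lemma simple_graphD:
  assumes "simple_graph G"
  shows "finite (verts G)" "finite (edges G)" "{u, v} \<in> edges G \<Longrightarrow> u \<in> verts G \<and> v \<in> verts G \<and> u \<noteq> v"
proof -
  show fin: "finite (verts G)" using assms by (simp add: simple_graph_def)
  have "edges G \<subseteq> Pow (verts G)" using assms by (auto simp: simple_graph_def)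
  then show "finite (edges G)" using fin finite_subset by auto
  show "{u, v} \<in> edges G \<Longrightarrow> u \<in> verts G \<and> v \<in> verts G \<and> u \<noteq> v"
    using assms by (force simp: simple_graph_def)
qed

lemma degree_le_max_degree:
  assumes "simple_graph G" "v \<in> verts G"
  shows "degree G v \<le> max_degree G"
  unfolding max_degree_def using simple_graphD(1)[OF assms(1)] assms(2) by (intro Max_ge) auto

lemma degenerateD:
  assumes "degenerate d G" "S \<subseteq> verts G" "S \<noteq> {}"
  shows "\<exists>v\<in>S. degree (induced_subgraph G S) v \<le> d"
  using assms(1)[unfolded degenerate_def, THEN spec, of S] assms(2,3) by simp

lemma instance_listsI:
  assumes G: "simple_graph G" "max_degree G \<le> 4" and H: "verts H = verts G" "edges H \<subseteq> edges G"
    and adj: "adjacency_lists G adj" "adjacency_lists H hadj"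
  shows "instance_lists adj hadj"
proof
  have vG: "verts G = {..<length adj}" "verts H = {..<length hadj}" using adj by (auto simp: adjacency_lists_def)
  then show len: "length hadj = length adj" using H(1) by simp
  have N: "set (adj ! v) = {u. {v, u} \<in> edges G}" "set (hadj ! v) = {u. {v, u} \<in> edges H}"
    "distinct (adj ! v)" "distinct (hadj ! v)" if "v < length adj" for v
    using adj that len by (auto simp: adjacency_lists_def)
  fix v w assume v: "v < length adj"
  show "distinct (adj ! v)" "distinct (hadj ! v)" using N v by auto
  show "set (hadj ! v) \<subseteq> set (adj ! v)" using N v H(2) by auto
  have "length (adj ! v) = card {u. {v, u} \<in> edges G}" using N[OF v] by (metis distinct_card)
  also have "\<dots> \<le> 4" using card_nb_le_degree[OF simple_graphD(2)[OF G(1)], of v] degree_le_max_degree[OF G(1), of v] G(2) v vG by simp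
  finally show "length (adj ! v) \<le> 4" .
  show "w < length adj \<and> w \<noteq> v \<and> v \<in> set (adj ! w)" if "w \<in> set (adj ! v)"
  proof -
    have e: "{v, w} \<in> edges G" using that N[OF v] by simp
    then have "w < length adj" "w \<noteq> v" using simple_graphD(3)[OF G(1)] vG by auto
    then show ?thesis using N[of w] e by (simp add: insert_commute)
  qed
  show "v \<in> set (hadj ! w)" if "w \<in> set (hadj ! v)"
  proof -
    have e: "{v, w} \<in> edges H" using that N[OF v] by simp
    then have "w < length adj" using simple_graphD(3)[OF G(1), of v w] H(2) vG by auto
    then show ?thesis using N[of w] e by (simp add: insert_commute)
  qed
qed

lemma good_output_coloring:
  assumes G: "simple_graph G" "max_degree G \<le> 4" and H: "verts H = verts G" "edges H \<subseteq> edges G"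
    and adj: "adjacency_lists G adj" "adjacency_lists H hadj" and lam: "2 \<le> lam" and K: "K \<in> {5, 6}"
    and out: "instance_lists.good_output adj hadj lam K s"
  shows "backbone_k_coloring lam (2 * lam + (K - 4)) G H (s 5)"
proof -
  interpret instance_lists adj hadj lam by (rule instance_listsI[OF G H adj])
  obtain col where col: "\<And>v. v < n \<Longrightarrow> col v \<in> {1..K} \<and> s 5 v = stretch (col v) \<and>
     (\<forall>w\<in>N v. compat (w \<in> B v) (col v) (col w))"
    using out unfolding good_output_def by blast
  have vG: "verts G = {..<n}" using adj by (simp add: adjacency_lists_def)
  have "1 \<le> s 5 v" "s 5 v \<le> 2 * lam + (K - 4)" if "v \<in> verts G" for v
    using col[of v] stretch_range[OF lam, of "col v" K] K that vG by auto
  moreover have E: "s 5 u \<noteq> s 5 v \<and> ({u, v} \<in> edges H \<longrightarrow> int lam \<le> \<bar>int (s 5 u) - int (s 5 v)\<bar>)"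
    if "{u, v} \<in> edges G" for u v
  proof -
    have uv: "u < n" "v < n" using simple_graphD(3)[OF G(1) that] vG by auto
    have vN: "v \<in> N u" using that adj(1) uv by (auto simp: adjacency_lists_def)
    have vB: "v \<in> B u" if "{u, v} \<in> edges H" using that adj(2) uv len by (auto simp: adjacency_lists_def)
    have c: "col u \<in> {1..6}" "col v \<in> {1..6}" using col[of u] col[of v] uv K by auto
    have "compat (v \<in> B u) (col u) (col v)" using col[OF uv(1)] vN by blast
    from stretch_compat[OF lam c this] vB show ?thesis using col[of u] col[of v] uv by simp
  qed
  ultimately show ?thesis unfolding backbone_k_coloring_def backbone_coloring_def using H(2) by auto
qed

lemma matching_finds:
  assumes G: "simple_graph G" "max_degree G \<le> 4" and lam: "2 \<le> lam" and M: "matching G M"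
  shows "finds_coloring_in_time matching_program (\<lambda>n. matching_cost * (n + 1)) lam (2 * lam + 1) G (spanned_by G M)"
  unfolding finds_coloring_in_time_def
proof (intro allI impI)
  fix adjG adjH
  let ?H = "spanned_by G M"
  assume adj: "adjacency_lists G adjG \<and> adjacency_lists ?H adjH"
  have H: "verts ?H = verts G" "edges ?H \<subseteq> edges G" using M by (auto simp: spanned_by_def matching_def)
  interpret instance_lists adjG adjH lam by (rule instance_listsI[OF G H]) (use adj in auto)
  interpret matching_lists adjG adjH lam
  proof
    fix v assume v: "v < n"
    have B: "B v = {u. {v, u} \<in> M}" using adj v len by (auto simp: adjacency_lists_def spanned_by_def)
    have one: "u = w" if "u \<in> B v" "w \<in> B v" for u w
    proof (rule ccontr)
      assume "u \<noteq> w"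
      then have "{v, u} \<noteq> {v, w}" by (auto simp: doubleton_eq_iff)
      moreover have "pairwise disjnt M" "{v, u} \<in> M" "{v, w} \<in> M" using M that B by (auto simp: matching_def)
      ultimately have "disjnt {v, u} {v, w}" by (metis pairwiseD)
      then show False by (simp add: disjnt_def)
    qed
    then have "card (B v) \<le> Suc 0" by (subst card_le_Suc0_iff_eq) auto
    then show "length (adjH ! v) \<le> 1" using distinct_card[OF hdist[OF v]] by simp
  qed
  from matching_program obtain t s where e: "exec matching_program (input_store lam adjG adjH) t s"
    "t \<le> matching_cost * (n + 1)" "good_output 5 s" unfolding runs_def by blast
  have "backbone_k_coloring lam (2 * lam + (5 - 4)) G ?H (s 5)"
    by (rule good_output_coloring[OF G H _ _ lam _ e(3)]) (use adj in auto)
  moreover have "card (verts G) = n" using adj by (simp add: adjacency_lists_def)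
  ultimately show "\<exists>t s. exec matching_program (input_store lam adjG adjH) t s \<and> t \<le> matching_cost * (card (verts G) + 1) \<and>
      backbone_k_coloring lam (2 * lam + 1) G ?H (s 5)" using e by auto
qed

definition forest_cost :: nat where
  "forest_cost = 20 + 2 * cost peel_body + engine_cost 6 True"

lemma forest_finds:
  assumes G: "simple_graph G" "max_degree G \<le> 4" and lam: "2 \<le> lam"
    and sp: "spanning_subgraph H G" and dg: "degenerate 1 H"
  shows "finds_coloring_in_time forest_program (\<lambda>n. forest_cost * (n + 1)) lam (2 * lam + 2) G H"
  unfolding finds_coloring_in_time_def
proof (intro allI impI)
  fix adjG adjH
  assume adj: "adjacency_lists G adjG \<and> adjacency_lists H adjH"
  have H: "verts H = verts G" "edges H \<subseteq> edges G" using sp by (auto simp: spanning_subgraph_def)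
  interpret instance_lists adjG adjH lam by (rule instance_listsI[OF G H]) (use adj in auto)
  have vG: "verts G = {..<n}" using adj by (simp add: adjacency_lists_def)
  have "\<exists>v\<in>S. card (B v \<inter> S) \<le> 1" if S: "S \<subseteq> {..<n}" "S \<noteq> {}" for S
  proof -
    have "S \<subseteq> verts H" using S H(1) vG by simp
    then obtain v where v: "v \<in> S" "degree (induced_subgraph H S) v \<le> 1"
      using degenerateD[OF dg _ S(2)] by blast
    have fin: "finite (edges (induced_subgraph H S))"
      using simple_graphD(2)[OF G(1)] H(2) by (auto simp: induced_subgraph_def intro: finite_subset)
    have "B v \<inter> S = {u. {v, u} \<in> edges (induced_subgraph H S)}"
      using adj v(1) S(1) len by (auto simp: adjacency_lists_def induced_subgraph_def)
    then have "card (B v \<inter> S) \<le> 1" using card_nb_le_degree[OF fin, of v] v(2) by simp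
    then show ?thesis using v(1) by blast
  qed
  from forest_program[OF this] obtain t s where e: "exec forest_program (input_store lam adjG adjH) t s"
    "t \<le> forest_cost * (n + 1)" "good_output 6 s" unfolding runs_def forest_cost_def by blast
  have "backbone_k_coloring lam (2 * lam + (6 - 4)) G H (s 5)"
    by (rule good_output_coloring[OF G H _ _ lam _ e(3)]) (use adj in auto)
  moreover have "card (verts G) = n" using vG by simp
  ultimately show "\<exists>t s. exec forest_program (input_store lam adjG adjH) t s \<and> t \<le> forest_cost * (card (verts G) + 1) \<and>
      backbone_k_coloring lam (2 * lam + 2) G H (s 5)" using e by auto
qed

lemma exists_adjacency_lists:
  assumes "finite (edges G)" "verts G = {..<n}"
  shows "\<exists>adj. adjacency_lists (G :: nat ugraph) adj"
proof -
  have "finite {u. {v, u} \<in> edges G}" for v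
  proof -
    have "inj_on (\<lambda>u. {v, u}) {u. {v, u} \<in> edges G}" by (auto simp: inj_on_def doubleton_eq_iff)
    moreover have "(\<lambda>u. {v, u}) ` {u. {v, u} \<in> edges G} \<subseteq> edges G" by auto
    ultimately show ?thesis using assms(1) finite_subset finite_imageD by metis
  qed
  then show ?thesis using assms(2)
    by (intro exI[of _ "map (\<lambda>v. sorted_list_of_set {u. {v, u} \<in> edges G}) [0..<n]"]) (simp add: adjacency_lists_def)
qed

text \<open>The bounds on \<open>BBC\<close> are read off from the programs: a graph on
  \<open>{..<n}\<close> has adjacency lists, and the output for them is a coloring.\<close>

lemma finds_coloring_exists:
  assumes "finds_coloring_in_time p T lam k G H" "simple_graph G" "verts G = {..<n}" "verts H = verts G" "edges H \<subseteq> edges G"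
  shows "\<exists>c. backbone_k_coloring lam k G H c"
proof -
  have "finite (edges H)" using simple_graphD(2)[OF assms(2)] assms(5) finite_subset by blast
  then obtain adjG adjH where "adjacency_lists G adjG" "adjacency_lists H adjH"
    using exists_adjacency_lists simple_graphD(2)[OF assms(2)] assms(3,4) by metis
  then show ?thesis using assms(1) unfolding finds_coloring_in_time_def by blast
qed

section \<open>Transfer to graphs with arbitrary vertices\<close>

definition relabel :: "('a \<Rightarrow> nat) \<Rightarrow> 'a ugraph \<Rightarrow> nat ugraph" where
  "relabel f G = \<lparr>verts = f ` verts G, edges = (`) f ` edges G\<rparr>"

context
  fixes f :: "'a \<Rightarrow> nat" and G :: "'a ugraph"
  assumes G: "simple_graph G" and f: "inj_on f (verts G)"
begin

lemma relabel_mem: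
  assumes "e \<in> edges G" "v \<in> verts G"
  shows "f v \<in> f ` e \<longleftrightarrow> v \<in> e"
  using assms G f by (intro inj_on_image_mem_iff[of f "verts G"]) (auto simp: simple_graph_def)

lemma simple_relabel: "simple_graph (relabel f G)"
  using G f unfolding simple_graph_def relabel_def
  by (auto simp: card_image inj_on_subset)

text \<open>The set \<open>E'\<close> of image edges is kept arbitrary for two uses: all edges, for
  the maximum degree, and the edges inside a vertex set, for degeneracy.\<close>

lemma degree_relabel:
  assumes "E \<subseteq> edges G" "v \<in> verts G" "E' \<subseteq> (`) f ` E"
  shows "card {e \<in> E'. f v \<in> e} \<le> card {e \<in> E. v \<in> e \<and> f ` e \<in> E'}"
proof -
  have fin: "finite E" using simple_graphD(2)[OF G] assms(1) finite_subset by blast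
  have "{e \<in> E'. f v \<in> e} \<subseteq> (`) f ` {e \<in> E. v \<in> e \<and> f ` e \<in> E'}"
  proof
    fix e assume "e \<in> {e \<in> E'. f v \<in> e}"
    then have e: "e \<in> E'" "f v \<in> e" by auto
    then obtain d where d: "d \<in> E" "e = f ` d" using assms(3) by auto
    then have "v \<in> d" using relabel_mem[of d v] e(2) assms(1,2) by auto
    then show "e \<in> (`) f ` {e \<in> E. v \<in> e \<and> f ` e \<in> E'}" using d e(1) by auto
  qed
  then have "card {e \<in> E'. f v \<in> e} \<le> card ((`) f ` {e \<in> E. v \<in> e \<and> f ` e \<in> E'})"
    using fin by (intro card_mono) auto
  also have "\<dots> \<le> card {e \<in> E. v \<in> e \<and> f ` e \<in> E'}" using fin by (intro card_image_le) auto
  finally show ?thesis .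
qed

lemma max_degree_relabel: "max_degree (relabel f G) \<le> max_degree G"
proof -
  have "degree (relabel f G) (f v) \<le> max_degree G" if v: "v \<in> verts G" for v
  proof -
    have "degree (relabel f G) (f v) \<le> card {e \<in> edges G. v \<in> e \<and> f ` e \<in> (`) f ` edges G}"
      unfolding degree_def relabel_def ugraph.simps by (rule degree_relabel[OF order_refl v order_refl])
    also have "\<dots> \<le> degree G v" unfolding degree_def using simple_graphD(2)[OF G] by (intro card_mono) auto
    also have "\<dots> \<le> max_degree G" by (rule degree_le_max_degree[OF G v])
    finally show ?thesis .
  qed
  then show ?thesis unfolding max_degree_def[of "relabel f G"] using simple_graphD(1)[OF G]
    by (intro Max.boundedI) (auto simp: relabel_def)
qed

lemma degenerate_relabel:
  assumes H: "verts H = verts G" "edges H \<subseteq> edges G" "degenerate d H"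
  shows "degenerate d (relabel f H)"
  unfolding degenerate_def
proof (intro allI impI)
  fix S assume S: "S \<subseteq> verts (relabel f H) \<and> S \<noteq> {}"
  define T where "T = {v \<in> verts G. f v \<in> S}"
  have fT: "f ` T = S" using S H(1) by (auto simp: T_def relabel_def)
  have "T \<subseteq> verts H" "T \<noteq> {}" using fT S H(1) by (auto simp: T_def)
  then obtain v where v: "v \<in> T" "degree (induced_subgraph H T) v \<le> d"
    using degenerateD[OF H(3)] by blast
  have vG: "v \<in> verts G" using v by (simp add: T_def)
  have E: "edges (induced_subgraph (relabel f H) S) \<subseteq> (`) f ` edges H"
    by (auto simp: induced_subgraph_def relabel_def)
  have "degree (induced_subgraph (relabel f H) S) (f v) \<le>
      card {e \<in> edges H. v \<in> e \<and> f ` e \<in> edges (induced_subgraph (relabel f H) S)}"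
    unfolding degree_def by (rule degree_relabel[OF H(2) vG E])
  also have "\<dots> \<le> degree (induced_subgraph H T) v"
  proof -
    have "e \<subseteq> T" if "e \<in> edges H" "f ` e \<subseteq> S" for e
      using that H(2) G by (auto simp: T_def simple_graph_def)
    moreover have "finite (edges H)" using simple_graphD(2)[OF G] H(2) finite_subset by blast
    ultimately show ?thesis unfolding degree_def induced_subgraph_def by (intro card_mono) auto
  qed
  finally have "degree (induced_subgraph (relabel f H) S) (f v) \<le> d" using v(2) by simp
  moreover have "f v \<in> S" using v(1) by (simp add: T_def)
  ultimately show "\<exists>v\<in>S. degree (induced_subgraph (relabel f H) S) v \<le> d" by blast
qed

lemma matching_relabel:
  assumes "matching G M"
  shows "matching (relabel f G) ((`) f ` M)"
proof -
  have "disjnt (f ` e) (f ` e')" if "e \<in> M" "e' \<in> M" "f ` e \<noteq> f ` e'" for e e'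
  proof -
    have sub: "e \<subseteq> verts G" "e' \<subseteq> verts G" using assms that G by (auto simp: matching_def simple_graph_def)
    have "e \<noteq> e'" using that by auto
    moreover have "pairwise disjnt M" using assms by (simp add: matching_def)
    ultimately have "disjnt e e'" using that(1,2) by (metis pairwiseD)
    then show ?thesis by (simp add: disjnt_def inj_on_image_Int[OF f sub, symmetric])
  qed
  then show ?thesis using assms by (auto simp: matching_def relabel_def pairwise_def)
qed

lemma coloring_relabel:
  assumes "verts H = verts G" "backbone_k_coloring lam k (relabel f G) (relabel f H) c"
  shows "backbone_k_coloring lam k G H (c \<circ> f)"
proof -
  have E: "{f u, f v} \<in> edges (relabel f X)" if "{u, v} \<in> edges X" for u v and X :: "'a ugraph"
    using imageI[OF that, of "(`) f"] by (simp add: relabel_def)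
  show ?thesis using assms E unfolding backbone_k_coloring_def backbone_coloring_def
    by (auto simp: relabel_def)
qed

end

lemma BBC_le: "backbone_k_coloring lam k G H c \<Longrightarrow> BBC lam G H \<le> k"
  unfolding BBC_def by (rule Least_le) blast

text \<open>For \<open>n \<ge> 1\<close> one has \<open>n + 1 \<le> 2 * n\<close>, whence the
  constant \<open>2 * C\<close>.\<close>

lemma linear_in_bigo: "(\<lambda>n. real (C * (n + 1))) \<in> O(\<lambda>n. real n)"
proof (rule bigoI)
  show "\<forall>\<^sub>F n in sequentially. norm (real (C * (n + 1))) \<le> real (2 * C) * norm (real n)"
  proof (rule eventually_sequentiallyI[of 1])
    fix n :: nat assume "1 \<le> n"
    then have "C * (n + 1) \<le> C * (2 * n)" by (intro mult_left_mono) auto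
    then have "real (C * (n + 1)) \<le> real (2 * C * n)" unfolding of_nat_le_iff by (simp add: algebra_simps)
    then show "norm (real (C * (n + 1))) \<le> real (2 * C) * norm (real n)" by simp
  qed
qed

lemma BBC_bounds:
  assumes G: "simple_graph G" "max_degree G \<le> 4" and lam: "2 \<le> lam"
  shows "matching G M \<Longrightarrow> BBC lam G (spanned_by G M) \<le> 2 * lam + 1"
    and "spanning_subgraph H G \<Longrightarrow> degenerate 1 H \<Longrightarrow> BBC lam G H \<le> 2 * lam + 2"
proof -
  obtain f where "bij_betw f (verts G) {0..<card (verts G)}"
    using ex_bij_betw_finite_nat[OF simple_graphD(1)[OF G(1)]] by blast
  then have f: "inj_on f (verts G)" "f ` verts G = {..<card (verts G)}"
    by (auto simp: bij_betw_def lessThan_atLeast0)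
  let ?G = "relabel f G"
  have G': "simple_graph ?G" "max_degree ?G \<le> 4" "verts ?G = {..<card (verts G)}"
    using simple_relabel[OF G(1) f(1)] max_degree_relabel[OF G(1) f(1)] G(2) f(2) by (auto simp: relabel_def)
  show "BBC lam G (spanned_by G M) \<le> 2 * lam + 1" if M: "matching G M"
  proof -
    have e: "relabel f (spanned_by G M) = spanned_by ?G ((`) f ` M)" by (simp add: relabel_def spanned_by_def)
    have M': "matching ?G ((`) f ` M)" by (rule matching_relabel[OF G(1) f(1) M])
    have "\<exists>c. backbone_k_coloring lam (2 * lam + 1) ?G (spanned_by ?G ((`) f ` M)) c"
      by (rule finds_coloring_exists[OF matching_finds[OF G'(1,2) lam M'] G'(1,3)])
        (use M' in \<open>auto simp: spanned_by_def matching_def\<close>)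
    then obtain c where "backbone_k_coloring lam (2 * lam + 1) ?G (relabel f (spanned_by G M)) c" unfolding e by blast
    then show ?thesis using coloring_relabel[OF G(1) f(1), of "spanned_by G M"] BBC_le by (force simp: spanned_by_def)
  qed
  show "BBC lam G H \<le> 2 * lam + 2" if H: "spanning_subgraph H G" "degenerate 1 H"
  proof -
    have h: "verts H = verts G" "edges H \<subseteq> edges G" using H(1) by (auto simp: spanning_subgraph_def)
    have d: "degenerate 1 (relabel f H)" by (rule degenerate_relabel[OF G(1) f(1) h H(2)])
    have s: "spanning_subgraph (relabel f H) ?G" using h by (auto simp: spanning_subgraph_def relabel_def)
    have "\<exists>c. backbone_k_coloring lam (2 * lam + 2) ?G (relabel f H) c"
      by (rule finds_coloring_exists[OF forest_finds[OF G'(1,2) lam s d] G'(1,3)])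
        (use s in \<open>auto simp: spanning_subgraph_def\<close>)
    then show ?thesis using coloring_relabel[OF G(1) f(1) h(1)] BBC_le by blast
  qed
qed

theorem theorem9:
  "(\<forall>(G :: 'a ugraph) (lam :: nat). simple_graph G \<and> max_degree G \<le> 4 \<and> 2 \<le> lam \<longrightarrow>
      (\<forall>M. matching G M \<longrightarrow> BBC lam G (spanned_by G M) \<le> 2 * lam + 1) \<and>
      (\<forall>H. spanning_subgraph H G \<and> degenerate 1 H \<longrightarrow> BBC lam G H \<le> 2 * lam + 2))
   \<and>
   (\<exists>(p :: com) (T :: nat \<Rightarrow> nat). (\<lambda>n. real (T n)) \<in> O(\<lambda>n. real n) \<and>
      (\<forall>(G :: nat ugraph) (lam :: nat) M.
         simple_graph G \<and> max_degree G \<le> 4 \<and> 2 \<le> lam \<and> matching G M \<longrightarrow>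
         finds_coloring_in_time p T lam (2 * lam + 1) G (spanned_by G M)))
   \<and>
   (\<exists>(p :: com) (T :: nat \<Rightarrow> nat). (\<lambda>n. real (T n)) \<in> O(\<lambda>n. real n) \<and>
      (\<forall>(G :: nat ugraph) (lam :: nat) H.
         simple_graph G \<and> max_degree G \<le> 4 \<and> 2 \<le> lam \<and> spanning_subgraph H G \<and> degenerate 1 H \<longrightarrow>
         finds_coloring_in_time p T lam (2 * lam + 2) G H))"
proof (intro conjI)
  show "\<forall>(G :: 'a ugraph) (lam :: nat). simple_graph G \<and> max_degree G \<le> 4 \<and> 2 \<le> lam \<longrightarrow>
      (\<forall>M. matching G M \<longrightarrow> BBC lam G (spanned_by G M) \<le> 2 * lam + 1) \<and>
      (\<forall>H. spanning_subgraph H G \<and> degenerate 1 H \<longrightarrow> BBC lam G H \<le> 2 * lam + 2)"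
    using BBC_bounds by blast
  show "\<exists>(p :: com) (T :: nat \<Rightarrow> nat). (\<lambda>n. real (T n)) \<in> O(\<lambda>n. real n) \<and>
      (\<forall>(G :: nat ugraph) (lam :: nat) M.
         simple_graph G \<and> max_degree G \<le> 4 \<and> 2 \<le> lam \<and> matching G M \<longrightarrow>
         finds_coloring_in_time p T lam (2 * lam + 1) G (spanned_by G M))"
  proof (intro exI conjI)
    show "(\<lambda>n. real (matching_cost * (n + 1))) \<in> O(\<lambda>n. real n)" by (rule linear_in_bigo)
  qed (use matching_finds in blast)
  show "\<exists>(p :: com) (T :: nat \<Rightarrow> nat). (\<lambda>n. real (T n)) \<in> O(\<lambda>n. real n) \<and>
      (\<forall>(G :: nat ugraph) (lam :: nat) H.
         simple_graph G \<and> max_degree G \<le> 4 \<and> 2 \<le> lam \<and> spanning_subgraph H G \<and> degenerate 1 H \<longrightarrow>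
         finds_coloring_in_time p T lam (2 * lam + 2) G H)"
  proof (intro exI conjI)
    show "(\<lambda>n. real (forest_cost * (n + 1))) \<in> O(\<lambda>n. real n)" by (rule linear_in_bigo)
  qed (use forest_finds in blast)
qed

end
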